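(* Let $S,R\in\mathcal B_T(H)$ and $a\in A$. Then (i) $(S+R)^*=S^*+R^*$; (ii) $(aS)^*=aS^*$; (iii) $(SR)^*=R^*S^*$; (iv) $(S^* )^*=S$; (v) $I^*=I$, where $I$ is the identity operator on $H$.
   Context: Setting. All spaces are real. $E$ is a Dedekind complete Riesz space with weak order unit $e$. $T:E\to E$ is a conditional expectation operator, i.e. a positive order-continuous linear projection whose range is a Dedekind complete Riesz subspace and which maps weak order units to weak order units; it satisfies $Te=e$ and is strictly positive ($x\ge 0$ and $Tx=0$ imply $x=0$). $E^u$ is the universal completion of $E$, with its $f$-algebra multiplication having unit $e$. $L^1(T)\subseteq E^u$ is the natural domain of $T$: the set of differences $f_1-f_2$ with $f_i\in E^u_+$ such that there is a net $(f_\alpha)$ in $E_+$ with $f_\alpha\uparrow f_i$ in $E^u$ and $(Tf_\alpha)$ bounded above in $E^u$; $T$ is extended to $L^1(T)$ by $Tf_i=\sup_\alpha Tf_\alpha$, and the extension, still denoted $T$, is again a strictly positive conditional expectation on $L^1(T)$ with $Te=e$. $A:=R(T)$ is the range of the (extended) $T$; it is a Dedekind complete unital Archimedean $f$-algebra with unit $e$, and $T(az)=aT(z)$ for $a\in A$ whenever the products are defined. $H:=L^2(T)=\{x\in L^1(T):x^2\in L^1(T)\}$ with the inherited order is a Dedekind complete Riesz space and an $A$-module. For $x,y\in H$, $\langle x,y\rangle_T:=T(xy)\in A$ and $\|x\|_{T,2}:=(T(x^2))^{1/2}\in A_+$ (the positive square root in $A$). Definitions. $\mathcal B_T(H)$ is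 the set of $A$-linear (additive and $A$-homogeneous) maps $S:H\to H$ that are $T$-strongly bounded: there is $k\in A_+$ with $\|Sx\|_{T,2}\le k\|x\|_{T,2}$ for all $x\in H$. It is a unital algebra under composition, and $(aS)x:=a(Sx)$ for $a\in A$. For $S\in\mathcal B_T(H)$, the adjoint $S^*$ is the unique operator in $\mathcal B_T(H)$ with $\langle Sx,y\rangle_T=\langle x,S^*y\rangle_T$ for all $x,y\in H$ (it always exists). *)

theory Defs
  imports "HOL-Analysis.Analysis" "HOL-Library.Lattice_Algebras" "HOL-Library.Lub_Glb"
begin

section \<open>Riesz spaces\<close>

class riesz_space = ordered_real_vector + lattice_ab_group_add_abs

class dedekind_complete_riesz_space = riesz_space + conditionally_complete_lattice

definition disjoint_elts :: "'a::riesz_space \<Rightarrow> 'a \<Rightarrow> bool" where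
  "disjoint_elts x y \<longleftrightarrow> inf \<bar>x\<bar> \<bar>y\<bar> = 0"

text \<open>Lateral completeness: every set of pairwise disjoint positive elements has a supremum.
  By Dedekind completeness it is enough to ask for an upper bound.\<close>

class universally_complete_riesz_space = dedekind_complete_riesz_space +
  assumes disjoint_bdd_above:
    "(\<And>x. x \<in> D \<Longrightarrow> 0 \<le> x) \<Longrightarrow> (\<And>x y. x \<in> D \<Longrightarrow> y \<in> D \<Longrightarrow> x \<noteq> y \<Longrightarrow> inf \<bar>x\<bar> \<bar>y\<bar> = 0) \<Longrightarrow> bdd_above D"

text \<open>The multiplicative unit is not part of the class; it is required separately, so that the
  zero space is not excluded.\<close>

class f_algebra = riesz_space + real_algebra + lattice_ring +
  assumes f_algebra_left: "inf a b = 0 \<Longrightarrow> 0 \<le> c \<Longrightarrow> inf (c * a) b = 0"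
    and f_algebra_right: "inf a b = 0 \<Longrightarrow> 0 \<le> c \<Longrightarrow> inf (a * c) b = 0"

definition weak_order_unit :: "'a::riesz_space \<Rightarrow> bool" where
  "weak_order_unit e \<longleftrightarrow> 0 \<le> e \<and> (\<forall>x. inf \<bar>x\<bar> e = 0 \<longrightarrow> x = 0)"

definition riesz_subspace :: "'a::riesz_space set \<Rightarrow> bool" where
  "riesz_subspace V \<longleftrightarrow> subspace V \<and> (\<forall>x\<in>V. \<forall>y\<in>V. sup x y \<in> V \<and> inf x y \<in> V)"

text \<open>Suprema are formed in \<open>V\<close> itself, not in the ambient space.\<close>

definition dedekind_complete_on :: "'a::riesz_space set \<Rightarrow> bool" where
  "dedekind_complete_on V \<longleftrightarrow>
     (\<forall>D\<subseteq>V. D \<noteq> {} \<longrightarrow> (\<exists>b. isUb V D b) \<longrightarrow> (\<exists>s. isLub V D s))"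

text \<open>Increasing nets are represented by their ranges, which are upward directed sets.\<close>

definition up_directed :: "'a::order set \<Rightarrow> bool" where
  "up_directed D \<longleftrightarrow> D \<noteq> {} \<and> (\<forall>x\<in>D. \<forall>y\<in>D. \<exists>z\<in>D. x \<le> z \<and> y \<le> z)"

definition positive_map :: "('a::riesz_space \<Rightarrow> 'b::riesz_space) \<Rightarrow> bool" where
  "positive_map T \<longleftrightarrow> (\<forall>x\<ge>0. 0 \<le> T x)"

text \<open>Order continuity of a positive linear map: \<open>x\<^sub>\<alpha> \<up> x\<close> implies \<open>T x\<^sub>\<alpha> \<up> T x\<close>.\<close>

definition order_continuous :: "('a::riesz_space \<Rightarrow> 'b::riesz_space) \<Rightarrow> bool" where
  "order_continuous T \<longleftrightarrow>
     (\<forall>D x. up_directed D \<longrightarrow> isLub UNIV D x \<longrightarrow> isLub UNIV (T ` D) (T x))"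

definition strictly_positive :: "('a::riesz_space \<Rightarrow> 'b::riesz_space) \<Rightarrow> bool" where
  "strictly_positive T \<longleftrightarrow> (\<forall>x\<ge>0. T x = 0 \<longrightarrow> x = 0)"

definition conditional_expectation :: "('a::dedekind_complete_riesz_space \<Rightarrow> 'a) \<Rightarrow> bool" where
  "conditional_expectation T \<longleftrightarrow>
     linear T \<and> positive_map T \<and> order_continuous T \<and> T \<circ> T = T \<and>
     riesz_subspace (range T) \<and> dedekind_complete_on (range T) \<and>
     (\<forall>w. weak_order_unit w \<longrightarrow> weak_order_unit (T w))"


section \<open>Universal completion and natural domain\<close>

text \<open>A universal completion of \<open>'e\<close> is a universally complete space \<open>'u\<close> together with a Riesz
  isomorphism \<open>\<iota>\<close> of \<open>'e\<close> onto an order dense Riesz subspace of \<open>'u\<close>; it is unique up to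
  isomorphism.\<close>

definition universal_completion ::
    "('e::dedekind_complete_riesz_space \<Rightarrow> 'u::universally_complete_riesz_space) \<Rightarrow> bool" where
  "universal_completion \<iota> \<longleftrightarrow>
     linear \<iota> \<and> inj \<iota> \<and> (\<forall>x y. \<iota> (sup x y) = sup (\<iota> x) (\<iota> y)) \<and>
     (\<forall>u>0. \<exists>x. 0 < \<iota> x \<and> \<iota> x \<le> u)"

definition mult_unit :: "'u::f_algebra \<Rightarrow> bool" where
  "mult_unit u \<longleftrightarrow> (\<forall>z. u * z = z \<and> z * u = z)"

text \<open>\<open>D\<close> is (the range of) a net in \<open>E\<^sub>+\<close> increasing to \<open>f\<close> in \<open>E\<^sup>u\<close> whose image under \<open>T\<close> is
  bounded above in \<open>E\<^sup>u\<close>.\<close>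

definition approx_net ::
    "('e::dedekind_complete_riesz_space \<Rightarrow> 'u::universally_complete_riesz_space) \<Rightarrow>
     ('e \<Rightarrow> 'e) \<Rightarrow> 'e set \<Rightarrow> 'u \<Rightarrow> bool" where
  "approx_net \<iota> T D f \<longleftrightarrow>
     up_directed D \<and> (\<forall>x\<in>D. 0 \<le> x) \<and> isLub UNIV (\<iota> ` D) f \<and> bdd_above (\<iota> ` T ` D)"

definition L1_pos where
  "L1_pos \<iota> T = {f. 0 \<le> f \<and> (\<exists>D. approx_net \<iota> T D f)}"

definition L1 where
  "L1 \<iota> T = {f1 - f2 | f1 f2. f1 \<in> L1_pos \<iota> T \<and> f2 \<in> L1_pos \<iota> T}"

text \<open>The description operators below express that the value depends neither on the net nor on
  the decomposition.\<close>

definition T_pos where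
  "T_pos \<iota> T f = (THE g. \<exists>D. approx_net \<iota> T D f \<and> isLub UNIV (\<iota> ` T ` D) g)"

definition T_ext where
  "T_ext \<iota> T z = (THE w. \<exists>f1\<in>L1_pos \<iota> T. \<exists>f2\<in>L1_pos \<iota> T.
     z = f1 - f2 \<and> w = T_pos \<iota> T f1 - T_pos \<iota> T f2)"

definition range_T where
  "range_T \<iota> T = T_ext \<iota> T ` L1 \<iota> T"


section \<open>The space $L^2(T)$ and its $T$-strongly bounded operators\<close>

definition L2 ::
    "('e::dedekind_complete_riesz_space \<Rightarrow> 'u::{universally_complete_riesz_space,f_algebra}) \<Rightarrow>
     ('e \<Rightarrow> 'e) \<Rightarrow> 'u set" where
  "L2 \<iota> T = {x \<in> L1 \<iota> T. x * x \<in> L1 \<iota> T}"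

definition T_inner where
  "T_inner \<iota> T x y = T_ext \<iota> T (x * y :: 'u::{universally_complete_riesz_space,f_algebra})"

definition T_norm where
  "T_norm \<iota> T x = (THE r. r \<in> range_T \<iota> T \<and> 0 \<le> r \<and>
     r * r = T_ext \<iota> T (x * x :: 'u::{universally_complete_riesz_space,f_algebra}))"

text \<open>Operators on \<open>H = L2 \<iota> T\<close> are extensional functions (\<open>undefined\<close> outside \<open>H\<close>), so that
  equality of operators is equality in HOL.\<close>

definition T_bounded_ops ::
    "('e::dedekind_complete_riesz_space \<Rightarrow> 'u::{universally_complete_riesz_space,f_algebra}) \<Rightarrow>
     ('e \<Rightarrow> 'e) \<Rightarrow> ('u \<Rightarrow> 'u) set" where
  "T_bounded_ops \<iota> T = {S \<in> L2 \<iota> T \<rightarrow>\<^sub>E L2 \<iota> T.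
     (\<forall>x\<in>L2 \<iota> T. \<forall>y\<in>L2 \<iota> T. S (x + y) = S x + S y) \<and>
     (\<forall>a\<in>range_T \<iota> T. \<forall>x\<in>L2 \<iota> T. S (a * x) = a * S x) \<and>
     (\<exists>k\<in>range_T \<iota> T. 0 \<le> k \<and> (\<forall>x\<in>L2 \<iota> T. T_norm \<iota> T (S x) \<le> k * T_norm \<iota> T x))}"

definition op_add where
  "op_add \<iota> T S R = (\<lambda>x\<in>L2 \<iota> T. S x + R x)"

definition op_scale where
  "op_scale \<iota> T a S = (\<lambda>x\<in>L2 \<iota> T. a * S x)"

definition op_comp where
  "op_comp \<iota> T S R = compose (L2 \<iota> T) S R"

definition op_id where
  "op_id \<iota> T = (\<lambda>x\<in>L2 \<iota> T. x)"

definition op_adjoint where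
  "op_adjoint \<iota> T S = (THE S'. S' \<in> T_bounded_ops \<iota> T \<and>
     (\<forall>x\<in>L2 \<iota> T. \<forall>y\<in>L2 \<iota> T. T_inner \<iota> T (S x) y = T_inner \<iota> T x (S' y)))"

end

theory Submission
  imports Defs
begin

text \<open>All five identities follow from uniqueness of adjoints once every \<open>T\<close>-strongly bounded operator
  is known to have one, so the work lies in a Riesz representation theorem for \<open>H\<close>.

  Inequalities between finitely many elements of \<open>E\<^sup>u\<close> are reduced to inequalities between reals:
  elements of an Archimedean unital \<open>f\<close>-algebra are separated by real valued lattice and algebra
  homomorphisms on solid subalgebras, obtained from maximal \<open>\<ell>\<close>-ideals. In this way
  \<open>x\<^sup>2 = sup\<^sub>t (2 t x - t\<^sup>2)\<close> gives the Jensen inequality \<open>(T x)\<^sup>2 \<le> T (x\<^sup>2)\<close>; with strict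
  positivity it shows that \<open>A\<close> is a subalgebra, and positivity of the form \<open>T (x y) - T x * T y\<close>
  yields the averaging property \<open>T (a x) = a T x\<close>.

  A bounded \<open>A\<close>-linear functional on \<open>H\<close> is a difference of positive ones (Riesz-Kantorovich), and a
  positive one \<open>\<psi>\<close> is represented by the supremum of all \<open>x \<ge> 0\<close> with \<open>T (x h) \<le> \<psi> h\<close> for
  \<open>h \<ge> 0\<close>. This supremum exists because lateral completeness of \<open>E\<^sup>u\<close> makes every upward directed
  set on which \<open>T\<close> is bounded order bounded.\<close>

section \<open>Real points of unital f-algebras\<close>

text \<open>In general no single real homomorphism is finite on all of E^u, so every comparison
  picks a point whose subalgebra \<open>V\<close> contains the finitely many elements involved.
  Evaluation at a point need not commute with infinite suprema or infima. Facts about those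
  (\<open>mult_isLub\<close>, \<open>sqrt_exists\<close>, the representation theorem) therefore
  follow one scheme: if the extremal element failed, a small perturbation of it, built by lattice
  and algebra operations, would contradict its extremality, and points only serve to check the
  inequalities for that perturbation. H is handled through order completeness instead of norm
  completeness. Bounds on functionals have the form \<phi> x \<le> t c + T(x^2) / t for all real t >
  0: this involves no root and no division in A, a fixed t gives a priori bounds, and t tending to 0
  replaces order continuity of the functional.\<close>

lemma scaleR_inf_distrib:
  fixes a b :: "'a::riesz_space"
  assumes "0 \<le> c"
  shows "c *\<^sub>R inf a b = inf (c *\<^sub>R a) (c *\<^sub>R b)"
proof (cases "c = 0")
  case False
  with assms have c: "0 < c" by simp
  show ?thesis
  proof (rule antisym)
    show "c *\<^sub>R inf a b \<le> inf (c *\<^sub>R a) (c *\<^sub>R b)"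
      using assms by (simp add: scaleR_left_mono)
    have "inf (c *\<^sub>R a) (c *\<^sub>R b) /\<^sub>R c \<le> inf a b"
      using c by (simp add: pos_divideR_le_eq)
    then show "inf (c *\<^sub>R a) (c *\<^sub>R b) \<le> c *\<^sub>R inf a b"
      unfolding pos_divideR_le_eq[OF c] .
  qed
qed simp

lemma scaleR_sup_distrib:
  fixes a b :: "'a::riesz_space"
  assumes "0 \<le> c"
  shows "c *\<^sub>R sup a b = sup (c *\<^sub>R a) (c *\<^sub>R b)"
  using scaleR_inf_distrib[OF assms, of "- a" "- b"] by (simp flip: neg_sup_eq_inf)

lemma inf_pprt_uminus:
  fixes x :: "'a::riesz_space"
  shows "inf (pprt x) (pprt (- x)) = 0"
proof -
  have "inf (pprt x) (pprt (- x)) = pprt (- x) + inf (pprt x - pprt (- x)) 0"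
    by (simp add: add_inf_distrib_left)
  also have "pprt x - pprt (- x) = x"
    using prts[of x] by (simp add: pprt_neg)
  also have "pprt (- x) + inf x 0 = 0"
    by (simp add: pprt_neg flip: nprt_def)
  finally show ?thesis .
qed

lemma pprt_diff_pprt_uminus:
  fixes x :: "'a::riesz_space"
  shows "pprt x - pprt (- x) = x"
  using prts[of x] by (simp add: pprt_neg)

lemma twice_pprt:
  fixes x :: "'a::riesz_space"
  shows "2 *\<^sub>R pprt x = x + \<bar>x\<bar>"
  using prts[of x] abs_prts[of x] by (metis add.commute add_diff_cancel_left' diff_add_eq group_cancel.sub1 scaleR_2 pprt_diff_pprt_uminus)

lemma abs_scaleR_riesz:
  fixes x :: "'a::riesz_space"
  shows "\<bar>c *\<^sub>R x\<bar> = \<bar>c\<bar> *\<^sub>R \<bar>x\<bar>"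
proof -
  have pos: "\<bar>d *\<^sub>R x\<bar> = d *\<^sub>R \<bar>x\<bar>" if "0 \<le> d" for d
    by (simp add: abs_lattice scaleR_sup_distrib[OF that])
  show ?thesis
    using pos[of c] pos[of "- c"] by (cases "0 \<le> c") auto
qed

text \<open>The multiples n x^+ stay below |y|; Dedekind completeness gives them a supremum s, and
  then s \<le> s - x^+. Arguments below in which a real t tends to 0 end with this lemma.\<close>

lemma riesz_archimedean:
  fixes x y :: "'a::dedekind_complete_riesz_space"
  assumes "\<And>t::real. 0 < t \<Longrightarrow> x \<le> t *\<^sub>R y"
  shows "x \<le> 0"
proof -
  have bd: "real n *\<^sub>R pprt x \<le> \<bar>y\<bar>" for n
  proof (cases "n = 0")
    case False
    have "x \<le> inverse (real n) *\<^sub>R y" using assms False by simp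
    also have "\<dots> \<le> inverse (real n) *\<^sub>R \<bar>y\<bar>"
      by (intro scaleR_left_mono abs_ge_self) auto
    finally have "pprt x \<le> \<bar>y\<bar> /\<^sub>R real n"
      by (simp add: pprt_def scaleR_nonneg_nonneg)
    then show ?thesis using False by (simp add: pos_le_divideR_eq)
  qed simp
  let ?D = "range (\<lambda>n. real n *\<^sub>R pprt x)"
  have "bdd_above ?D" using bd by (auto intro!: bdd_aboveI)
  then have "real n *\<^sub>R pprt x \<le> Sup ?D - pprt x" for n
    using cSup_upper[OF rangeI[of "\<lambda>n. real n *\<^sub>R pprt x" "Suc n"]]
    by (simp add: scaleR_left_distrib algebra_simps)
  then have "Sup ?D \<le> Sup ?D - pprt x"
    by (intro cSup_least) auto
  then show ?thesis by (simp add: pprt_def le_supE)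
qed

text \<open>Multiplying one of two disjoint elements by a positive element keeps them disjoint:
  first a * b becomes disjoint from a, then from itself.\<close>

lemma f_algebra_disjoint_mult:
  fixes a b :: "'a::f_algebra"
  assumes "inf a b = 0"
  shows "a * b = 0"
proof -
  have a: "0 \<le> a" and b: "0 \<le> b" using assms by (metis inf_le1, metis inf_le2)
  have "inf (a * b) a = 0"
    using f_algebra_left[of b a a] assms a by (simp add: inf_commute)
  then have "inf (a * b) (a * b) = 0"
    using f_algebra_right[of a "a * b" b] b by (simp add: inf_commute)
  then show ?thesis by simp
qed

text \<open>The cross terms of x^+ and x^- vanish, so the square is the sum of their
  squares.\<close>

lemma f_algebra_square_nonneg:
  fixes x :: "'a::f_algebra"
  shows "0 \<le> x * x"
proof -
  let ?p = "pprt x" and ?n = "pprt (- x)"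
  have 1: "?p * ?n = 0" "?n * ?p = 0"
    using f_algebra_disjoint_mult[of ?p ?n] f_algebra_disjoint_mult[of ?n ?p] inf_pprt_uminus[of x]
    by (simp_all add: inf_commute)
  have "x * x = (?p - ?n) * (?p - ?n)" by (simp only: pprt_diff_pprt_uminus)
  also have "\<dots> = ?p * ?p + ?n * ?n" using 1 by (simp add: algebra_simps)
  also have "\<dots> \<ge> 0" by (intro add_nonneg_nonneg mult_nonneg_nonneg) (simp_all)
  finally show ?thesis .
qed

section \<open>Order ideals and maximality\<close>

definition lideal :: "'a::riesz_space set \<Rightarrow> bool" where
  "lideal M \<longleftrightarrow> 0 \<in> M \<and> (\<forall>a\<in>M. \<forall>b\<in>M. a + b \<in> M) \<and> (\<forall>a\<in>M. \<forall>c::real. c *\<^sub>R a \<in> M) \<and>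
     (\<forall>b\<in>M. \<forall>a. \<bar>a\<bar> \<le> \<bar>b\<bar> \<longrightarrow> a \<in> M)"

text \<open>N is the order ideal generated by M and a. Describing it by a bound on |x| instead of by
  sums makes solidity immediate.\<close>

lemma lideal_adjoin:
  fixes M :: "'a::riesz_space set" and a :: 'a
  assumes "lideal M"
  defines "N \<equiv> {x. \<exists>m\<in>M. \<exists>n::real. 0 \<le> n \<and> \<bar>x\<bar> \<le> \<bar>m\<bar> + n *\<^sub>R \<bar>a\<bar>}"
  shows "lideal N" "M \<subseteq> N" "a \<in> N"
proof -
  have M: "0 \<in> M" "\<And>a b. a \<in> M \<Longrightarrow> b \<in> M \<Longrightarrow> a + b \<in> M" "\<And>a c. a \<in> M \<Longrightarrow> c *\<^sub>R a \<in> M"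
    "\<And>a b. b \<in> M \<Longrightarrow> \<bar>a\<bar> \<le> \<bar>b\<bar> \<Longrightarrow> a \<in> M"
    using assms(1) unfolding lideal_def by blast+
  have NI: "x \<in> N" if "m \<in> M" "0 \<le> n" "\<bar>x\<bar> \<le> \<bar>m\<bar> + n *\<^sub>R \<bar>a\<bar>" for x m n
    unfolding N_def using that by blast
  have abs_mem: "\<bar>m\<bar> \<in> M" if "m \<in> M" for m by (rule M(4)[OF that]) simp
  show sub: "M \<subseteq> N" by (auto intro: NI[of _ 0])
  show "a \<in> N" by (rule NI[OF M(1), of 1]) simp_all
  show "lideal N"
    unfolding lideal_def
  proof (intro conjI ballI allI impI)
    show "0 \<in> N" using sub M by blast
  next
    fix x y assume "x \<in> N" "y \<in> N"
    then obtain m n m' n' where *: "m \<in> M" "m' \<in> M" "0 \<le> n" "0 \<le> n'"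
      "\<bar>x\<bar> \<le> \<bar>m\<bar> + n *\<^sub>R \<bar>a\<bar>" "\<bar>y\<bar> \<le> \<bar>m'\<bar> + n' *\<^sub>R \<bar>a\<bar>" unfolding N_def by blast
    have "\<bar>x + y\<bar> \<le> \<bar>x\<bar> + \<bar>y\<bar>" by (rule abs_triangle_ineq)
    also have "\<dots> \<le> (\<bar>m\<bar> + n *\<^sub>R \<bar>a\<bar>) + (\<bar>m'\<bar> + n' *\<^sub>R \<bar>a\<bar>)" using * by (intro add_mono)
    also have "\<dots> = \<bar>\<bar>m\<bar> + \<bar>m'\<bar>\<bar> + (n + n') *\<^sub>R \<bar>a\<bar>" by (simp add: scaleR_left_distrib)
    finally show "x + y \<in> N" by (rule NI[rotated 2]) (use * abs_mem M in auto)
  next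
    fix x and c :: real assume "x \<in> N"
    then obtain m n where *: "m \<in> M" "0 \<le> n" "\<bar>x\<bar> \<le> \<bar>m\<bar> + n *\<^sub>R \<bar>a\<bar>" unfolding N_def by blast
    have "\<bar>c *\<^sub>R x\<bar> \<le> \<bar>c\<bar> *\<^sub>R (\<bar>m\<bar> + n *\<^sub>R \<bar>a\<bar>)"
      unfolding abs_scaleR_riesz using * by (intro scaleR_left_mono) auto
    also have "\<dots> = \<bar>c *\<^sub>R m\<bar> + (\<bar>c\<bar> * n) *\<^sub>R \<bar>a\<bar>" by (simp add: abs_scaleR_riesz scaleR_right_distrib)
    finally show "c *\<^sub>R x \<in> N" by (rule NI[rotated 2]) (use * M in auto)
  next
    fix x y assume "x \<in> N" "\<bar>y\<bar> \<le> \<bar>x\<bar>"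
    then show "y \<in> N" unfolding N_def by (blast intro: order_trans)
  qed
qed

text \<open>The hypothesis on d says that u lies outside the order ideal generated by d, so Zorn's
  lemma applies to the ideals that contain d and omit u. The last conclusion is maximality in usable
  form: adjoining any further a captures u.\<close>

lemma maximal_lideal:
  fixes u d :: "'a::riesz_space"
  assumes u: "0 \<le> u" and d: "\<And>n::real. 0 \<le> n \<Longrightarrow> \<not> u \<le> n *\<^sub>R \<bar>d\<bar>"
  obtains M where "lideal M" "u \<notin> M" "d \<in> M"
    "\<And>a. a \<notin> M \<Longrightarrow> \<exists>m\<in>M. \<exists>n::real. 0 \<le> n \<and> u \<le> \<bar>m\<bar> + n *\<^sub>R \<bar>a\<bar>"
proof -
  let ?A = "{M. lideal M \<and> u \<notin> M \<and> d \<in> M}"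
  have l0: "lideal {0::'a}" by (simp add: lideal_def)
  have "?A \<noteq> {}"
  proof -
    let ?N = "{x. \<exists>m\<in>{0}. \<exists>n::real. 0 \<le> n \<and> \<bar>x\<bar> \<le> \<bar>m\<bar> + n *\<^sub>R \<bar>d\<bar>}"
    have "u \<notin> ?N" using d u by simp
    then have "?N \<in> ?A" using lideal_adjoin[OF l0, of d] by blast
    then show ?thesis by blast
  qed
  moreover have "\<Union>C \<in> ?A" if "C \<noteq> {}" "subset.chain ?A C" for C
  proof -
    have C: "\<And>M. M \<in> C \<Longrightarrow> lideal M \<and> u \<notin> M \<and> d \<in> M"
      using that unfolding subset.chain_def by blast
    have ch: "\<And>M N. M \<in> C \<Longrightarrow> N \<in> C \<Longrightarrow> M \<subseteq> N \<or> N \<subseteq> M"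
      using that(2) unfolding subset.chain_def by blast
    have "lideal (\<Union>C)"
      unfolding lideal_def
    proof (intro conjI ballI allI impI)
      obtain M where "M \<in> C" using \<open>C \<noteq> {}\<close> by blast
      with C have "0 \<in> M" unfolding lideal_def by blast
      with \<open>M \<in> C\<close> show "0 \<in> \<Union>C" by blast
    next
      fix a b assume "a \<in> \<Union>C" "b \<in> \<Union>C"
      then obtain M N where *: "M \<in> C" "N \<in> C" "a \<in> M" "b \<in> N" by blast
      then obtain K where K: "K \<in> C" "a \<in> K" "b \<in> K" using ch[of M N] by blast
      with C have "a + b \<in> K" unfolding lideal_def by blast
      with K show "a + b \<in> \<Union>C" by blast
    next
      fix a and c :: real assume "a \<in> \<Union>C"
      then obtain K where K: "K \<in> C" "a \<in> K" by blast
      with C have "c *\<^sub>R a \<in> K" unfolding lideal_def by blast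
      with K show "c *\<^sub>R a \<in> \<Union>C" by blast
    next
      fix b a assume "b \<in> \<Union>C" and ab: "\<bar>a\<bar> \<le> \<bar>b\<bar>"
      then obtain K where K: "K \<in> C" "b \<in> K" by blast
      with C ab have "a \<in> K" unfolding lideal_def by blast
      with K show "a \<in> \<Union>C" by blast
    qed
    then show ?thesis using C that(1) by blast
  qed
  ultimately obtain M where M: "M \<in> ?A" and max: "\<And>N. N \<in> ?A \<Longrightarrow> M \<subseteq> N \<Longrightarrow> N = M"
    using subset_Zorn_nonempty[of ?A] by blast
  show thesis
  proof (rule that[of M])
    fix a assume a: "a \<notin> M"
    let ?N = "{x. \<exists>m\<in>M. \<exists>n::real. 0 \<le> n \<and> \<bar>x\<bar> \<le> \<bar>m\<bar> + n *\<^sub>R \<bar>a\<bar>}"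
    have N: "lideal ?N" "M \<subseteq> ?N" "a \<in> ?N" using lideal_adjoin[of M a] M by auto
    then have "?N \<noteq> M" using a by blast
    then have "u \<in> ?N" using max[of ?N] N M by blast
    then show "\<exists>m\<in>M. \<exists>n::real. 0 \<le> n \<and> u \<le> \<bar>m\<bar> + n *\<^sub>R \<bar>a\<bar>" using u by simp
  qed (use M in auto)
qed

text \<open>Positive parts, and through them sup and inf, are expressed by |.| and linear
  operations. Preservation of or closure under |.| is then all that has to be checked.\<close>

lemma pprt_eq:
  fixes x y :: "'a::riesz_space"
  shows "pprt x = (1/2) *\<^sub>R (x + \<bar>x\<bar>)"
  unfolding twice_pprt[symmetric] by simp

lemma sup_eq_pprt:
  fixes x y :: "'a::riesz_space"
  shows "sup x y = y + pprt (x - y)"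
  by (simp add: pprt_def add_sup_distrib_left)

lemma inf_eq_pprt:
  fixes x y :: "'a::riesz_space"
  shows "inf x y = x - pprt (x - y)"
  using add_eq_inf_sup[of x y] by (simp add: sup_eq_pprt algebra_simps)

section \<open>Unital f-algebras and real points\<close>

locale unital_f_algebra =
  fixes one :: "'u::{dedekind_complete_riesz_space,f_algebra}"
  assumes unit: "mult_unit one"
begin

lemma one_mult [simp]: "one * x = x" and mult_one [simp]: "x * one = x"
  using unit by (auto simp: mult_unit_def)

lemma one_nonneg [simp]: "0 \<le> one"
  using f_algebra_square_nonneg[of one] by simp

text \<open>The unit is a weak order unit, because disjoint elements multiply to 0.\<close>

lemma disjoint_one:
  assumes "inf x one = 0"
  shows "x = 0"
  using f_algebra_disjoint_mult[OF assms] by simp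

end

text \<open>For \<open>'u\<close> realised as \<open>C\<^sup>\<infinity>(K)\<close> (extended continuous functions, finite on a dense set),
  \<open>V\<close> consists of the functions that are finite at some point of \<open>K\<close> and \<open>\<omega>\<close> is evaluation
  at that point.\<close>

locale real_point = unital_f_algebra one
  for one :: "'u::{dedekind_complete_riesz_space,f_algebra}" +
  fixes V :: "'u set" and \<omega> :: "'u \<Rightarrow> real"
  assumes V_one [simp]: "one \<in> V"
    and V_add [simp]: "x \<in> V \<Longrightarrow> y \<in> V \<Longrightarrow> x + y \<in> V"
    and V_scaleR [simp]: "x \<in> V \<Longrightarrow> c *\<^sub>R x \<in> V"
    and V_solid: "x \<in> V \<Longrightarrow> \<bar>y\<bar> \<le> \<bar>x\<bar> \<Longrightarrow> y \<in> V"
    and V_mult [simp]: "x \<in> V \<Longrightarrow> y \<in> V \<Longrightarrow> x * y \<in> V"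
    and pt_one [simp]: "\<omega> one = 1"
    and pt_add [simp]: "x \<in> V \<Longrightarrow> y \<in> V \<Longrightarrow> \<omega> (x + y) = \<omega> x + \<omega> y"
    and pt_scaleR [simp]: "x \<in> V \<Longrightarrow> \<omega> (c *\<^sub>R x) = c * \<omega> x"
    and pt_abs [simp]: "x \<in> V \<Longrightarrow> \<omega> \<bar>x\<bar> = \<bar>\<omega> x\<bar>"
    and pt_mult [simp]: "x \<in> V \<Longrightarrow> y \<in> V \<Longrightarrow> \<omega> (x * y) = \<omega> x * \<omega> y"
begin

lemma V_zero [simp]: "0 \<in> V" and pt_zero [simp]: "\<omega> 0 = 0"
  using V_scaleR[OF V_one, of 0] pt_scaleR[OF V_one, of 0] by simp_all

lemma V_uminus [simp]: "x \<in> V \<Longrightarrow> - x \<in> V"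
  using V_scaleR[of x "-1"] by simp

lemma pt_uminus [simp]: "x \<in> V \<Longrightarrow> \<omega> (- x) = - \<omega> x"
  using pt_scaleR[of x "-1"] by simp

lemma V_diff [simp]: "x \<in> V \<Longrightarrow> y \<in> V \<Longrightarrow> x - y \<in> V"
  using V_add[of x "- y"] by simp

lemma pt_diff [simp]: "x \<in> V \<Longrightarrow> y \<in> V \<Longrightarrow> \<omega> (x - y) = \<omega> x - \<omega> y"
  using pt_add[of x "- y"] by simp

lemma V_abs [simp]: "x \<in> V \<Longrightarrow> \<bar>x\<bar> \<in> V"
  by (rule V_solid[of x]) auto

text \<open>Positivity is hidden in \<open>pt_abs\<close>: y - x equals its absolute value, whose
  image is an absolute value.\<close>

lemma pt_mono: "x \<in> V \<Longrightarrow> y \<in> V \<Longrightarrow> x \<le> y \<Longrightarrow> \<omega> x \<le> \<omega> y"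
  using pt_abs[of "y - x"] by simp

lemma V_pprt [simp]: "x \<in> V \<Longrightarrow> pprt x \<in> V"
  and V_sup [simp]: "x \<in> V \<Longrightarrow> y \<in> V \<Longrightarrow> sup x y \<in> V"
  and V_inf [simp]: "x \<in> V \<Longrightarrow> y \<in> V \<Longrightarrow> inf x y \<in> V"
  by (simp_all add: sup_eq_pprt inf_eq_pprt pprt_eq)

lemma pt_pprt [simp]: "x \<in> V \<Longrightarrow> \<omega> (pprt x) = max (\<omega> x) 0"
  by (simp add: pprt_eq)

lemma pt_sup [simp]: "x \<in> V \<Longrightarrow> y \<in> V \<Longrightarrow> \<omega> (sup x y) = max (\<omega> x) (\<omega> y)"
  and pt_inf [simp]: "x \<in> V \<Longrightarrow> y \<in> V \<Longrightarrow> \<omega> (inf x y) = min (\<omega> x) (\<omega> y)"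
  by (simp_all add: sup_eq_pprt inf_eq_pprt max_def min_def)

end

section \<open>Existence of real points and separation\<close>

context unital_f_algebra
begin

text \<open>Maximality makes every element that is bounded modulo M congruent to a unique real
  multiple of \<open>one\<close>; that real is its value. The last conjunct is the finiteness test:
  a bound on |x| modulo M puts x into \<open>V\<close>.\<close>

lemma real_point_of_maximal_lideal:
  assumes M: "lideal M" and one: "one \<notin> M"
    and max: "\<And>a. a \<notin> M \<Longrightarrow> \<exists>m\<in>M. \<exists>n::real. 0 \<le> n \<and> one \<le> \<bar>m\<bar> + n *\<^sub>R \<bar>a\<bar>"
  shows "\<exists>\<omega>. real_point one {x. \<exists>t. x - t *\<^sub>R one \<in> M} \<omega> \<and>
    (\<forall>t x. x - t *\<^sub>R one \<in> M \<longrightarrow> \<omega> x = t) \<and>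
    (\<forall>x t. pprt (\<bar>x\<bar> - t *\<^sub>R one) \<in> M \<longrightarrow> (\<exists>t. x - t *\<^sub>R one \<in> M))"
proof -
  have M0 [simp]: "0 \<in> M" and Madd: "\<And>a b. a \<in> M \<Longrightarrow> b \<in> M \<Longrightarrow> a + b \<in> M"
    and Msc: "\<And>a c. a \<in> M \<Longrightarrow> c *\<^sub>R a \<in> M" and Msol: "\<And>a b. b \<in> M \<Longrightarrow> \<bar>a\<bar> \<le> \<bar>b\<bar> \<Longrightarrow> a \<in> M"
    using M unfolding lideal_def by blast+
  have Mabs: "\<bar>a\<bar> \<in> M" if "a \<in> M" for a using Msol[OF that, of "\<bar>a\<bar>"] by simp
  have Mdiff: "a - b \<in> M" if "a \<in> M" "b \<in> M" for a b
    using Madd[OF that(1) Msc[OF that(2), of "-1"]] by simp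
  have Mpos: "a \<in> M" if "b \<in> M" "0 \<le> a" "a \<le> b" for a b
    using Msol[of b a] that by simp
  have big: False if "c *\<^sub>R one \<le> m" "0 < c" "m \<in> M" for c m
  proof -
    have "c *\<^sub>R one \<in> M" using that by (intro Mpos[OF that(3)]) (simp_all add: scaleR_nonneg_nonneg)
    from Msc[OF this, of "1/c"] show False using that one by simp
  qed
  \<comment> \<open>If both were missing, maximality would give one \<le> k + N a and one \<le> k +
    N b with a common k in M, hence one \<le> k + N inf a b = k.\<close>
  have prime: "a \<in> M \<or> b \<in> M" if ab: "inf a b = 0" for a b
  proof (rule ccontr)
    have a: "0 \<le> a" and b: "0 \<le> b" using ab by (metis inf_le1, metis inf_le2)
    assume "\<not> ?thesis"
    then obtain m n m' n' where *: "m \<in> M" "m' \<in> M" "0 \<le> n" "0 \<le> n'"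
      "one \<le> \<bar>m\<bar> + n *\<^sub>R \<bar>a\<bar>" "one \<le> \<bar>m'\<bar> + n' *\<^sub>R \<bar>b\<bar>" using max by meson
    let ?k = "\<bar>m\<bar> + \<bar>m'\<bar>" and ?N = "n + n'"
    have "n *\<^sub>R a \<le> ?N *\<^sub>R a" "n' *\<^sub>R b \<le> ?N *\<^sub>R b"
      using * a b by (simp_all add: scaleR_right_mono)
    moreover have "\<bar>m\<bar> \<le> ?k" "\<bar>m'\<bar> \<le> ?k" by simp_all
    ultimately have "\<bar>m\<bar> + n *\<^sub>R a \<le> ?k + ?N *\<^sub>R a" "\<bar>m'\<bar> + n' *\<^sub>R b \<le> ?k + ?N *\<^sub>R b"
      by (simp_all add: add_mono)
    moreover have "one \<le> \<bar>m\<bar> + n *\<^sub>R a" "one \<le> \<bar>m'\<bar> + n' *\<^sub>R b"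
      using * a b by simp_all
    ultimately have "one \<le> ?k + ?N *\<^sub>R a" "one \<le> ?k + ?N *\<^sub>R b"
      by (blast intro: order_trans)+
    then have "one - ?k \<le> ?N *\<^sub>R a" "one - ?k \<le> ?N *\<^sub>R b"
      by (simp_all add: diff_le_eq add.commute)
    then have "one - ?k \<le> ?N *\<^sub>R inf a b"
      using * by (simp add: scaleR_inf_distrib)
    with ab have "one \<le> ?k" by simp
    with big[of 1 ?k] * Mabs Madd show False by simp
  qed
  have uniq: "s = t" if "x - t *\<^sub>R one \<in> M" "x - s *\<^sub>R one \<in> M" for s t x
  proof (rule ccontr)
    assume "s \<noteq> t"
    have "(s - t) *\<^sub>R one \<in> M" using Mdiff[OF that] by (simp add: algebra_simps)
    from Msc[OF this, of "1/(s-t)"] show False using \<open>s \<noteq> t\<close> one by simp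
  qed
  \<comment> \<open>A Dedekind cut: the value is the infimum of all t with x \<le> t one modulo M.
    The bound n makes the cut nonempty and -n bounds it below.\<close>
  have finite: "\<exists>t. x - t *\<^sub>R one \<in> M" if x: "pprt (\<bar>x\<bar> - n *\<^sub>R one) \<in> M" for x n
  proof -
    let ?S = "{t. pprt (x - t *\<^sub>R one) \<in> M}"
    have "pprt (x - n *\<^sub>R one) \<in> M"
      by (rule Mpos[OF x]) (simp_all add: pprt_def sup.coboundedI1 abs_ge_self)
    then have ne: "n \<in> ?S" by simp
    have low: "- n \<le> t" if "t \<in> ?S" for t
    proof (rule ccontr)
      assume t: "\<not> - n \<le> t"
      have "x - t *\<^sub>R one \<le> pprt (x - t *\<^sub>R one)" by (simp add: pprt_def)
      moreover have "- x - n *\<^sub>R one \<le> pprt (\<bar>x\<bar> - n *\<^sub>R one)"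
        by (simp add: pprt_def abs_ge_minus_self sup.coboundedI1)
      ultimately have "(x - t *\<^sub>R one) + (- x - n *\<^sub>R one) \<le> pprt (x - t *\<^sub>R one) + pprt (\<bar>x\<bar> - n *\<^sub>R one)"
        by (rule add_mono)
      then have "(- t - n) *\<^sub>R one \<le> pprt (x - t *\<^sub>R one) + pprt (\<bar>x\<bar> - n *\<^sub>R one)"
        by (simp add: algebra_simps)
      with big[of "- t - n"] Madd[of "pprt (x - t *\<^sub>R one)" "pprt (\<bar>x\<bar> - n *\<^sub>R one)"] that x t
      show False by simp
    qed
    define \<tau> where "\<tau> = Inf ?S"
    have bdd: "bdd_below ?S" using low by (rule bdd_belowI)
    have "x - \<tau> *\<^sub>R one \<in> M"
    proof (rule ccontr)
      assume "x - \<tau> *\<^sub>R one \<notin> M"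
      then obtain m k where mk: "m \<in> M" "0 \<le> k" "one \<le> \<bar>m\<bar> + k *\<^sub>R \<bar>x - \<tau> *\<^sub>R one\<bar>"
        using max by blast
      \<comment> \<open>Chosen so that k \<delta> < 1. Once x is within \<delta> of \<tau> modulo M,
        the element (1 - k \<delta>) one is dominated by an element of M, which \<open>big\<close>
        excludes.\<close>
      define \<delta> where "\<delta> = 1 / (2 * (k + 1))"
      have \<delta>: "0 < \<delta>" "k * \<delta> < 1" using mk by (auto simp: \<delta>_def field_simps)
      obtain t where t: "t \<in> ?S" "t < \<tau> + \<delta>"
        using cInf_lessD[of ?S "\<tau> + \<delta>"] ne \<delta> \<tau>_def by auto
      have "x - (\<tau> + \<delta>) *\<^sub>R one \<le> x - t *\<^sub>R one"
        using t by (simp add: scaleR_right_mono)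
      then have "pprt (x - (\<tau> + \<delta>) *\<^sub>R one) \<le> pprt (x - t *\<^sub>R one)"
        by (simp add: pprt_mono)
      then have 1: "pprt (x - (\<tau> + \<delta>) *\<^sub>R one) \<in> M"
        by (rule Mpos[rotated 2]) (use t in simp_all)
      \<comment> \<open>One of the disjoint positive and negative parts lies in M by primeness;
        below the cut it cannot be the positive one.\<close>
      have "\<tau> - \<delta> \<notin> ?S" using cInf_lower[OF _ bdd, of "\<tau> - \<delta>"] \<delta> \<tau>_def by auto
      then have 2: "pprt (- (x - (\<tau> - \<delta>) *\<^sub>R one)) \<in> M"
        using prime[OF inf_pprt_uminus[of "x - (\<tau> - \<delta>) *\<^sub>R one"]] by blast
      let ?u = "pprt (x - (\<tau> + \<delta>) *\<^sub>R one)" and ?v = "pprt (- (x - (\<tau> - \<delta>) *\<^sub>R one))"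
      have "x - \<tau> *\<^sub>R one \<le> \<delta> *\<^sub>R one + ?u + ?v"
      proof -
        have "x - (\<tau> + \<delta>) *\<^sub>R one \<le> ?u + ?v"
          by (rule add_increasing2) (simp_all add: pprt_def)
        then show ?thesis by (simp add: algebra_simps)
      qed
      moreover have "- (x - \<tau> *\<^sub>R one) \<le> \<delta> *\<^sub>R one + ?u + ?v"
      proof -
        have "- (x - (\<tau> - \<delta>) *\<^sub>R one) \<le> ?u + ?v"
          by (rule add_increasing) (simp_all add: pprt_def)
        then show ?thesis by (simp add: algebra_simps)
      qed
      ultimately have "\<bar>x - \<tau> *\<^sub>R one\<bar> \<le> \<delta> *\<^sub>R one + ?u + ?v" by (rule abs_leI)
      then have "k *\<^sub>R \<bar>x - \<tau> *\<^sub>R one\<bar> \<le> k *\<^sub>R (\<delta> *\<^sub>R one + ?u + ?v)"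
        using mk by (intro scaleR_left_mono)
      with mk(3) have "one \<le> \<bar>m\<bar> + k *\<^sub>R (\<delta> *\<^sub>R one + ?u + ?v)"
        by (meson add_left_mono order_trans)
      then have 3: "(1 - k * \<delta>) *\<^sub>R one \<le> \<bar>m\<bar> + k *\<^sub>R (?u + ?v)"
        by (simp add: algebra_simps)
      have 4: "\<bar>m\<bar> + k *\<^sub>R (?u + ?v) \<in> M" using 1 2 mk by (intro Madd Msc Mabs)
      show False by (rule big[OF 3 _ 4]) (use \<delta> in simp)
    qed
    then show ?thesis by blast
  qed
  define V where "V = {x. \<exists>t. x - t *\<^sub>R one \<in> M}"
  define \<omega> where "\<omega> = (\<lambda>x. THE t. x - t *\<^sub>R one \<in> M)"
  have \<omega>: "\<omega> x = t" if "x - t *\<^sub>R one \<in> M" for x t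
    unfolding \<omega>_def using that uniq by blast
  have \<omega>V: "x - \<omega> x *\<^sub>R one \<in> M" if "x \<in> V" for x
    using that \<omega> unfolding V_def by auto
  have abs: "\<bar>x\<bar> - \<bar>t\<bar> *\<^sub>R one \<in> M" if "x - t *\<^sub>R one \<in> M" for x t
  proof (rule Msol[OF that])
    show "\<bar>\<bar>x\<bar> - \<bar>t\<bar> *\<^sub>R one\<bar> \<le> \<bar>x - t *\<^sub>R one\<bar>"
      using abs_triangle_ineq3[of x "t *\<^sub>R one"] by (simp add: abs_scaleR_riesz)
  qed
  have solid: "y \<in> V" if x: "x \<in> V" and "\<bar>y\<bar> \<le> \<bar>x\<bar>" for x y
  proof -
    obtain t where "x - t *\<^sub>R one \<in> M" using x V_def by auto
    then have t: "\<bar>x\<bar> - \<bar>t\<bar> *\<^sub>R one \<in> M" by (rule abs)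
    have "pprt (\<bar>y\<bar> - \<bar>t\<bar> *\<^sub>R one) \<le> \<bar>\<bar>x\<bar> - \<bar>t\<bar> *\<^sub>R one\<bar>"
      using that(2) by (simp add: pprt_def) (meson abs_ge_self diff_right_mono order_trans)
    then have "pprt (\<bar>y\<bar> - \<bar>t\<bar> *\<^sub>R one) \<in> M" by (rule Mpos[OF Mabs[OF t], rotated]) simp_all
    then show ?thesis using finite V_def by blast
  qed
  \<comment> \<open>The part ?p of y above ?N is disjoint from ?q, and so is its product with m. The
    1 in ?N keeps ?q above \<open>one\<close> modulo M, hence outside M; primeness then puts m * ?p
    and ?p * m into M, and below ?N the product is at most a multiple of m.\<close>
  have pos_mult: "m * y \<in> M \<and> y * m \<in> M" if m: "m \<in> M" "0 \<le> m" and y: "y \<in> V" "0 \<le> y" for m y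
  proof -
    let ?N = "\<omega> y + 1"
    let ?p = "pprt (y - ?N *\<^sub>R one)" and ?q = "pprt (- (y - ?N *\<^sub>R one))"
    have pq: "inf ?p ?q = 0" by (rule inf_pprt_uminus)
    have "?q \<notin> M"
    proof
      assume "?q \<in> M"
      with \<omega>V[OF y(1)] have 1: "?q + (y - \<omega> y *\<^sub>R one) \<in> M" by (rule Madd[rotated])
      have 2: "1 *\<^sub>R one \<le> ?q + (y - \<omega> y *\<^sub>R one)"
      proof -
        have "- (y - ?N *\<^sub>R one) \<le> ?q" by (simp add: pprt_def)
        then have "- (y - ?N *\<^sub>R one) + (y - \<omega> y *\<^sub>R one) \<le> ?q + (y - \<omega> y *\<^sub>R one)"
          by (rule add_right_mono)
        then show ?thesis by (simp add: scaleR_left_distrib)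
      qed
      show False by (rule big[OF 2 _ 1]) simp
    qed
    then have mp: "m * ?p \<in> M" "?p * m \<in> M"
      using prime[OF f_algebra_left[OF pq m(2)]] prime[OF f_algebra_right[OF pq m(2)]] by auto
    have y': "y \<le> \<bar>?N\<bar> *\<^sub>R one + ?p"
    proof -
      have "y - ?N *\<^sub>R one \<le> ?p" by (simp add: pprt_def)
      then have "y \<le> ?N *\<^sub>R one + ?p" by (simp add: algebra_simps)
      also have "\<dots> \<le> \<bar>?N\<bar> *\<^sub>R one + ?p" by (intro add_right_mono scaleR_right_mono) auto
      finally show ?thesis .
    qed
    have "m * y \<le> \<bar>?N\<bar> *\<^sub>R m + m * ?p" "y * m \<le> \<bar>?N\<bar> *\<^sub>R m + ?p * m"
      using mult_left_mono[OF y' m(2)] mult_right_mono[OF y' m(2)]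
      by (simp_all add: distrib_left distrib_right)
    moreover have "\<bar>?N\<bar> *\<^sub>R m + m * ?p \<in> M" "\<bar>?N\<bar> *\<^sub>R m + ?p * m \<in> M"
      using m mp by (blast intro: Madd Msc)+
    moreover have "0 \<le> m * y" "0 \<le> y * m" using m y by simp_all
    ultimately show ?thesis using Mpos by blast
  qed
  have multM: "m * y \<in> M \<and> y * m \<in> M" if m: "m \<in> M" and y: "y \<in> V" for m y
  proof -
    have "\<bar>y\<bar> \<in> V" using solid[OF y, of "\<bar>y\<bar>"] by simp
    then have "\<bar>m\<bar> * \<bar>y\<bar> \<in> M \<and> \<bar>y\<bar> * \<bar>m\<bar> \<in> M" using pos_mult Mabs[OF m] by simp
    moreover have "\<bar>m * y\<bar> \<le> \<bar>\<bar>m\<bar> * \<bar>y\<bar>\<bar>" "\<bar>y * m\<bar> \<le> \<bar>\<bar>y\<bar> * \<bar>m\<bar>\<bar>"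
      by (metis abs_ge_self abs_le_mult order_trans)+
    ultimately show ?thesis using Msol by blast
  qed
  have add: "(x + y) - (\<omega> x + \<omega> y) *\<^sub>R one \<in> M" if "x \<in> V" "y \<in> V" for x y
    using Madd[OF \<omega>V[OF that(1)] \<omega>V[OF that(2)]] by (simp add: algebra_simps)
  have sc: "c *\<^sub>R x - (c * \<omega> x) *\<^sub>R one \<in> M" if "x \<in> V" for x c
    using Msc[OF \<omega>V[OF that], of c] by (simp add: algebra_simps)
  \<comment> \<open>Writes the difference as (x - \<omega> x) y + \<omega> x (y - \<omega> y), with
    both summands in M.\<close>
  have mu: "x * y - (\<omega> x * \<omega> y) *\<^sub>R one \<in> M" if "x \<in> V" "y \<in> V" for x y
  proof -
    have "(x - \<omega> x *\<^sub>R one) * y + \<omega> x *\<^sub>R (y - \<omega> y *\<^sub>R one) \<in> M"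
      using multM[OF \<omega>V[OF that(1)] that(2)] Msc[OF \<omega>V[OF that(2)]] by (intro Madd) auto
    then show ?thesis by (simp add: algebra_simps)
  qed
  have o: "one - 1 *\<^sub>R one \<in> M" by simp
  have "real_point one V \<omega>"
  proof unfold_locales
    show "one \<in> V" using o V_def by blast
    show "\<omega> one = 1" using \<omega>[OF o] .
    fix x assume x: "x \<in> V"
    show "c *\<^sub>R x \<in> V" "\<omega> (c *\<^sub>R x) = c * \<omega> x" for c using sc[OF x, of c] V_def \<omega> by auto
    show "\<omega> \<bar>x\<bar> = \<bar>\<omega> x\<bar>" using abs[OF \<omega>V[OF x]] \<omega> by blast
    show "y \<in> V" if "\<bar>y\<bar> \<le> \<bar>x\<bar>" for y using solid[OF x that] .
    fix y assume y: "y \<in> V"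
    show "x + y \<in> V" "\<omega> (x + y) = \<omega> x + \<omega> y" using add[OF x y] V_def \<omega> by auto
    show "x * y \<in> V" "\<omega> (x * y) = \<omega> x * \<omega> y" using mu[OF x y] V_def \<omega> by auto
  qed
  then show ?thesis unfolding V_def using \<omega> finite by blast
qed

text \<open>U dominates everything that must be finite at the point, and w is a nonzero truncation
  of x^+. Forcing (\<delta> U - w)^+ into M does two jobs: \<delta> U \<le> w \<le> one modulo M
  makes U finite, and w \<ge> \<delta> U \<ge> \<delta> one modulo M makes x positive there.\<close>

lemma real_point_exists:
  assumes x: "\<not> x \<le> 0"
  obtains V \<omega> where "real_point one V \<omega>" "u \<in> V" "x \<in> V" "0 < \<omega> x"
proof -
  define U where "U = \<bar>u\<bar> + \<bar>x\<bar> + one"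
  define w where "w = inf (pprt x) one"
  have U: "0 \<le> U" "one \<le> U" "\<bar>u\<bar> \<le> U" "\<bar>x\<bar> \<le> U"
    by (simp_all add: U_def add_increasing add_increasing2)
  have "w \<noteq> 0"
    using disjoint_one[of "pprt x"] x by (auto simp: w_def pprt_def) (metis sup_ge1)
  moreover have "0 \<le> w" by (simp add: w_def)
  ultimately have "\<not> w \<le> 0" by simp
  then obtain \<delta> where \<delta>: "0 < \<delta>" "\<not> w \<le> \<delta> *\<^sub>R U"
    using riesz_archimedean[of w U] by blast
  let ?d = "pprt (- (w - \<delta> *\<^sub>R U))"
  \<comment> \<open>Otherwise ?c, which is disjoint from ?d, would be disjoint from
    \<open>one\<close> and hence 0, contrary to the choice of \<delta>.\<close>
  have "\<not> one \<le> n *\<^sub>R \<bar>?d\<bar>" if n: "0 \<le> n" for n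
  proof
    assume le: "one \<le> n *\<^sub>R \<bar>?d\<bar>"
    let ?c = "pprt (w - \<delta> *\<^sub>R U)"
    have "inf ?c one \<le> inf ((1 + n) *\<^sub>R ?c) ((1 + n) *\<^sub>R ?d)"
    proof (rule inf_mono)
      show "?c \<le> (1 + n) *\<^sub>R ?c" using n by (simp add: scaleR_left_distrib scaleR_nonneg_nonneg)
      show "one \<le> (1 + n) *\<^sub>R ?d" using n le
        by (simp add: scaleR_left_distrib) (simp add: add_increasing)
    qed
    also have "\<dots> = (1 + n) *\<^sub>R inf ?c ?d"
      by (rule scaleR_inf_distrib[symmetric]) (use n in simp)
    also have "\<dots> = 0" unfolding inf_pprt_uminus by simp
    finally have "inf ?c one = 0" by (simp add: antisym)
    then have "?c = 0" by (rule disjoint_one)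
    then show False using \<delta> by (metis diff_le_0_iff_le pprt_def sup_ge1)
  qed
  then obtain M where M: "lideal M" "one \<notin> M" "?d \<in> M"
    "\<And>a. a \<notin> M \<Longrightarrow> \<exists>m\<in>M. \<exists>n::real. 0 \<le> n \<and> one \<le> \<bar>m\<bar> + n *\<^sub>R \<bar>a\<bar>"
    using maximal_lideal[of one ?d] one_nonneg by blast
  define V where "V = {x. \<exists>t. x - t *\<^sub>R one \<in> M}"
  obtain \<omega> where \<omega>: "real_point one V \<omega>" "\<And>t x. x - t *\<^sub>R one \<in> M \<Longrightarrow> \<omega> x = t"
    "\<And>x t. pprt (\<bar>x\<bar> - t *\<^sub>R one) \<in> M \<Longrightarrow> x \<in> V"
    using real_point_of_maximal_lideal[OF M(1,2,4)] unfolding V_def by blast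
  interpret real_point one V \<omega> by fact
  have wd: "\<delta> *\<^sub>R U - w \<le> ?d" by (simp add: pprt_def)
  have "(1/\<delta>) *\<^sub>R (\<delta> *\<^sub>R U - w) \<le> (1/\<delta>) *\<^sub>R ?d"
    using \<delta> wd by (intro scaleR_left_mono) auto
  moreover have "(1/\<delta>) *\<^sub>R w \<le> (1/\<delta>) *\<^sub>R one"
    using \<delta> by (intro scaleR_left_mono) (auto simp: w_def)
  ultimately have "U - (1/\<delta>) *\<^sub>R one \<le> (1/\<delta>) *\<^sub>R ?d"
    using \<delta> by (simp add: scaleR_right_diff_distrib) (smt (verit) diff_left_mono order_trans)
  then have "pprt (\<bar>U\<bar> - (1/\<delta>) *\<^sub>R one) \<le> (1/\<delta>) *\<^sub>R ?d"
    using \<delta> U by (simp add: pprt_def scaleR_nonneg_nonneg)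
  then have "pprt (\<bar>U\<bar> - (1/\<delta>) *\<^sub>R one) \<in> M"
    using M(1,3) unfolding lideal_def by (smt (verit, best) abs_of_nonneg order_trans zero_le_pprt)
  then have UV: "U \<in> V" by (rule \<omega>(3))
  have uV: "u \<in> V" and xV: "x \<in> V" and wV: "w \<in> V"
    using V_solid[OF UV, of u] V_solid[OF UV, of x] U by (simp_all add: w_def)
  have dV: "?d \<in> V" "\<omega> ?d = 0" using \<omega>(2)[of ?d 0] M(3) UV wV by simp_all
  have "1 \<le> \<omega> U" using pt_mono[OF V_one UV] U by simp
  moreover have "\<delta> * \<omega> U - \<omega> w \<le> 0"
    using pt_mono[OF _ _ wd] UV wV dV by simp
  ultimately have "\<delta> \<le> \<omega> w" using \<delta> by (smt (verit) mult_le_cancel_left1)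
  then have "0 < \<omega> x" using \<delta> xV by (auto simp: w_def max_def split: if_splits)
  with \<omega>(1) uV xV show thesis using that by blast
qed

text \<open>The transfer principle to the reals. Z is finite so that the sum of all |z| can be made
  finite at the separating point; x is then finite there as (x - y) + y.\<close>

lemma le_by_points:
  fixes x y :: 'u
  assumes "finite Z"
    and "\<And>V \<omega>. real_point one V \<omega> \<Longrightarrow> Z \<subseteq> V \<Longrightarrow> x \<in> V \<Longrightarrow> y \<in> V \<Longrightarrow> \<omega> x \<le> \<omega> y"
  shows "x \<le> y"
proof (rule ccontr)
  assume "\<not> x \<le> y"
  then have "\<not> x - y \<le> 0" by simp
  from real_point_exists[OF this, of "\<bar>y\<bar> + (\<Sum>z\<in>Z. \<bar>z\<bar>)"] obtain V \<omega> where
    \<omega>: "real_point one V \<omega>" "\<bar>y\<bar> + (\<Sum>z\<in>Z. \<bar>z\<bar>) \<in> V" "x - y \<in> V" "0 < \<omega> (x - y)" .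
  interpret real_point one V \<omega> by fact
  have s: "0 \<le> (\<Sum>z\<in>Z. \<bar>z\<bar>)" by (simp add: sum_nonneg)
  have y: "y \<in> V" using V_solid[OF \<omega>(2), of y] s by simp
  have "z \<in> V" if "z \<in> Z" for z
  proof (rule V_solid[OF \<omega>(2)])
    have "\<bar>z\<bar> \<le> (\<Sum>z\<in>Z. \<bar>z\<bar>)" using that assms(1) sum_mono2[of Z "{z}" abs] by simp
    then show "\<bar>z\<bar> \<le> \<bar>\<bar>y\<bar> + (\<Sum>z\<in>Z. \<bar>z\<bar>)\<bar>" using s by (simp add: add_increasing)
  qed
  moreover have "x \<in> V" using V_add[OF \<omega>(3) y] by simp
  ultimately have "\<omega> x \<le> \<omega> y" using assms(2) \<omega>(1) y by blast
  then show False using \<omega>(4) \<open>x \<in> V\<close> y by simp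
qed

lemma eq_by_points:
  fixes x y :: 'u
  assumes "finite Z"
    and "\<And>V \<omega>. real_point one V \<omega> \<Longrightarrow> Z \<subseteq> V \<Longrightarrow> x \<in> V \<Longrightarrow> y \<in> V \<Longrightarrow> \<omega> x = \<omega> y"
  shows "x = y"
  by (rule antisym; rule le_by_points[OF assms(1)]) (simp_all add: assms(2))

text \<open>Commutativity is not part of the class \<open>f_algebra\<close>; it is inherited from
  the reals at every point.\<close>

lemma mult_commute: "x * y = y * x"
  for x y :: 'u
proof (rule eq_by_points[of "{x, y}"])
  fix V \<omega> assume "real_point one V \<omega>" "{x, y} \<subseteq> V"
  then interpret real_point one V \<omega> by simp
  show "\<omega> (x * y) = \<omega> (y * x)" using \<open>{x, y} \<subseteq> V\<close> by simp
qed simp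

lemma mult_left_commute: "x * (y * z) = y * (x * z)" for x y z :: 'u
  by (metis mult.assoc mult_commute)

lemmas mult_ac_simps = mult.assoc mult_commute mult_left_commute

lemma square_eq_0:
  fixes x :: 'u
  assumes "x * x = 0"
  shows "x = 0"
proof (rule eq_by_points[of "{}"])
  fix V \<omega> assume *: "real_point one V \<omega>" "x \<in> V"
  then interpret real_point one V \<omega> by simp
  show "\<omega> x = \<omega> 0" using assms pt_mult[OF *(2,2)] by simp
qed simp

end

section \<open>The extension of the conditional expectation\<close>

lemma isLub_UNIV_iff: "isLub UNIV D x \<longleftrightarrow> (\<forall>d\<in>D. d \<le> x) \<and> (\<forall>y. (\<forall>d\<in>D. d \<le> y) \<longrightarrow> x \<le> y)"
  by (auto simp: isLub_def isUb_def leastP_def setle_def setge_def)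

lemma isLub_upper: "isLub UNIV D x \<Longrightarrow> d \<in> D \<Longrightarrow> d \<le> x"
  and isLub_least: "isLub UNIV D x \<Longrightarrow> (\<And>d. d \<in> D \<Longrightarrow> d \<le> y) \<Longrightarrow> x \<le> y"
  by (auto simp: isLub_UNIV_iff)

lemma isLub_UNIV_I:
  "(\<And>d. d \<in> D \<Longrightarrow> d \<le> x) \<Longrightarrow> (\<And>y. (\<And>d. d \<in> D \<Longrightarrow> d \<le> y) \<Longrightarrow> x \<le> y) \<Longrightarrow> isLub UNIV D x"
  by (auto simp: isLub_UNIV_iff)

lemma isLub_cSup:
  fixes D :: "'a::conditionally_complete_lattice set"
  assumes "D \<noteq> {}" "bdd_above D"
  shows "isLub UNIV D (Sup D)"
  using assms by (auto intro!: isLub_UNIV_I intro: cSup_upper cSup_least)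

lemma isLub_UNIV_unique:
  fixes x y :: "'a::order"
  shows "isLub UNIV D x \<Longrightarrow> isLub UNIV D y \<Longrightarrow> x = y"
  by (auto simp: isLub_UNIV_iff intro: antisym)

lemma inf_eq_add_diff_sup:
  fixes x y :: "'a::riesz_space"
  shows "inf x y = x + y - sup x y"
  by (metis add_eq_inf_sup add_diff_cancel_left')

text \<open>Stands in for the infinite distributive law: if d increases to f, it controls how inf x
  d increases to inf x f.\<close>

lemma inf_sup_add_le:
  fixes x d f :: "'a::riesz_space"
  assumes "d \<le> f"
  shows "x + d \<le> inf x d + sup x f"
proof -
  have "x + d = inf x d + sup x d" by (metis add_eq_inf_sup add.commute)
  also have "\<dots> \<le> inf x d + sup x f" using assms by (intro add_left_mono sup_mono) auto
  finally show ?thesis .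
qed

lemma up_directed_image2:
  assumes "up_directed D" "up_directed D'"
    and "\<And>x y x' y'. x \<le> x' \<Longrightarrow> y \<le> y' \<Longrightarrow> f x y \<le> f x' y'"
  shows "up_directed {f x y | x y. x \<in> D \<and> y \<in> D'}"
  unfolding up_directed_def
proof (intro conjI ballI)
  show "{f x y | x y. x \<in> D \<and> y \<in> D'} \<noteq> {}" using assms(1,2) by (auto simp: up_directed_def)
  fix u v assume "u \<in> {f x y | x y. x \<in> D \<and> y \<in> D'}" "v \<in> {f x y | x y. x \<in> D \<and> y \<in> D'}"
  then obtain x y x' y' where *: "u = f x y" "v = f x' y'" "x \<in> D" "x' \<in> D" "y \<in> D'" "y' \<in> D'" by blast
  obtain z z' where "z \<in> D" "x \<le> z" "x' \<le> z" "z' \<in> D'" "y \<le> z'" "y' \<le> z'"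
    using assms(1,2) * unfolding up_directed_def by meson
  then show "\<exists>w\<in>{f x y | x y. x \<in> D \<and> y \<in> D'}. u \<le> w \<and> v \<le> w"
    using * assms(3) by (intro bexI[of _ "f z z'"]) auto
qed

lemma up_directed_image:
  assumes "up_directed D" and "\<And>x y. x \<in> D \<Longrightarrow> y \<in> D \<Longrightarrow> x \<le> y \<Longrightarrow> f x \<le> f y"
  shows "up_directed (f ` D)"
  unfolding up_directed_def
proof (intro conjI ballI)
  show "f ` D \<noteq> {}" using assms(1) by (auto simp: up_directed_def)
  fix u v assume "u \<in> f ` D" "v \<in> f ` D"
  then obtain x y where *: "u = f x" "v = f y" "x \<in> D" "y \<in> D" by blast
  then obtain z where "z \<in> D" "x \<le> z" "y \<le> z" using assms(1) unfolding up_directed_def by meson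
  then show "\<exists>w\<in>f ` D. u \<le> w \<and> v \<le> w" using * assms(2) by blast
qed

lemma up_directed_sup:
  assumes "D \<noteq> {}" "\<And>x y. x \<in> D \<Longrightarrow> y \<in> D \<Longrightarrow> sup x y \<in> (D :: 'a::lattice set)"
  shows "up_directed D"
  using assms unfolding up_directed_def by (meson sup_ge1 sup_ge2)

section \<open>The extension on positive elements\<close>

locale cond_exp =
  fixes T :: "'e::dedekind_complete_riesz_space \<Rightarrow> 'e"
    and \<iota> :: "'e \<Rightarrow> 'u::universally_complete_riesz_space"
  assumes ce: "conditional_expectation T" and sp: "strictly_positive T"
    and uc: "universal_completion \<iota>"
begin

lemma linear_T: "linear T" and T_T: "T (T x) = T x" and T_pos: "0 \<le> x \<Longrightarrow> 0 \<le> T x"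
  and T_oc: "order_continuous T"
  using ce unfolding conditional_expectation_def positive_map_def
  by (auto simp: fun_eq_iff)

lemma T_mono: "x \<le> y \<Longrightarrow> T x \<le> T y"
  using T_pos[of "y - x"] linear_diff[OF linear_T, of y x] by simp

lemma linear_i: "linear \<iota>" and inj_i: "inj \<iota>" and i_sup: "\<iota> (sup x y) = sup (\<iota> x) (\<iota> y)"
  and i_dense: "0 < u \<Longrightarrow> \<exists>x. 0 < \<iota> x \<and> \<iota> x \<le> u"
  using uc unfolding universal_completion_def by auto

lemma i_add: "\<iota> (x + y) = \<iota> x + \<iota> y" and i_diff: "\<iota> (x - y) = \<iota> x - \<iota> y"
  and i_0 [simp]: "\<iota> 0 = 0"
  and i_scaleR: "\<iota> (c *\<^sub>R x) = c *\<^sub>R \<iota> x"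
  using linear_i linear_add linear_diff linear_0 linear_scale by blast+

lemma i_le_iff [simp]: "\<iota> x \<le> \<iota> y \<longleftrightarrow> x \<le> y"
proof -
  have "\<iota> x \<le> \<iota> y \<longleftrightarrow> \<iota> (sup x y) = \<iota> y" by (simp add: i_sup le_iff_sup)
  also have "\<dots> \<longleftrightarrow> x \<le> y" using inj_i by (simp add: inj_eq le_iff_sup)
  finally show ?thesis .
qed

lemma i_nonneg_iff [simp]: "0 \<le> \<iota> x \<longleftrightarrow> 0 \<le> x"
  using i_le_iff[of 0 x] by simp

lemma i_inf: "\<iota> (inf x y) = inf (\<iota> x) (\<iota> y)"
  by (simp only: inf_eq_add_diff_sup i_diff i_add i_sup)

text \<open>The largest net approximating \<open>f\<close>: every element of \<open>L1_pos\<close> can be tested on it.\<close>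

definition below :: "'u \<Rightarrow> 'e set" where
  "below f = {x. 0 \<le> x \<and> \<iota> x \<le> f}"

text \<open>The \<open>Sup\<close> is a genuine supremum only if the image is bounded above; for f
  \<ge> 0 that is membership in \<open>L1_pos\<close>.\<close>

definition tau :: "'u \<Rightarrow> 'u" where
  "tau f = Sup (\<iota> ` T ` below f)"

lemma below_0: "0 \<le> f \<Longrightarrow> 0 \<in> below f"
  by (simp add: below_def)

lemma up_directed_below: "0 \<le> f \<Longrightarrow> up_directed (below f)"
  using below_0[of f] by (intro up_directed_sup) (auto simp: below_def i_sup le_supI1)

text \<open>If the supremum s fell short of f, order density would fit some \<iota> x > 0 into f -
  s; adding x to any element of \<open>below f\<close> stays in \<open>below f\<close>, which forces
  s \<le> s - \<iota> x.\<close>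

lemma isLub_below:
  assumes f: "0 \<le> f"
  shows "isLub UNIV (\<iota> ` below f) f"
proof -
  let ?s = "Sup (\<iota> ` below f)"
  have lub: "isLub UNIV (\<iota> ` below f) ?s"
    using below_0[OF f] by (intro isLub_cSup) (auto simp: below_def intro!: bdd_aboveI[of _ f])
  have "?s \<le> f" by (rule isLub_least[OF lub]) (auto simp: below_def)
  have "?s = f"
  proof (rule ccontr)
    assume "?s \<noteq> f"
    with \<open>?s \<le> f\<close> have "0 < f - ?s" by simp
    then obtain x where x: "0 < \<iota> x" "\<iota> x \<le> f - ?s" using i_dense by blast
    have "?s \<le> ?s - \<iota> x"
    proof (rule isLub_least[OF lub])
      fix d assume "d \<in> \<iota> ` below f"
      then obtain z where z: "d = \<iota> z" "z \<in> below f" by blast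
      have "\<iota> z + \<iota> x \<le> ?s + (f - ?s)" using z isLub_upper[OF lub] x by (intro add_mono) auto
      moreover have "0 \<le> x" using x(1) i_nonneg_iff[of x] less_imp_le by blast
      ultimately have "z + x \<in> below f" using z by (simp add: below_def i_add)
      then have "\<iota> (z + x) \<le> ?s" using isLub_upper[OF lub] by blast
      then show "d \<le> ?s - \<iota> x" using z by (simp add: i_add le_diff_eq)
    qed
    then show False using x by simp
  qed
  then show ?thesis using lub by simp
qed

text \<open>Order density makes \<open>\<iota>\<close> order continuous.\<close>

lemma i_isLub:
  assumes x: "isLub UNIV D x" and g: "\<And>d. d \<in> D \<Longrightarrow> \<iota> d \<le> g"
  shows "\<iota> x \<le> g"
proof (rule ccontr)
  assume "\<not> \<iota> x \<le> g"
  define m where "m = inf (\<iota> x) g"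
  have "m \<noteq> \<iota> x" using \<open>\<not> \<iota> x \<le> g\<close> m_def by (metis inf_le2)
  then have "m < \<iota> x" by (simp add: less_le m_def)
  then have "0 < \<iota> x - m" by simp
  then obtain y where y: "0 < \<iota> y" "\<iota> y \<le> \<iota> x - m" using i_dense by blast
  have "x \<le> x - y"
  proof (rule isLub_least[OF x])
    fix d assume d: "d \<in> D"
    have "\<iota> d \<le> m" using isLub_upper[OF x d] g[OF d] by (simp add: m_def)
    also have "\<dots> \<le> \<iota> x - \<iota> y" using y(2) by (simp add: le_diff_eq add.commute)
    finally show "d \<le> x - y" by (simp flip: i_diff)
  qed
  then have "y \<le> 0" by simp
  then have "\<iota> y \<le> 0" using i_le_iff[of y 0] by simp
  with y show False by simp
qed

text \<open>The heart of independence from the net. Since f need not come from E, order continuity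
  of T cannot be applied to D itself; cut off at x, the net increases to x inside E.\<close>

lemma T_le_of_net:
  assumes D: "up_directed D" and lub: "isLub UNIV (\<iota> ` D) f" and x: "\<iota> x \<le> f"
    and g: "\<And>d. d \<in> D \<Longrightarrow> \<iota> (T d) \<le> g"
  shows "\<iota> (T x) \<le> g"
proof -
  let ?D = "inf x ` D"
  have dir: "up_directed ?D" using D by (rule up_directed_image) (auto intro: le_infI2)
  have "isLub UNIV ?D x"
  proof (rule isLub_UNIV_I)
    fix y assume y: "\<And>d. d \<in> ?D \<Longrightarrow> d \<le> y"
    have "f \<le> \<iota> y - \<iota> x + sup (\<iota> x) f"
    proof (rule isLub_least[OF lub])
      fix d' assume "d' \<in> \<iota> ` D"
      then obtain d where d: "d' = \<iota> d" "d \<in> D" by blast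
      have "\<iota> x + \<iota> d \<le> inf (\<iota> x) (\<iota> d) + sup (\<iota> x) f"
        using isLub_upper[OF lub] d by (intro inf_sup_add_le) auto
      also have "inf (\<iota> x) (\<iota> d) \<le> \<iota> y" using y d by (simp flip: i_inf)
      finally show "d' \<le> \<iota> y - \<iota> x + sup (\<iota> x) f" using d by (simp add: algebra_simps)
    qed
    with x have "\<iota> x \<le> \<iota> y" by (simp add: sup_absorb2)
    then show "x \<le> y" by simp
  qed auto
  with T_oc dir have lubT: "isLub UNIV (T ` ?D) (T x)"
    unfolding order_continuous_def by blast
  show ?thesis
  proof (rule i_isLub[OF lubT])
    fix d assume "d \<in> T ` ?D"
    then obtain d' where "d = T (inf x d')" "d' \<in> D" by blast
    then have "\<iota> d \<le> \<iota> (T d')" by (simp add: T_mono)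
    also have "\<dots> \<le> g" using g \<open>d' \<in> D\<close> .
    finally show "\<iota> d \<le> g" .
  qed
qed

lemma approx_netI:
  assumes "up_directed D" "\<And>x. x \<in> D \<Longrightarrow> 0 \<le> x" "isLub UNIV (\<iota> ` D) f"
    "isLub UNIV (\<iota> ` T ` D) g"
  shows "approx_net \<iota> T D f"
proof -
  have "bdd_above (\<iota> ` T ` D)" using isLub_upper[OF assms(4)] by (rule bdd_aboveI)
  then show ?thesis using assms by (simp add: approx_net_def)
qed

lemma approx_net_below:
  assumes "0 \<le> f" "bdd_above (\<iota> ` T ` below f)"
  shows "approx_net \<iota> T (below f) f"
  using assms up_directed_below isLub_below by (auto simp: approx_net_def below_def)

lemma approx_net_bound:
  assumes D: "approx_net \<iota> T D f" and x: "x \<in> below f" and g: "\<And>d. d \<in> D \<Longrightarrow> \<iota> (T d) \<le> g"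
  shows "\<iota> (T x) \<le> g"
  by (rule T_le_of_net[of D f]) (use D x g in \<open>auto simp: approx_net_def below_def\<close>)

text \<open>Every approximating net is contained in \<open>below f\<close>, and by
  \<open>T_le_of_net\<close> its bounds under T also bound T on all of \<open>below f\<close>. The
  two suprema therefore agree.\<close>

lemma approx_net_tau:
  assumes D: "approx_net \<iota> T D f"
  shows "0 \<le> f" "bdd_above (\<iota> ` T ` below f)" "isLub UNIV (\<iota> ` T ` D) (tau f)"
proof -
  obtain d where "d \<in> D" "0 \<le> d" using D by (auto simp: approx_net_def up_directed_def)
  then have "0 \<le> \<iota> d" "\<iota> d \<le> f" using D isLub_upper by (auto simp: approx_net_def)
  then show f: "0 \<le> f" by (rule order_trans)
  obtain g where g: "\<And>d. d \<in> D \<Longrightarrow> \<iota> (T d) \<le> g"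
    using D by (auto simp: approx_net_def bdd_above_def)
  show bdd: "bdd_above (\<iota> ` T ` below f)"
    using approx_net_bound[OF D _ g] by (auto intro!: bdd_aboveI)
  have sub: "D \<subseteq> below f" using D by (auto simp: approx_net_def below_def intro: isLub_upper)
  have lub: "isLub UNIV (\<iota> ` T ` below f) (tau f)"
    unfolding tau_def using below_0[OF f] bdd by (intro isLub_cSup) auto
  show "isLub UNIV (\<iota> ` T ` D) (tau f)"
  proof (rule isLub_UNIV_I)
    fix d assume "d \<in> \<iota> ` T ` D"
    then show "d \<le> tau f" using isLub_upper[OF lub] sub by blast
  next
    fix y assume "\<And>d. d \<in> \<iota> ` T ` D \<Longrightarrow> d \<le> y"
    then show "tau f \<le> y"
      using approx_net_bound[OF D, of _ y] by (intro isLub_least[OF lub]) auto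
  qed
qed

lemma L1_pos_iff: "f \<in> L1_pos \<iota> T \<longleftrightarrow> 0 \<le> f \<and> bdd_above (\<iota> ` T ` below f)"
proof
  assume "f \<in> L1_pos \<iota> T"
  then obtain D where "approx_net \<iota> T D f" by (auto simp: L1_pos_def)
  then show "0 \<le> f \<and> bdd_above (\<iota> ` T ` below f)" using approx_net_tau(1,2) by simp
next
  assume "0 \<le> f \<and> bdd_above (\<iota> ` T ` below f)"
  then show "f \<in> L1_pos \<iota> T" using approx_net_below[of f] unfolding L1_pos_def by blast
qed

lemma isLub_tau: "f \<in> L1_pos \<iota> T \<Longrightarrow> isLub UNIV (\<iota> ` T ` below f) (tau f)"
  using approx_net_below approx_net_tau(3) by (auto simp: L1_pos_iff)

lemma T_pos_eq: "f \<in> L1_pos \<iota> T \<Longrightarrow> T_pos \<iota> T f = tau f"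
  unfolding T_pos_def
proof (rule the_equality)
  assume f: "f \<in> L1_pos \<iota> T"
  then show "\<exists>D. approx_net \<iota> T D f \<and> isLub UNIV (\<iota> ` T ` D) (tau f)"
    using approx_net_below[of f] isLub_tau[of f] by (auto simp: L1_pos_iff)
next
  fix g assume "\<exists>D. approx_net \<iota> T D f \<and> isLub UNIV (\<iota> ` T ` D) g"
  then obtain D where D: "approx_net \<iota> T D f" "isLub UNIV (\<iota> ` T ` D) g" by blast
  then show "g = tau f" using isLub_UNIV_unique[OF D(2) approx_net_tau(3)[OF D(1)]] by simp
qed

lemma L1_posI: "approx_net \<iota> T D f \<Longrightarrow> f \<in> L1_pos \<iota> T"
  using approx_net_tau by (simp add: L1_pos_iff)

lemma tau_mono:
  assumes "0 \<le> g" "g \<le> f" "f \<in> L1_pos \<iota> T"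
  shows "g \<in> L1_pos \<iota> T" "tau g \<le> tau f"
proof -
  have sub: "below g \<subseteq> below f" using assms by (auto simp: below_def)
  have "\<iota> ` T ` below g \<subseteq> \<iota> ` T ` below f" using sub by blast
  then show g: "g \<in> L1_pos \<iota> T"
    using assms bdd_above_mono by (auto simp: L1_pos_iff)
  show "tau g \<le> tau f"
    using sub isLub_upper[OF isLub_tau[OF assms(3)]] by (intro isLub_least[OF isLub_tau[OF g]]) auto
qed

lemma tau_nonneg: "f \<in> L1_pos \<iota> T \<Longrightarrow> 0 \<le> tau f"
  using isLub_upper[OF isLub_tau, of f 0] below_0[of f] linear_0[OF linear_T]
  by (force simp: L1_pos_iff)

lemma tau_add:
  assumes f: "f \<in> L1_pos \<iota> T" and g: "g \<in> L1_pos \<iota> T"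
  shows "f + g \<in> L1_pos \<iota> T" "tau (f + g) = tau f + tau g"
proof -
  let ?D = "{x + y | x y. x \<in> below f \<and> y \<in> below g}"
  have pos: "0 \<le> f" "0 \<le> g" using f g by (simp_all add: L1_pos_iff)
  \<comment> \<open>The map h is left open because this is used both for \<iota> and for \<iota>
    after T.\<close>
  have plus: "isLub UNIV {h x + h y | x y. x \<in> below f \<and> y \<in> below g} (u + v)"
    if "isLub UNIV (h ` below f) u" "isLub UNIV (h ` below g) v" for h :: "'e \<Rightarrow> 'u" and u v
  proof (rule isLub_UNIV_I)
    fix d assume "d \<in> {h x + h y | x y. x \<in> below f \<and> y \<in> below g}"
    then show "d \<le> u + v" using that by (auto intro!: add_mono intro: isLub_upper)
  next
    fix w assume w: "\<And>d. d \<in> {h x + h y | x y. x \<in> below f \<and> y \<in> below g} \<Longrightarrow> d \<le> w"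
    have "u \<le> w - v"
    proof (rule isLub_least[OF that(1)])
      fix d assume "d \<in> h ` below f"
      then obtain x where x: "d = h x" "x \<in> below f" by blast
      have "v \<le> w - h x"
        by (rule isLub_least[OF that(2)]) (use w x in \<open>force simp: le_diff_eq add.commute\<close>)
      then show "d \<le> w - v" using x by (simp add: le_diff_eq add.commute)
    qed
    then show "u + v \<le> w" by (simp add: le_diff_eq)
  qed
  have img: "k ` ?D = {k x + k y | x y. x \<in> below f \<and> y \<in> below g}"
    if "\<And>x y. k (x + y) = k x + k y" for k :: "'e \<Rightarrow> 'u"
    unfolding that[symmetric] by blast
  have 1: "isLub UNIV (\<iota> ` ?D) (f + g)"
    unfolding img[of \<iota>, OF i_add] by (rule plus[OF isLub_below[OF pos(1)] isLub_below[OF pos(2)]])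
  have "isLub UNIV ((\<iota> \<circ> T) ` ?D) (tau f + tau g)"
    using isLub_tau[OF f] isLub_tau[OF g]
    by (subst img) (auto simp: i_add linear_add[OF linear_T] image_comp intro!: plus[of "\<iota> \<circ> T", unfolded o_apply])
  then have 2: "isLub UNIV (\<iota> ` T ` ?D) (tau f + tau g)" by (simp only: image_comp)
  have "up_directed ?D"
    using pos by (intro up_directed_image2 up_directed_below add_mono)
  then have net: "approx_net \<iota> T ?D (f + g)"
    by (rule approx_netI[OF _ _ 1 2]) (auto simp: below_def)
  then show "f + g \<in> L1_pos \<iota> T" by (rule L1_posI)
  show "tau (f + g) = tau f + tau g"
    using isLub_UNIV_unique[OF approx_net_tau(3)[OF net] 2] .
qed

lemma tau_scaleR:
  assumes f: "f \<in> L1_pos \<iota> T" and c: "0 \<le> c"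
  shows "c *\<^sub>R f \<in> L1_pos \<iota> T" "tau (c *\<^sub>R f) = c *\<^sub>R tau f"
proof -
  have 0: "approx_net \<iota> T {0} 0" "isLub UNIV (\<iota> ` T ` {0}) 0"
    by (auto simp: approx_net_def up_directed_def isLub_UNIV_iff linear_0[OF linear_T])
  have t0: "tau 0 = 0" using approx_net_tau(3)[OF 0(1)] isLub_UNIV_unique 0(2) by blast
  have "c *\<^sub>R f \<in> L1_pos \<iota> T \<and> tau (c *\<^sub>R f) = c *\<^sub>R tau f"
  proof (cases "c = 0")
    case True
    then show ?thesis using t0 L1_posI[OF 0(1)] by simp
  next
    case False
    with c have c: "0 < c" by simp
    let ?D = "(*\<^sub>R) c ` below f"
    have pos: "0 \<le> f" using f by (simp add: L1_pos_iff)
    have sc: "isLub UNIV ((\<lambda>x. c *\<^sub>R h x) ` below f) (c *\<^sub>R u)"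
      if "isLub UNIV (h ` below f) u" for h :: "'e \<Rightarrow> 'u" and u
    proof (rule isLub_UNIV_I)
      fix d assume "d \<in> (\<lambda>x. c *\<^sub>R h x) ` below f"
      then show "d \<le> c *\<^sub>R u" using that c by (auto intro!: scaleR_left_mono intro: isLub_upper)
    next
      fix w assume w: "\<And>d. d \<in> (\<lambda>x. c *\<^sub>R h x) ` below f \<Longrightarrow> d \<le> w"
      have "u \<le> w /\<^sub>R c"
        by (rule isLub_least[OF that]) (use w in \<open>auto simp: pos_le_divideR_eq[OF c]\<close>)
      then show "c *\<^sub>R u \<le> w" by (simp add: pos_le_divideR_eq[OF c])
    qed
    have 1: "isLub UNIV (\<iota> ` ?D) (c *\<^sub>R f)"
      using sc[OF isLub_below[OF pos]] by (simp add: image_image i_scaleR)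
    have 2: "isLub UNIV (\<iota> ` T ` ?D) (c *\<^sub>R tau f)"
      using sc[of "\<iota> \<circ> T" "tau f"] isLub_tau[OF f]
      by (simp add: image_image i_scaleR linear_scale[OF linear_T])
    have "up_directed ?D"
      using up_directed_below[OF pos] c by (intro up_directed_image) (auto intro: scaleR_left_mono)
    then have net: "approx_net \<iota> T ?D (c *\<^sub>R f)"
      by (rule approx_netI[OF _ _ 1 2]) (use c in \<open>auto simp: below_def scaleR_nonneg_nonneg\<close>)
    show ?thesis
      using isLub_UNIV_unique[OF approx_net_tau(3)[OF net] 2] L1_posI[OF net] by blast
  qed
  then show "c *\<^sub>R f \<in> L1_pos \<iota> T" "tau (c *\<^sub>R f) = c *\<^sub>R tau f" by blast+
qed

section \<open>The extension on the linear space L1\<close>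

abbreviation LT ("\<L>") where "\<L> \<equiv> L1 \<iota> T"
abbreviation TT ("\<T>") where "\<T> \<equiv> T_ext \<iota> T"

text \<open>Two decompositions satisfy f + f2 = f1 + g, so additivity of \<open>tau\<close> makes
  the value independent of the choice.\<close>

lemma T_ext_diff_pos:
  assumes "f \<in> L1_pos \<iota> T" "g \<in> L1_pos \<iota> T"
  shows "\<T> (f - g) = tau f - tau g"
  unfolding T_ext_def
proof (rule the_equality)
  show "\<exists>f1\<in>L1_pos \<iota> T. \<exists>f2\<in>L1_pos \<iota> T. f - g = f1 - f2 \<and> tau f - tau g = T_pos \<iota> T f1 - T_pos \<iota> T f2"
    using assms by (auto simp: T_pos_eq)
  fix w assume "\<exists>f1\<in>L1_pos \<iota> T. \<exists>f2\<in>L1_pos \<iota> T. f - g = f1 - f2 \<and> w = T_pos \<iota> T f1 - T_pos \<iota> T f2"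
  then obtain f1 f2 where *: "f1 \<in> L1_pos \<iota> T" "f2 \<in> L1_pos \<iota> T" "f - g = f1 - f2" "w = tau f1 - tau f2"
    by (auto simp: T_pos_eq)
  then have "f + f2 = f1 + g" by (simp add: algebra_simps)
  then have "tau f + tau f2 = tau f1 + tau g" using tau_add assms * by metis
  then have "tau f = tau f1 + tau g - tau f2" by (metis add_diff_cancel_right')
  then show "w = tau f - tau g" using * by simp
qed

lemma L1_iff: "z \<in> \<L> \<longleftrightarrow> \<bar>z\<bar> \<in> L1_pos \<iota> T"
proof
  assume "z \<in> \<L>"
  then obtain f g where fg: "z = f - g" "f \<in> L1_pos \<iota> T" "g \<in> L1_pos \<iota> T" by (auto simp: L1_def)
  then have "\<bar>z\<bar> \<le> f + g" using abs_triangle_ineq4[of f g] by (simp add: L1_pos_iff)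
  then show "\<bar>z\<bar> \<in> L1_pos \<iota> T" using tau_mono(1)[OF _ _ tau_add(1)] fg by simp
next
  assume *: "\<bar>z\<bar> \<in> L1_pos \<iota> T"
  have "pprt z \<le> \<bar>z\<bar>" "pprt (- z) \<le> \<bar>z\<bar>" by (simp_all add: pprt_def abs_ge_self abs_ge_minus_self)
  then have "pprt z \<in> L1_pos \<iota> T" "pprt (- z) \<in> L1_pos \<iota> T" using tau_mono(1)[OF _ _ *] by auto
  then show "z \<in> \<L>" unfolding L1_def using pprt_diff_pprt_uminus[of z, symmetric] by blast
qed

lemma L1_pos_eq: "f \<in> L1_pos \<iota> T \<longleftrightarrow> f \<in> \<L> \<and> 0 \<le> f"
  by (auto simp: L1_iff) (auto simp: L1_pos_iff)

lemma T_ext_pos: "f \<in> \<L> \<Longrightarrow> 0 \<le> f \<Longrightarrow> \<T> f = tau f"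
proof -
  assume "f \<in> \<L>" "0 \<le> f"
  then have f: "f \<in> L1_pos \<iota> T" by (simp add: L1_pos_eq)
  then show "\<T> f = tau f" using T_ext_diff_pos[OF f, of 0] tau_scaleR[OF f, of 0] by simp
qed

lemma L_solid: "x \<in> \<L> \<Longrightarrow> \<bar>y\<bar> \<le> \<bar>x\<bar> \<Longrightarrow> y \<in> \<L>"
  using tau_mono(1)[of "\<bar>y\<bar>" "\<bar>x\<bar>"] by (simp add: L1_iff)

lemma L_cases:
  assumes "x \<in> \<L>"
  obtains f g where "f \<in> L1_pos \<iota> T" "g \<in> L1_pos \<iota> T" "x = f - g"
  using assms by (auto simp: L1_def)

lemma L_add [simp]: "x \<in> \<L> \<Longrightarrow> y \<in> \<L> \<Longrightarrow> x + y \<in> \<L>"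
  and T_add [simp]: "x \<in> \<L> \<Longrightarrow> y \<in> \<L> \<Longrightarrow> \<T> (x + y) = \<T> x + \<T> y"
proof -
  assume "x \<in> \<L>" "y \<in> \<L>"
  then obtain f g f' g' where *: "f \<in> L1_pos \<iota> T" "g \<in> L1_pos \<iota> T" "x = f - g"
    "f' \<in> L1_pos \<iota> T" "g' \<in> L1_pos \<iota> T" "y = f' - g'" by (metis L_cases)
  then have eq: "x + y = (f + f') - (g + g')" by simp
  show "x + y \<in> \<L>" unfolding eq L1_def using tau_add(1) * by blast
  have "\<T> (x + y) = tau (f + f') - tau (g + g')" unfolding eq using tau_add(1) * by (intro T_ext_diff_pos) auto
  also have "\<dots> = (tau f - tau g) + (tau f' - tau g')" using tau_add(2) * by simp
  also have "\<dots> = \<T> x + \<T> y" using * by (simp add: T_ext_diff_pos)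
  finally show "\<T> (x + y) = \<T> x + \<T> y" .
qed

lemma L_uminus [simp]: "x \<in> \<L> \<Longrightarrow> - x \<in> \<L>"
  by (simp add: L1_iff)

lemma T_uminus [simp]: "x \<in> \<L> \<Longrightarrow> \<T> (- x) = - \<T> x"
  by (metis L_cases T_ext_diff_pos minus_diff_eq)

lemma L_diff [simp]: "x \<in> \<L> \<Longrightarrow> y \<in> \<L> \<Longrightarrow> x - y \<in> \<L>"
  and T_diff [simp]: "x \<in> \<L> \<Longrightarrow> y \<in> \<L> \<Longrightarrow> \<T> (x - y) = \<T> x - \<T> y"
  using L_add[of x "- y"] T_add[of x "- y"] by simp_all

lemma L_scaleR [simp]: "x \<in> \<L> \<Longrightarrow> c *\<^sub>R x \<in> \<L>"
  using tau_scaleR(1)[of "\<bar>x\<bar>" "\<bar>c\<bar>"] by (simp add: L1_iff abs_scaleR_riesz)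

lemma T_scaleR [simp]: 
  assumes "x \<in> \<L>"
  shows "\<T> (c *\<^sub>R x) = c *\<^sub>R \<T> x"
proof -
  obtain f g where fg: "f \<in> L1_pos \<iota> T" "g \<in> L1_pos \<iota> T" "x = f - g" using assms by (rule L_cases)
  have nonneg: "\<T> (d *\<^sub>R x) = d *\<^sub>R \<T> x" if "0 \<le> d" for d
    using T_ext_diff_pos[OF tau_scaleR(1)[OF fg(1) that] tau_scaleR(1)[OF fg(2) that]] tau_scaleR(2) fg that
    by (simp add: T_ext_diff_pos scaleR_right_diff_distrib)
  show ?thesis
    using nonneg[of c] nonneg[of "- c"] assms by (cases "0 \<le> c") (simp_all add: T_uminus)
qed

lemma L_0 [simp]: "0 \<in> \<L>" and T_0 [simp]: "\<T> 0 = 0"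
proof -
  have "approx_net \<iota> T {0} 0"
    by (auto simp: approx_net_def up_directed_def isLub_UNIV_iff)
  then show L0: "0 \<in> \<L>" by (simp add: L1_iff L1_posI)
  show "\<T> 0 = 0" using T_scaleR[OF L0, of 0] by simp
qed

lemma T_nonneg: "x \<in> \<L> \<Longrightarrow> 0 \<le> x \<Longrightarrow> 0 \<le> \<T> x"
  by (simp add: T_ext_pos tau_nonneg L1_pos_eq)

lemma T_ext_mono: "x \<in> \<L> \<Longrightarrow> y \<in> \<L> \<Longrightarrow> x \<le> y \<Longrightarrow> \<T> x \<le> \<T> y"
  using T_nonneg[of "y - x"] by simp

lemma L_mono: "x \<in> \<L> \<Longrightarrow> 0 \<le> y \<Longrightarrow> y \<le> x \<Longrightarrow> y \<in> \<L>"
  using L_solid[of x y] by simp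

text \<open>Strict positivity is carried over from E: every y \<ge> 0 in E with \<iota> y \<le> x
  has T y \<le> 0, hence y = 0, and x is the supremum of these \<iota> y.\<close>

lemma T_eq_0:
  assumes x: "x \<in> \<L>" "0 \<le> x" "\<T> x \<le> 0"
  shows "x = 0"
proof -
  have xp: "x \<in> L1_pos \<iota> T" using x by (simp add: L1_pos_eq)
  have "x \<le> 0"
  proof (rule isLub_least[OF isLub_below[OF x(2)]])
    fix d assume "d \<in> \<iota> ` below x"
    then obtain y where y: "d = \<iota> y" "y \<in> below x" by blast
    have "\<iota> (T y) \<le> tau x" using isLub_upper[OF isLub_tau[OF xp]] y by blast
    also have "\<dots> \<le> \<iota> 0" using x by (simp add: T_ext_pos)
    finally have "T y \<le> 0" by (simp only: i_le_iff)
    moreover have "0 \<le> y" using y by (simp add: below_def)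
    ultimately have "y = 0" using sp T_pos[of y] by (simp add: strictly_positive_def)
    then show "d \<le> 0" using y by simp
  qed
  then show ?thesis using x by simp
qed

text \<open>Monotone convergence, including integrability of the limit. The union of the sets
  \<open>below d\<close> is itself an approximating net of f, and g bounds its image under
  T.\<close>

lemma T_isLub:
  assumes D: "up_directed D" "\<And>d. d \<in> D \<Longrightarrow> d \<in> \<L>" "\<And>d. d \<in> D \<Longrightarrow> 0 \<le> d"
    and lub: "isLub UNIV D f" and g: "\<And>d. d \<in> D \<Longrightarrow> \<T> d \<le> g"
  shows "f \<in> \<L>" "isLub UNIV (\<T> ` D) (\<T> f)"
proof -
  have Dp: "d \<in> L1_pos \<iota> T" "\<T> d = tau d" if "d \<in> D" for d
    using D that by (simp_all add: L1_pos_eq T_ext_pos)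
  let ?N = "\<Union>d\<in>D. below d"
  obtain d0 where "d0 \<in> D" using D(1) by (auto simp: up_directed_def)
  then have "?N \<noteq> {}" using below_0[OF D(3)] by blast
  moreover have "sup x y \<in> ?N" if xy: "x \<in> ?N" "y \<in> ?N" for x y
  proof -
    obtain d d' where "d \<in> D" "d' \<in> D" "x \<in> below d" "y \<in> below d'" using xy by blast
    moreover from this obtain d'' where "d'' \<in> D" "d \<le> d''" "d' \<le> d''"
      using D(1) unfolding up_directed_def by meson
    ultimately have "sup x y \<in> below d''" by (auto simp: below_def i_sup le_supI1 intro: order_trans)
    with \<open>d'' \<in> D\<close> show ?thesis by blast
  qed
  ultimately have dir: "up_directed ?N" by (rule up_directed_sup)
  have lubN: "isLub UNIV (\<iota> ` ?N) f"
  proof (rule isLub_UNIV_I)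
    fix z assume "z \<in> \<iota> ` ?N"
    then show "z \<le> f" using isLub_upper[OF lub] by (auto simp: below_def intro: order_trans)
  next
    fix y assume y: "\<And>z. z \<in> \<iota> ` ?N \<Longrightarrow> z \<le> y"
    show "f \<le> y"
    proof (rule isLub_least[OF lub])
      fix d assume d: "d \<in> D"
      show "d \<le> y"
        by (rule isLub_least[OF isLub_below[OF D(3)[OF d]]]) (use y d in blast)
    qed
  qed
  have up: "z \<le> y" if zy: "z \<in> \<iota> ` T ` ?N" "\<And>d. d \<in> D \<Longrightarrow> \<T> d \<le> y" for z y
  proof -
    obtain d x where dx: "d \<in> D" "x \<in> below d" "z = \<iota> (T x)" using zy(1) by blast
    then have "z \<le> tau d" using isLub_upper[OF isLub_tau[OF Dp(1)[OF dx(1)]]] by blast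
    then show ?thesis using zy(2)[OF dx(1)] Dp(2)[OF dx(1)] by simp
  qed
  have "bdd_above (\<iota> ` T ` ?N)" using up[OF _ g] by (rule bdd_aboveI)
  then have net: "approx_net \<iota> T ?N f"
    using dir lubN by (simp add: approx_net_def) (simp add: below_def)
  then have f: "f \<in> L1_pos \<iota> T" by (rule L1_posI)
  then show fL: "f \<in> \<L>" by (simp add: L1_pos_eq)
  have f0: "0 \<le> f" using f by (simp add: L1_pos_eq)
  show "isLub UNIV (\<T> ` D) (\<T> f)"
  proof (rule isLub_UNIV_I)
    fix d assume "d \<in> \<T> ` D"
    then show "d \<le> \<T> f" using D fL isLub_upper[OF lub] T_ext_mono by blast
  next
    fix y assume "\<And>d. d \<in> \<T> ` D \<Longrightarrow> d \<le> y"
    then have "tau f \<le> y" using up by (intro isLub_least[OF approx_net_tau(3)[OF net]]) (meson imageI)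
    then show "\<T> f \<le> y" using f0 fL by (simp add: T_ext_pos)
  qed
qed

lemma i_L_pos: "0 \<le> x \<Longrightarrow> \<iota> x \<in> \<L> \<and> \<T> (\<iota> x) = \<iota> (T x)"
proof -
  assume x: "0 \<le> x"
  have net: "approx_net \<iota> T {x} (\<iota> x)"
    using x by (auto simp: approx_net_def up_directed_def isLub_UNIV_iff)
  have "isLub UNIV (\<iota> ` T ` {x}) (\<iota> (T x))" by (auto simp: isLub_UNIV_iff)
  then have "tau (\<iota> x) = \<iota> (T x)" using approx_net_tau(3)[OF net] isLub_UNIV_unique by blast
  then show ?thesis using L1_posI[OF net] x by (simp add: T_ext_pos L1_pos_eq)
qed

text \<open>Applying T to the net \<open>below f\<close> gives a net for \<open>tau f\<close>, and
  idempotence of T leaves the image of this net under T unchanged.\<close>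

lemma T_in_L_pos:
  assumes f: "f \<in> L1_pos \<iota> T"
  shows "tau f \<in> L1_pos \<iota> T \<and> tau (tau f) = tau f"
proof -
  have dir: "up_directed (T ` below f)" 
    using f by (intro up_directed_image up_directed_below) (auto simp: L1_pos_iff T_mono)
  have "T ` T ` below f = T ` below f" by (simp add: image_image T_T)
  then have lub: "isLub UNIV (\<iota> ` T ` T ` below f) (tau f)" using isLub_tau[OF f] by simp
  have net: "approx_net \<iota> T (T ` below f) (tau f)"
    by (rule approx_netI[OF dir _ isLub_tau[OF f] lub]) (auto simp: below_def T_pos)
  show ?thesis using isLub_UNIV_unique[OF approx_net_tau(3)[OF net] lub] L1_posI[OF net] by simp
qed

lemma T_in_L [simp]: "x \<in> \<L> \<Longrightarrow> \<T> x \<in> \<L>" and T_ext_idem [simp]: "x \<in> \<L> \<Longrightarrow> \<T> (\<T> x) = \<T> x"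
proof -
  assume "x \<in> \<L>"
  then obtain f g where fg: "f \<in> L1_pos \<iota> T" "g \<in> L1_pos \<iota> T" "x = f - g" by (rule L_cases)
  then have *: "tau f \<in> L1_pos \<iota> T" "tau g \<in> L1_pos \<iota> T" using T_in_L_pos by auto
  have eq: "\<T> x = tau f - tau g" using fg T_ext_diff_pos by simp
  show "\<T> x \<in> \<L>" unfolding eq using * by (simp add: L1_pos_eq)
  show "\<T> (\<T> x) = \<T> x" using T_in_L_pos[OF fg(1)] T_in_L_pos[OF fg(2)] T_ext_diff_pos[OF *] eq by simp
qed

section \<open>The range of the extension as a vector lattice\<close>

abbreviation AA ("\<A>") where "\<A> \<equiv> range_T \<iota> T"

lemma A_iff: "a \<in> \<A> \<longleftrightarrow> a \<in> \<L> \<and> \<T> a = a"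
  unfolding range_T_def by force

lemma T_in_A [simp]: "x \<in> \<L> \<Longrightarrow> \<T> x \<in> \<A>"
  by (simp add: A_iff)

lemma A_add [simp]: "a \<in> \<A> \<Longrightarrow> b \<in> \<A> \<Longrightarrow> a + b \<in> \<A>"
  and A_diff [simp]: "a \<in> \<A> \<Longrightarrow> b \<in> \<A> \<Longrightarrow> a - b \<in> \<A>"
  and A_uminus [simp]: "a \<in> \<A> \<Longrightarrow> - a \<in> \<A>"
  and A_scaleR [simp]: "a \<in> \<A> \<Longrightarrow> c *\<^sub>R a \<in> \<A>"
  and A_0 [simp]: "0 \<in> \<A>"
  by (simp_all add: A_iff)

text \<open>The element \<T> x - x is positive and annihilated by \<T>, hence 0. One inequality thus
  suffices for membership in A: this one suits suprema and convex expressions,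
  \<open>A_if_T_le\<close> suits infima.\<close>

lemma A_if_le_T: 
  assumes "x \<in> \<L>" "x \<le> \<T> x"
  shows "x \<in> \<A>"
proof -
  have "\<T> x - x = 0" using assms by (intro T_eq_0) simp_all
  then show ?thesis using assms by (simp add: A_iff)
qed

lemma A_if_T_le: 
  assumes "x \<in> \<L>" "\<T> x \<le> x"
  shows "x \<in> \<A>"
proof -
  have "x - \<T> x = 0" using assms by (intro T_eq_0) simp_all
  then show ?thesis using assms by (simp add: A_iff)
qed

lemma L_abs [simp]: "x \<in> \<L> \<Longrightarrow> \<bar>x\<bar> \<in> \<L>"
  by (simp add: L1_iff)

lemma A_abs [simp]: "a \<in> \<A> \<Longrightarrow> \<bar>a\<bar> \<in> \<A>"
proof (rule A_if_le_T)
  assume a: "a \<in> \<A>"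
  then have aL: "a \<in> \<L>" and aT: "\<T> a = a" by (simp_all add: A_iff)
  then show "\<bar>a\<bar> \<in> \<L>" by simp
  have "\<T> a \<le> \<T> \<bar>a\<bar>" "\<T> (- a) \<le> \<T> \<bar>a\<bar>" using aL by (intro T_ext_mono; simp add: abs_ge_self abs_ge_minus_self)+
  then show "\<bar>a\<bar> \<le> \<T> \<bar>a\<bar>" using aT aL by (intro abs_leI) simp_all
qed

lemma L_pprt [simp]: "x \<in> \<L> \<Longrightarrow> pprt x \<in> \<L>"
  and A_pprt [simp]: "x \<in> \<A> \<Longrightarrow> pprt x \<in> \<A>"
  by (simp_all add: pprt_eq)

lemma L_inf [simp]: "x \<in> \<L> \<Longrightarrow> y \<in> \<L> \<Longrightarrow> inf x y \<in> \<L>"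
  and A_inf [simp]: "x \<in> \<A> \<Longrightarrow> y \<in> \<A> \<Longrightarrow> inf x y \<in> \<A>"
  by (simp_all add: inf_eq_pprt)

end

section \<open>Averaging, square roots and the space $L^2(T)$\<close>

text \<open>At s = -(A + 1) / B the affine function would take the value -1.\<close>

lemma linear_nonneg_imp_0:
  fixes A B :: real
  assumes "\<And>s. 0 \<le> A + s * B"
  shows "B = 0"
proof (rule ccontr)
  assume "B \<noteq> 0"
  then show False using assms[of "- (A + 1) / B"] by simp
qed

section \<open>Multiplication and suprema, truncation\<close>

context unital_f_algebra
begin

text \<open>Where c \<le> N, an excess of c s over y gives s - d \<ge> (c s - y) / N for every d, so
  s could be lowered. As c may be unbounded, the lowering is confined to such regions.\<close>

lemma mult_isLub:
  fixes c s :: 'u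
  assumes c: "0 \<le> c" and lub: "isLub UNIV D s"
  shows "isLub UNIV ((\<lambda>d. c * d) ` D) (c * s)"
proof (rule isLub_UNIV_I)
  fix d assume "d \<in> (\<lambda>d. c * d) ` D"
  then show "d \<le> c * s" using c isLub_upper[OF lub] by (auto intro: mult_left_mono)
next
  fix y assume y: "\<And>d. d \<in> (\<lambda>d. c * d) ` D \<Longrightarrow> d \<le> y"
  \<comment> \<open>The excess of c s over y, cut down to the region c < N by the second factor of
    the infimum; s - g N / N is still an upper bound of D.\<close>
  define g where "g = (\<lambda>N. inf (pprt (c * s - y)) (pprt (N *\<^sub>R one - c)))"
  have g: "g N \<le> 0" if N: "0 < N" for N
  proof -
    have "s \<le> s - (1 / N) *\<^sub>R g N"
    proof (rule isLub_least[OF lub])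
      fix d assume d: "d \<in> D"
      show "d \<le> s - (1 / N) *\<^sub>R g N"
      proof (rule le_by_points[of "{c, s, y, d}"])
        fix V \<omega> assume p: "real_point one V \<omega>" and Z: "{c, s, y, d} \<subseteq> V"
        interpret real_point one V \<omega> by fact
        have [simp]: "c \<in> V" "s \<in> V" "y \<in> V" "d \<in> V" using Z by auto
        have le: "\<omega> c * \<omega> d \<le> \<omega> y" "\<omega> d \<le> \<omega> s" "0 \<le> \<omega> c"
          using pt_mono[of "c * d" y] pt_mono[of d s] pt_mono[of 0 c] y d c isLub_upper[OF lub] by auto
        have "min (max (\<omega> c * \<omega> s - \<omega> y) 0) (max (N - \<omega> c) 0) \<le> N * (\<omega> s - \<omega> d)"
        proof (cases "\<omega> c \<le> N")
          case True
          have "\<omega> c * \<omega> s - \<omega> y \<le> \<omega> c * (\<omega> s - \<omega> d)" using le by (simp add: algebra_simps)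
          also have "\<dots> \<le> N * (\<omega> s - \<omega> d)" using True le by (intro mult_right_mono) auto
          finally have "\<omega> c * \<omega> s - \<omega> y \<le> N * (\<omega> s - \<omega> d)" .
          moreover have "0 \<le> N * (\<omega> s - \<omega> d)" using N le by simp
          ultimately show ?thesis by auto
        next
          case False
          have "0 \<le> N * (\<omega> s - \<omega> d)" using N le by simp
          then show ?thesis using False by auto
        qed
        then show "\<omega> d \<le> \<omega> (s - (1 / N) *\<^sub>R g N)"
          using N by (simp add: g_def field_simps)
      qed simp
    qed
    then have "(1 / N) *\<^sub>R g N \<le> 0" by simp
    then have "N *\<^sub>R (1 / N) *\<^sub>R g N \<le> N *\<^sub>R 0" using N by (intro scaleR_left_mono) auto
    then show ?thesis using N by simp
  qed
  show "c * s \<le> y"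
  proof (rule le_by_points[of "{c, s, y}"])
    fix V \<omega> assume p: "real_point one V \<omega>" and Z: "{c, s, y} \<subseteq> V"
    interpret real_point one V \<omega> by fact
    have [simp]: "c \<in> V" "s \<in> V" "y \<in> V" using Z by auto
    have "\<omega> (g (max (\<omega> c) 0 + 1)) \<le> \<omega> 0" using g[of "max (\<omega> c) 0 + 1"] by (intro pt_mono) (auto simp: g_def)
    then show "\<omega> (c * s) \<le> \<omega> y" by (auto simp: g_def min_def max_def split: if_splits)
  qed simp
qed

definition trunc :: "'u \<Rightarrow> nat \<Rightarrow> 'u" where
  "trunc x n = inf x (real n *\<^sub>R one)"

lemma trunc_mono: "x \<le> y \<Longrightarrow> m \<le> n \<Longrightarrow> trunc x m \<le> trunc y n"
  unfolding trunc_def by (intro inf_mono scaleR_right_mono) auto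

lemma trunc_nonneg: "0 \<le> x \<Longrightarrow> 0 \<le> trunc x n"
  by (simp add: trunc_def scaleR_nonneg_nonneg)

lemma trunc_le: "trunc x n \<le> x" and trunc_le_n: "trunc x n \<le> real n *\<^sub>R one"
  by (simp_all add: trunc_def)

text \<open>At a given point the value of x is a finite real, and truncation at any larger n leaves
  it unchanged.\<close>

lemma isLub_trunc: "isLub UNIV (range (trunc x)) x"
proof (rule isLub_UNIV_I)
  fix y assume y: "\<And>d. d \<in> range (trunc x) \<Longrightarrow> d \<le> y"
  show "x \<le> y"
  proof (rule le_by_points[of "{x, y}"])
    fix V \<omega> assume p: "real_point one V \<omega>" and Z: "{x, y} \<subseteq> V"
    interpret real_point one V \<omega> by fact
    have [simp]: "x \<in> V" "y \<in> V" using Z by auto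
    obtain n :: nat where n: "\<omega> x \<le> real n" using real_arch_simple by blast
    have "\<omega> (trunc x n) \<le> \<omega> y" using y by (intro pt_mono) (auto simp: trunc_def)
    then show "\<omega> x \<le> \<omega> y" using n by (simp add: trunc_def)
  qed simp
qed (auto simp: trunc_le)

lemma up_directed_trunc: "up_directed (range (trunc x))"
proof (rule up_directed_image)
  show "up_directed (UNIV :: nat set)"
    by (simp add: up_directed_def) (meson nat_le_linear order_refl)
qed (simp add: trunc_mono)

lemma square_le_iff:
  fixes r s :: 'u
  assumes "0 \<le> r" "0 \<le> s" "r * r \<le> s * s"
  shows "r \<le> s"
proof (rule le_by_points[of "{r, s}"])
  fix V \<omega> assume p: "real_point one V \<omega>" and Z: "{r, s} \<subseteq> V"
  interpret real_point one V \<omega> by fact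
  have [simp]: "r \<in> V" "s \<in> V" using Z by auto
  have "\<omega> r * \<omega> r \<le> \<omega> s * \<omega> s" "0 \<le> \<omega> s" 
    using pt_mono[OF _ _ assms(3)] pt_mono[OF _ _ assms(2)] by auto
  then show "\<omega> r \<le> \<omega> s" by (smt (verit) mult_strict_mono)
qed simp

text \<open>Follows from (x + y)^2 \<ge> 0 and (x - y)^2 \<ge> 0. It makes products of square
  integrable elements integrable.\<close>

lemma abs_mult_le_squares: "\<bar>x * y\<bar> \<le> \<bar>x * x + y * y\<bar>" for x y :: 'u
proof (rule le_by_points[of "{x, y}"])
  fix V \<omega> assume p: "real_point one V \<omega>" and Z: "{x, y} \<subseteq> V"
  interpret real_point one V \<omega> by fact
  have [simp]: "x \<in> V" "y \<in> V" using Z by auto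
  have "0 \<le> (\<omega> x + \<omega> y)\<^sup>2" "0 \<le> (\<omega> x - \<omega> y)\<^sup>2" by simp_all
  then have "\<bar>\<omega> x * \<omega> y\<bar> \<le> \<bar>\<omega> x * \<omega> x + \<omega> y * \<omega> y\<bar>"
    by (simp add: power2_eq_square algebra_simps)
  then show "\<omega> \<bar>x * y\<bar> \<le> \<omega> \<bar>x * x + y * y\<bar>" by simp
qed simp

lemma square_of_abs: "\<bar>x\<bar> * \<bar>x\<bar> = x * x" for x :: 'u
proof (rule eq_by_points[of "{x}"])
  fix V \<omega> assume p: "real_point one V \<omega>" and Z: "{x} \<subseteq> V"
  interpret real_point one V \<omega> by fact
  show "\<omega> (\<bar>x\<bar> * \<bar>x\<bar>) = \<omega> (x * x)" using Z by simp
qed simp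

lemma square_mono: "0 \<le> x \<Longrightarrow> x \<le> y \<Longrightarrow> x * x \<le> y * y" for x y :: 'u
  by (meson mult_mono order_trans)

end

text \<open>The assumption on \<open>one\<close> is the form in which T e = e enters, with
  \<open>one\<close> later taken to be \<iota> e.\<close>

locale cond_exp_L2 = cond_exp T \<iota> + unital_f_algebra one
  for T :: "'e::dedekind_complete_riesz_space \<Rightarrow> 'e"
    and \<iota> :: "'e \<Rightarrow> 'u::{universally_complete_riesz_space,f_algebra}"
    and one :: 'u +
  assumes one_in_A [simp]: "one \<in> \<A>"
begin

section \<open>Jensen's inequality and the averaging property\<close>

lemma A_in_L [simp]: "a \<in> \<A> \<Longrightarrow> a \<in> \<L>" and T_A [simp]: "a \<in> \<A> \<Longrightarrow> \<T> a = a"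
  by (simp_all add: A_iff)

lemma bounded_in_L:
  assumes "\<bar>x\<bar> \<le> c *\<^sub>R one"
  shows "x \<in> \<L>"
proof (rule L_solid[of "c *\<^sub>R one"])
  show "\<bar>x\<bar> \<le> \<bar>c *\<^sub>R one\<bar>" using assms abs_ge_self order_trans by blast
qed simp

lemma trunc_in_L [simp]: "0 \<le> x \<Longrightarrow> trunc x n \<in> \<L>"
  by (rule bounded_in_L[of _ "real n"]) (simp add: trunc_nonneg trunc_le_n)

lemma trunc_in_A [simp]: "a \<in> \<A> \<Longrightarrow> trunc a n \<in> \<A>"
  by (simp add: trunc_def)

lemma bounded_square_in_L:
  assumes "0 \<le> x" "x \<le> c *\<^sub>R one"
  shows "x * x \<in> \<L>"
proof (rule bounded_in_L[of _ "c * c"])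
  have "x * x \<le> (c *\<^sub>R one) * (c *\<^sub>R one)" using assms by (rule square_mono)
  then show "\<bar>x * x\<bar> \<le> (c * c) *\<^sub>R one" by (simp add: f_algebra_square_nonneg)
qed

text \<open>The supremum over real \<open>t\<close> of \<open>2 t z - t\<^sup>2\<close> is \<open>z\<^sup>2\<close>.\<close>

lemma jensen_square:
  assumes x: "x \<in> \<L>" and xx: "x * x \<in> \<L>"
  shows "\<T> x * \<T> x \<le> \<T> (x * x)"
proof -
  have le: "(2 * t) *\<^sub>R \<T> x - (t * t) *\<^sub>R one \<le> \<T> (x * x)" for t
  proof -
    have "0 \<le> (x - t *\<^sub>R one) * (x - t *\<^sub>R one)" by (rule f_algebra_square_nonneg)
    then have "(2 * t) *\<^sub>R x - (t * t) *\<^sub>R one \<le> x * x"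
      by (simp add: algebra_simps scaleR_2 flip: scaleR_scaleR)
    from T_ext_mono[OF _ _ this] show ?thesis using x xx by simp
  qed
  show ?thesis
  proof (rule le_by_points[of "{\<T> x}"])
    fix V \<omega> assume p: "real_point one V \<omega>" and Z: "{\<T> x} \<subseteq> V" and [simp]: "\<T> (x * x) \<in> V"
    interpret real_point one V \<omega> by fact
    have [simp]: "\<T> x \<in> V" using Z by simp
    show "\<omega> (\<T> x * \<T> x) \<le> \<omega> (\<T> (x * x))"
      using pt_mono[OF _ _ le[of "\<omega> (\<T> x)"]] by simp
  qed simp
qed

text \<open>Jensen with \<T> a = a reads a^2 \<le> \<T> (a^2), and \<open>A_if_le_T\<close> turns
  this into membership.\<close>

lemma A_square_bounded:
  assumes a: "a \<in> \<A>" "0 \<le> a" "a \<le> c *\<^sub>R one"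
  shows "a * a \<in> \<A>"
proof -
  have aa: "a * a \<in> \<L>" using bounded_square_in_L a by blast
  show ?thesis using jensen_square[of a] a aa by (intro A_if_le_T) simp_all
qed

text \<open>Nothing yet says that a^2 is integrable. The squares of the truncations of |a| are fixed
  by \<T> and bounded by a^2, so monotone convergence gives integrability and invariance
  together.\<close>

lemma A_square:
  assumes a: "a \<in> \<A>"
  shows "a * a \<in> \<A>"
proof -
  let ?b = "\<bar>a\<bar>"
  let ?D = "(\<lambda>x. x * x) ` range (trunc ?b)"
  have b: "?b \<in> \<A>" "0 \<le> ?b" using a by simp_all
  have D: "d \<in> \<A>" "0 \<le> d" "d \<le> a * a" if "d \<in> ?D" for d
  proof -
    obtain n where n: "d = trunc ?b n * trunc ?b n" using \<open>d \<in> ?D\<close> by blast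
    show "d \<in> \<A>" unfolding n using b trunc_nonneg[OF b(2)] trunc_le_n by (intro A_square_bounded[of _ "real n"]) auto
    show "0 \<le> d" unfolding n by (rule f_algebra_square_nonneg)
    show "d \<le> a * a" unfolding n square_of_abs[of a, symmetric]
      by (intro square_mono trunc_nonneg trunc_le) simp
  qed
  have dir: "up_directed ?D"
    by (intro up_directed_image up_directed_trunc square_mono) (auto simp: trunc_nonneg)
  have lub: "isLub UNIV ?D (a * a)"
  proof (rule isLub_UNIV_I[OF D(3)])
    fix y assume y: "\<And>d. d \<in> ?D \<Longrightarrow> d \<le> y"
    show "a * a \<le> y"
    proof (rule le_by_points[of "{a}"])
      fix V \<omega> assume p: "real_point one V \<omega>" and Z: "{a} \<subseteq> V" and [simp]: "y \<in> V"
      interpret real_point one V \<omega> by fact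
      have [simp]: "a \<in> V" using Z by simp
      obtain n :: nat where n: "\<bar>\<omega> a\<bar> \<le> real n" using real_arch_simple by blast
      have "\<omega> (trunc ?b n * trunc ?b n) \<le> \<omega> y" using y by (intro pt_mono) (auto simp: trunc_def)
      then show "\<omega> (a * a) \<le> \<omega> y" using n by (simp add: trunc_def min_absorb1)
    qed simp
  qed
  have le: "\<T> d \<le> a * a" if "d \<in> ?D" for d
    using D(3)[OF that] T_A[OF D(1)[OF that]] by simp
  note L = T_isLub[OF dir A_in_L[OF D(1)] D(2) lub le]
  have "\<T> ` ?D = (\<lambda>x. x) ` ?D" by (rule image_cong[OF refl T_A[OF D(1)]])
  then have "\<T> (a * a) = a * a" using L(2) lub isLub_UNIV_unique by (metis image_ident)
  then show ?thesis unfolding A_iff using L(1) by blast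
qed

lemma mult_polar: "a * b = (1/4) *\<^sub>R ((a + b) * (a + b) - (a - b) * (a - b))" for a b :: 'u
proof (rule eq_by_points[of "{a, b}"])
  fix V \<omega> assume p: "real_point one V \<omega>" and Z: "{a, b} \<subseteq> V"
  interpret real_point one V \<omega> by fact
  show "\<omega> (a * b) = \<omega> ((1/4) *\<^sub>R ((a + b) * (a + b) - (a - b) * (a - b)))"
    using Z by (simp add: algebra_simps)
qed simp

lemma A_mult [simp]: "a \<in> \<A> \<Longrightarrow> b \<in> \<A> \<Longrightarrow> a * b \<in> \<A>"
  unfolding mult_polar[of a b] by (intro A_scaleR A_diff A_square A_add)

lemma mult_in_L: "x * x \<in> \<L> \<Longrightarrow> y * y \<in> \<L> \<Longrightarrow> x * y \<in> \<L>"
  by (rule L_solid[OF L_add abs_mult_le_squares])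

text \<open>\<open>T (x y) - T x * T y\<close> is a positive semidefinite form by \<open>jensen_square\<close>, whose
  kernel contains \<open>A\<close>.\<close>

lemma averaging_square:
  assumes x: "x \<in> \<L>" "x * x \<in> \<L>" and a: "a \<in> \<A>"
  shows "\<T> (a * x) = a * \<T> x"
proof -
  have aa: "a * a \<in> \<A>" using a by simp
  have ax: "a * x \<in> \<L>" by (rule mult_in_L) (use aa x in simp_all)
  \<comment> \<open>Jensen for x + s a. As \<T> (a^2) = a^2 = (\<T> a)^2, the terms in s^2 cancel;
    an affine function of s that is nonnegative for all s remains, so its slope is 0.\<close>
  have le: "(\<T> x + s *\<^sub>R a) * (\<T> x + s *\<^sub>R a) \<le> \<T> (x * x) + (2 * s) *\<^sub>R \<T> (a * x) + (s * s) *\<^sub>R (a * a)" for s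
  proof -
    have eq: "(x + s *\<^sub>R a) * (x + s *\<^sub>R a) = x * x + (2 * s) *\<^sub>R (a * x) + (s * s) *\<^sub>R (a * a)"
      by (simp add: algebra_simps mult_commute[of x a] scaleR_2 flip: scaleR_scaleR)
    have "\<T> (x + s *\<^sub>R a) * \<T> (x + s *\<^sub>R a) \<le> \<T> ((x + s *\<^sub>R a) * (x + s *\<^sub>R a))"
      using x a aa ax by (intro jensen_square) (simp_all add: eq)
    then show ?thesis unfolding eq using x a aa ax by simp
  qed
  show ?thesis
  proof (rule eq_by_points[of "{\<T> x, a, \<T> (x * x)}"])
    fix V \<omega> assume p: "real_point one V \<omega>" and Z: "{\<T> x, a, \<T> (x * x)} \<subseteq> V"
      and [simp]: "\<T> (a * x) \<in> V"
    interpret real_point one V \<omega> by fact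
    have [simp]: "\<T> x \<in> V" "a \<in> V" "\<T> (x * x) \<in> V" using Z by auto
    let ?B = "2 * (\<omega> (\<T> (a * x)) - \<omega> a * \<omega> (\<T> x))"
    have "0 \<le> (\<omega> (\<T> (x * x)) - \<omega> (\<T> x) * \<omega> (\<T> x)) + s * ?B" for s
      using pt_mono[OF _ _ le[of s]] by (simp add: algebra_simps)
    then have "?B = 0" by (rule linear_nonneg_imp_0)
    then show "\<omega> (\<T> (a * x)) = \<omega> (a * \<T> x)" by simp
  qed simp
qed

text \<open>Truncations of x are square integrable, so \<open>averaging_square\<close> applies to
  them; order continuity of multiplication and monotone convergence pass to the limit on both
  sides.\<close>

lemma averaging_pos:
  assumes x: "x \<in> \<L>" "0 \<le> x" and a: "a \<in> \<A>" "0 \<le> a"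
  shows "a * x \<in> \<L> \<and> \<T> (a * x) = a * \<T> x"
proof -
  let ?D = "(\<lambda>d. a * d) ` range (trunc x)"
  have sq: "trunc x n * trunc x n \<in> \<L>" for n
    using x by (intro bounded_square_in_L[of _ "real n"] trunc_nonneg trunc_le_n)
  have Tn: "\<T> (a * trunc x n) = a * \<T> (trunc x n)" for n
    using x a sq by (intro averaging_square) simp_all
  have anL: "a * trunc x n \<in> \<L>" for n
    by (rule mult_in_L) (use a sq in simp_all)
  have le: "\<T> (trunc x n) \<le> \<T> x" for n
    using x by (intro T_ext_mono trunc_le) simp_all
  have dir: "up_directed ?D"
    using a by (intro up_directed_image up_directed_trunc mult_left_mono)
  have lub: "isLub UNIV ?D (a * x)" using mult_isLub[OF a(2) isLub_trunc] .
  have D: "d \<in> \<L>" "0 \<le> d" "\<T> d \<le> a * \<T> x" if "d \<in> ?D" for d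
    using that anL a x le by (auto simp: Tn trunc_nonneg intro!: mult_nonneg_nonneg mult_left_mono)
  have 1: "a * x \<in> \<L>" "isLub UNIV (\<T> ` ?D) (\<T> (a * x))"
    using T_isLub[OF dir D(1,2) lub D(3)] by auto
  have "isLub UNIV (\<T> ` range (trunc x)) (\<T> x)"
    using x le by (intro T_isLub(2)[OF up_directed_trunc _ _ isLub_trunc, of _ "\<T> x"]) (auto simp: trunc_nonneg)
  then have "isLub UNIV ((\<lambda>d. a * d) ` \<T> ` range (trunc x)) (a * \<T> x)"
    by (rule mult_isLub[OF a(2)])
  moreover have "(\<lambda>d. a * d) ` \<T> ` range (trunc x) = \<T> ` ?D"
    by (simp add: image_image Tn)
  ultimately show ?thesis using 1 isLub_UNIV_unique by metis
qed

lemma A_mult_L [simp]: "a \<in> \<A> \<Longrightarrow> x \<in> \<L> \<Longrightarrow> a * x \<in> \<L>"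
  and averaging [simp]: "a \<in> \<A> \<Longrightarrow> x \<in> \<L> \<Longrightarrow> \<T> (a * x) = a * \<T> x"
proof -
  assume a: "a \<in> \<A>" and x: "x \<in> \<L>"
  have *: "pprt u * pprt v \<in> \<L> \<and> \<T> (pprt u * pprt v) = pprt u * \<T> (pprt v)"
    if "u \<in> \<A>" "v \<in> \<L>" for u v
    using that by (intro averaging_pos) simp_all
  note parts = *[OF a x] *[OF a L_uminus[OF x]] *[OF A_uminus[OF a] x] *[OF A_uminus[OF a] L_uminus[OF x]]
  have eq: "a * x = (pprt a * pprt x - pprt a * pprt (- x)) - (pprt (- a) * pprt x - pprt (- a) * pprt (- x))"
    by (metis pprt_diff_pprt_uminus left_diff_distrib right_diff_distrib)
  show "a * x \<in> \<L>" unfolding eq using parts by simp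
  have "\<T> (a * x) = pprt a * (\<T> (pprt x) - \<T> (pprt (- x))) - pprt (- a) * (\<T> (pprt x) - \<T> (pprt (- x)))"
    unfolding eq using parts by (simp add: right_diff_distrib)
  also have "\<dots> = (pprt a - pprt (- a)) * \<T> (pprt x - pprt (- x))"
    using x by (simp add: left_diff_distrib)
  finally show "\<T> (a * x) = a * \<T> x" by (simp only: pprt_diff_pprt_uminus)
qed

text \<open>By the inequality of arithmetic and geometric means, the root of b is the infimum of (t
  + b / t) / 2 over real t > 0. Each such expression lies in A, and so does the infimum by
  \<open>A_if_T_le\<close>.\<close>

lemma sqrt_exists:
  assumes b: "b \<in> \<A>" "0 \<le> b"
  obtains r where "r \<in> \<A>" "0 \<le> r" "r * r = b"
proof -
  define m where "m = (\<lambda>t. (t/2) *\<^sub>R one + (1 / (2 * t)) *\<^sub>R b)"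
  define r where "r = Inf (m ` {0<..})"
  have m0: "0 \<le> m t" if "0 < t" for t
    using b that by (simp add: m_def scaleR_nonneg_nonneg)
  have bdd: "bdd_below (m ` {0<..})" using m0 by (auto intro!: bdd_belowI[of _ 0])
  have rle: "r \<le> m t" if "0 < t" for t
    unfolding r_def using that bdd by (intro cInf_lower) auto
  have rge: "y \<le> r" if "\<And>t. 0 < t \<Longrightarrow> y \<le> m t" for y
    unfolding r_def using that by (intro cInf_greatest) (auto intro: exI[of _ 1])
  have r0: "0 \<le> r" using m0 rge by blast
  have "m 1 \<in> \<L>" using b by (simp add: m_def)
  then have rL: "r \<in> \<L>" using L_mono[of "m 1" r] r0 rle[of 1] by simp
  have rA: "r \<in> \<A>"
  proof (rule A_if_T_le[OF rL])
    show "\<T> r \<le> r"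
    proof (rule rge)
      fix t :: real assume t: "0 < t"
      have mA: "m t \<in> \<A>" using b by (simp add: m_def)
      have "\<T> r \<le> \<T> (m t)" using rL mA rle[OF t] by (intro T_ext_mono) simp_all
      then show "\<T> r \<le> m t" using mA by simp
    qed
  qed
  have 1: "r * r \<le> b"
  proof (rule le_by_points[of "{r, b}"])
    fix V \<omega> assume p: "real_point one V \<omega>" and Z: "{r, b} \<subseteq> V"
    interpret real_point one V \<omega> by fact
    have [simp]: "r \<in> V" "b \<in> V" using Z by auto
    have pos: "0 \<le> \<omega> r" "0 \<le> \<omega> b" using pt_mono[OF _ _ r0] pt_mono[OF _ _ b(2)] by auto
    have rt: "\<omega> r \<le> t / 2 + \<omega> b / (2 * t)" if "0 < t" for t
      using pt_mono[OF _ _ rle[OF that]] by (simp add: m_def)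
    \<comment> \<open>The optimal t is the root of \<omega> b; adding \<epsilon> keeps t positive
      when \<omega> b = 0.\<close>
    have "\<omega> r \<le> sqrt (\<omega> b) + \<epsilon>" if \<epsilon>: "0 < \<epsilon>" for \<epsilon>
    proof -
      let ?t = "sqrt (\<omega> b) + \<epsilon>"
      have t: "0 < ?t" using \<epsilon> pos by (simp add: add_nonneg_pos)
      have "\<omega> b = sqrt (\<omega> b) * sqrt (\<omega> b)" using pos by simp
      also have "\<dots> \<le> ?t * ?t" using pos \<epsilon> by (intro mult_mono) auto
      finally have "\<omega> b \<le> ?t * ?t" .
      moreover have "B / (2 * t) \<le> t / 2" if "B \<le> t * t" "0 < t" for B t :: real
        using that by (simp add: field_simps)
      ultimately have "\<omega> b / (2 * ?t) \<le> ?t / 2" using t by blast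
      with rt[OF t] have "\<omega> r \<le> ?t / 2 + ?t / 2" by (rule order_trans[OF _ add_left_mono])
      then show ?thesis by (simp only: field_sum_of_halves)
    qed
    then have "\<omega> r \<le> sqrt (\<omega> b)" by (rule field_le_epsilon)
    then have "\<omega> r * \<omega> r \<le> sqrt (\<omega> b) * sqrt (\<omega> b)" using pos by (intro mult_mono) auto
    then show "\<omega> (r * r) \<le> \<omega> b" using pos by simp
  qed simp
  \<comment> \<open>The converse b \<le> r^2 argues by perturbation: w is the defect b - r^2 cut off
    at \<open>one\<close>, and \<open>w'\<close> lives where \<eta> r < w \<le> one, so r is bounded
    by 1 / \<eta> there. Adding the tiny \<open>w'\<close> to r keeps it below every m t.\<close>
  define w where "w = inf (pprt (b - r * r)) one"
  define w' where "w' = (\<lambda>\<eta>. (\<eta> * \<eta>) *\<^sub>R pprt (w - \<eta> *\<^sub>R r))"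
  have w': "w' \<eta> \<le> 0" if \<eta>: "0 < \<eta>" "\<eta> \<le> 1/4" for \<eta>
  proof -
    have "r + w' \<eta> \<le> r"
    proof (rule rge)
      fix t :: real assume t: "0 < t"
      show "r + w' \<eta> \<le> m t"
      proof (rule le_by_points[of "{r, b}"])
        fix V \<omega> assume p: "real_point one V \<omega>" and Z: "{r, b} \<subseteq> V"
        interpret real_point one V \<omega> by fact
        have [simp]: "r \<in> V" "b \<in> V" using Z by auto
        have [simp]: "w \<in> V" by (simp add: w_def)
        have pos: "0 \<le> \<omega> r" "0 \<le> \<omega> b" using pt_mono[OF _ _ r0] pt_mono[OF _ _ b(2)] by auto
        have rb: "\<omega> r * \<omega> r \<le> \<omega> b" using pt_mono[OF _ _ 1] by simp
        define R where "R = \<omega> r"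
        define B where "B = \<omega> b"
        define W where "W = \<omega> w"
        have W: "0 \<le> W" "W \<le> 1" "W \<le> B - R * R"
          using rb by (auto simp: W_def w_def B_def R_def)
        define u where "u = \<eta> * \<eta> * max (W - \<eta> * R) 0"
        have u0: "0 \<le> u" by (simp add: u_def)
        \<comment> \<open>The bounds R u \<le> W / 4 and u^2 \<le> W / 16 leave the increase 2 R u +
          u^2 below W, which is at most B - R^2.\<close>
        have "(R + u) * (R + u) \<le> B"
        proof (cases "W \<le> \<eta> * R")
          case True
          then show ?thesis using rb by (simp add: u_def R_def B_def)
        next
          case False
          have u1: "u \<le> \<eta> * \<eta> * W" unfolding u_def using W pos \<eta> by (intro mult_left_mono) (auto simp: R_def)
          have "\<eta> * R \<le> 1" using False W by simp
          have "R * u \<le> R * (\<eta> * \<eta> * W)" using u1 pos by (intro mult_left_mono) (auto simp: R_def)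
          also have "\<dots> = (\<eta> * R) * (\<eta> * W)" by simp
          also have "\<dots> \<le> 1 * (\<eta> * W)" using \<open>\<eta> * R \<le> 1\<close> W \<eta> by (intro mult_right_mono) auto
          also have "\<dots> \<le> 1/4 * W" using mult_right_mono[OF \<eta>(2) W(1)] by simp
          finally have Ru: "R * u \<le> W / 4" by simp
          have "\<eta> * \<eta> \<le> 1/4 * (1/4)" using \<eta> by (intro mult_mono) auto
          then have "\<eta> * \<eta> * W \<le> 1/16 * W" using W by (intro mult_right_mono) auto
          then have u2: "u \<le> W / 16" using u1 by simp
          then have "u * u \<le> (W / 16) * 1" using u0 W by (intro mult_mono) auto
          then have "u * u \<le> W / 16" by simp
          then show ?thesis using Ru W by (simp add: algebra_simps)
        qed
        moreover have "2 * t * (R + u) \<le> t * t + (R + u) * (R + u)"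
          using zero_le_square[of "t - (R + u)"] by (simp add: algebra_simps)
        ultimately have "2 * t * (R + u) \<le> t * t + B" by simp
        then have "R + u \<le> (t * t + B) / (2 * t)" using t by (simp add: field_simps)
        also have "\<dots> = t / 2 + B / (2 * t)" using t by (simp add: field_simps)
        finally show "\<omega> (r + w' \<eta>) \<le> \<omega> (m t)"
          by (simp add: w'_def m_def u_def R_def B_def W_def)
      qed simp
    qed
    then show ?thesis by simp
  qed
  have "b \<le> r * r"
  proof (rule le_by_points[of "{r, b}"])
    fix V \<omega> assume p: "real_point one V \<omega>" and Z: "{r, b} \<subseteq> V"
    interpret real_point one V \<omega> by fact
    have [simp]: "r \<in> V" "b \<in> V" using Z by auto
    have [simp]: "w \<in> V" by (simp add: w_def)
    have pos: "0 \<le> \<omega> r" using pt_mono[OF _ _ r0] by auto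
    have le: "\<omega> w \<le> \<eta> * \<omega> r" if \<eta>: "0 < \<eta>" "\<eta> \<le> 1/4" for \<eta>
    proof -
      have "\<eta> * \<eta> * max (\<omega> w - \<eta> * \<omega> r) 0 \<le> 0"
        using pt_mono[OF _ _ w'[OF \<eta>]] by (simp add: w'_def)
      then show ?thesis using \<eta> by (simp add: mult_le_0_iff max_def split: if_splits)
    qed
    have "\<omega> w \<le> 0"
    proof (rule field_le_epsilon)
      fix \<epsilon> :: real assume \<epsilon>: "0 < \<epsilon>"
      \<comment> \<open>The second bound makes \<eta> times \<omega> r at most \<epsilon>; the 1
        guards against \<omega> r = 0.\<close>
      define \<eta> where "\<eta> = min (1/4) (\<epsilon> / (\<omega> r + 1))"
      have \<eta>: "0 < \<eta>" "\<eta> \<le> 1/4" "\<eta> \<le> \<epsilon> / (\<omega> r + 1)" 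
        unfolding \<eta>_def using \<epsilon> pos by (simp, intro min.cobounded1, intro min.cobounded2)
      have "\<omega> w \<le> \<eta> * \<omega> r" using le \<eta> by blast
      also have "\<dots> \<le> \<epsilon> / (\<omega> r + 1) * \<omega> r" using \<eta> pos by (intro mult_right_mono)
      also have "\<dots> \<le> \<epsilon>" using \<epsilon> pos by (simp add: field_simps)
      finally show "\<omega> w \<le> 0 + \<epsilon>" by simp
    qed
    then show "\<omega> b \<le> \<omega> (r * r)" by (auto simp: w_def min_def max_def split: if_splits)
  qed simp
  with 1 have "r * r = b" by (rule antisym)
  then show thesis using that rA r0 by blast
qed

section \<open>H as an A-module and its vector-valued norm\<close>

abbreviation H2 ("\<H>") where "\<H> \<equiv> L2 \<iota> T"

lemma H_iff: "x \<in> \<H> \<longleftrightarrow> x \<in> \<L> \<and> x * x \<in> \<L>"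
  by (auto simp: L2_def)

lemma H_L [simp]: "x \<in> \<H> \<Longrightarrow> x \<in> \<L>"
  by (simp add: L2_def)

lemma H_mult [simp]: "x \<in> \<H> \<Longrightarrow> y \<in> \<H> \<Longrightarrow> x * y \<in> \<L>"
  by (rule mult_in_L) (simp_all only: H_iff)

lemma H_add [simp]: "x \<in> \<H> \<Longrightarrow> y \<in> \<H> \<Longrightarrow> x + y \<in> \<H>"
  unfolding H_iff[of "x + y"] by (simp add: distrib_left distrib_right)

lemma A_mult_H [simp]: "a \<in> \<A> \<Longrightarrow> x \<in> \<H> \<Longrightarrow> a * x \<in> \<H>"
proof -
  assume a: "a \<in> \<A>" and x: "x \<in> \<H>"
  have "(a * x) * (a * x) = (a * a) * (x * x)" by (metis mult.assoc mult_commute)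
  then show "a * x \<in> \<H>" unfolding H_iff[of "a * x"] using a x by simp
qed

lemma H_scaleR [simp]: "x \<in> \<H> \<Longrightarrow> c *\<^sub>R x \<in> \<H>"
  using A_mult_H[of "c *\<^sub>R one" x] by simp

lemma H_uminus [simp]: "x \<in> \<H> \<Longrightarrow> - x \<in> \<H>"
  unfolding H_iff[of "- x"] by simp

lemma H_diff [simp]: "x \<in> \<H> \<Longrightarrow> y \<in> \<H> \<Longrightarrow> x - y \<in> \<H>"
  using H_add[of x "- y"] by simp

lemma A_in_H [simp]: "a \<in> \<A> \<Longrightarrow> a \<in> \<H>"
  unfolding H_iff by simp

lemma H_solid: "x \<in> \<H> \<Longrightarrow> \<bar>y\<bar> \<le> \<bar>x\<bar> \<Longrightarrow> y \<in> \<H>"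
  unfolding H_iff using L_solid[of x y] square_mono[of "\<bar>y\<bar>" "\<bar>x\<bar>"] L_mono[of "x * x" "y * y"]
  by (auto simp: square_of_abs f_algebra_square_nonneg)

lemma H_mono: "x \<in> \<H> \<Longrightarrow> 0 \<le> y \<Longrightarrow> y \<le> x \<Longrightarrow> y \<in> \<H>"
  using H_solid[of x y] by simp

lemma H_abs [simp]: "x \<in> \<H> \<Longrightarrow> \<bar>x\<bar> \<in> \<H>"
  by (rule H_solid[of x]) simp_all

lemma H_pprt [simp]: "x \<in> \<H> \<Longrightarrow> pprt x \<in> \<H>"
  by (simp add: pprt_eq)

lemma H_sup [simp]: "x \<in> \<H> \<Longrightarrow> y \<in> \<H> \<Longrightarrow> sup x y \<in> \<H>"
  and H_inf [simp]: "x \<in> \<H> \<Longrightarrow> y \<in> \<H> \<Longrightarrow> inf x y \<in> \<H>"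
  by (simp_all add: sup_eq_pprt inf_eq_pprt)

lemma H_definite: "x \<in> \<H> \<Longrightarrow> \<T> (x * x) \<le> 0 \<Longrightarrow> x = 0"
  by (rule square_eq_0, rule T_eq_0) (simp_all add: f_algebra_square_nonneg)

lemma T_square_nonneg: "x \<in> \<H> \<Longrightarrow> 0 \<le> \<T> (x * x)"
  by (simp add: T_nonneg f_algebra_square_nonneg)

text \<open>Real multiples s of y suffice: at a point, \<T> ((x + s y)^2) becomes a real quadratic
  polynomial in s, so the discriminant argument needs no division in A.\<close>

lemma cauchy_schwarz:
  assumes x: "x \<in> \<H>" and y: "y \<in> \<H>"
  shows "\<T> (x * y) * \<T> (x * y) \<le> \<T> (x * x) * \<T> (y * y)"
proof -
  have le: "0 \<le> \<T> (x * x) + (2 * s) *\<^sub>R \<T> (x * y) + (s * s) *\<^sub>R \<T> (y * y)" for s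
  proof -
    have "(x + s *\<^sub>R y) * (x + s *\<^sub>R y) = x * x + (2 * s) *\<^sub>R (x * y) + (s * s) *\<^sub>R (y * y)"
      by (simp add: algebra_simps mult_commute[of y x] scaleR_2 flip: scaleR_scaleR)
    then show ?thesis using T_square_nonneg[of "x + s *\<^sub>R y"] x y by simp
  qed
  show ?thesis
  proof (rule le_by_points[of "{\<T> (x * x), \<T> (x * y), \<T> (y * y)}"])
    fix V \<omega> assume p: "real_point one V \<omega>" and Z: "{\<T> (x * x), \<T> (x * y), \<T> (y * y)} \<subseteq> V"
    interpret real_point one V \<omega> by fact
    have [simp]: "\<T> (x * x) \<in> V" "\<T> (x * y) \<in> V" "\<T> (y * y) \<in> V" using Z by auto
    define X Y P where "X = \<omega> (\<T> (x * x))" "Y = \<omega> (\<T> (y * y))" "P = \<omega> (\<T> (x * y))"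
    have XY: "0 \<le> X" "0 \<le> Y"
      using pt_mono[OF _ _ T_square_nonneg[OF x]] pt_mono[OF _ _ T_square_nonneg[OF y]] by (simp_all add: X_Y_P_def)
    have q: "0 \<le> X + 2 * s * P + s * s * Y" for s
      using pt_mono[OF _ _ le[of s]] by (simp add: X_Y_P_def)
    have "P * P \<le> X * Y"
    proof (cases "Y = 0")
      case True
      then have "0 \<le> X + s * (2 * P)" for s using q[of s] by (simp add: ac_simps)
      then have "2 * P = 0" by (rule linear_nonneg_imp_0)
      then show ?thesis using True by simp
    next
      case False
      \<comment> \<open>The minimiser s = -P / Y of the quadratic, multiplied through by Y.\<close>
      have "0 \<le> Y * (X + 2 * (- P / Y) * P + (- P / Y) * (- P / Y) * Y)"
        using mult_nonneg_nonneg[OF XY(2) q[of "- P / Y"]] .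
      also have "\<dots> = X * Y - P * P" using False by (simp add: field_simps)
      finally show ?thesis by simp
    qed
    then show "\<omega> (\<T> (x * y) * \<T> (x * y)) \<le> \<omega> (\<T> (x * x) * \<T> (y * y))"
      by (simp add: X_Y_P_def)
  qed simp
qed

text \<open>Justifies the description operator: \<open>sqrt_exists\<close> gives a root, and
  nonnegative roots are unique by \<open>square_le_iff\<close>.\<close>

lemma T_norm:
  assumes x: "x \<in> \<H>"
  shows "T_norm \<iota> T x \<in> \<A>" "0 \<le> T_norm \<iota> T x" "T_norm \<iota> T x * T_norm \<iota> T x = \<T> (x * x)"
proof -
  obtain r where r: "r \<in> \<A>" "0 \<le> r" "r * r = \<T> (x * x)"
    using sqrt_exists[of "\<T> (x * x)"] T_square_nonneg[OF x] x by auto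
  have "T_norm \<iota> T x = r" unfolding T_norm_def
  proof (rule the_equality)
    fix s assume "s \<in> \<A> \<and> 0 \<le> s \<and> s * s = \<T> (x * x)"
    then show "s = r" using r square_le_iff[of s r] square_le_iff[of r s] by (intro antisym) auto
  qed (use r in blast)
  then show "T_norm \<iota> T x \<in> \<A>" "0 \<le> T_norm \<iota> T x" "T_norm \<iota> T x * T_norm \<iota> T x = \<T> (x * x)"
    using r by auto
qed

text \<open>Removes the root from the definition of boundedness; all later estimates are between
  squares.\<close>

lemma T_norm_le_iff:
  assumes x: "x \<in> \<H>" and y: "y \<in> \<H>" and k: "0 \<le> k"
  shows "T_norm \<iota> T x \<le> k * T_norm \<iota> T y \<longleftrightarrow> \<T> (x * x) \<le> k * k * \<T> (y * y)"
proof -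
  have eq: "(k * T_norm \<iota> T y) * (k * T_norm \<iota> T y) = k * k * \<T> (y * y)"
    unfolding T_norm(3)[OF y, symmetric] by (metis mult.assoc mult_commute)
  have pos: "0 \<le> k * T_norm \<iota> T y" using k T_norm(2)[OF y] by simp
  show ?thesis
    using square_mono[OF T_norm(2)[OF x], of "k * T_norm \<iota> T y"] square_le_iff[OF T_norm(2)[OF x] pos]
    unfolding eq T_norm(3)[OF x] by blast
qed

end

section \<open>Riesz representation and adjoints\<close>

lemma chain_bounded_maximal:
  fixes A :: "'a::order set"
  assumes "A \<noteq> {}"
    and ub: "\<And>C. C \<subseteq> A \<Longrightarrow> C \<noteq> {} \<Longrightarrow> (\<And>x y. x \<in> C \<Longrightarrow> y \<in> C \<Longrightarrow> x \<le> y \<or> y \<le> x) \<Longrightarrow> \<exists>u\<in>A. \<forall>a\<in>C. a \<le> u"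
  obtains m where "m \<in> A" "\<And>a. a \<in> A \<Longrightarrow> m \<le> a \<Longrightarrow> a = m"
proof -
  have "partial_order_on A (relation_of (\<le>) A)"
    by (rule partial_order_on_relation_ofI) auto
  moreover have "\<exists>u\<in>A. \<forall>a\<in>C. a \<le> u" if C: "C \<in> Chains (relation_of (\<le>) A)" for C
  proof (cases "C = {}")
    case True
    then show ?thesis using assms(1) by blast
  next
    case False
    have *: "x \<in> A \<and> y \<in> A \<and> (x \<le> y \<or> y \<le> x)" if "x \<in> C" "y \<in> C" for x y
      using C that unfolding Chains_def relation_of_def by blast
    show ?thesis by (rule ub) (use * False in blast)+
  qed
  ultimately show thesis using predicate_Zorn[of A "(\<le>)"] that by blast
qed

text \<open>Since (t C + X / t)^2 \<ge> 4 C X \<ge> C X. This turns Cauchy-Schwarz into a bound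
  linear in C and X.\<close>

lemma le_of_square_le:
  fixes p C X t :: real
  assumes "p * p \<le> C * X" "0 \<le> C" "0 \<le> X" "0 < t"
  shows "p \<le> t * C + X / t"
proof -
  have "C * X \<le> (t * C + X / t) * (t * C + X / t)"
    using assms by (simp add: field_simps)
  with assms(1) have "p\<^sup>2 \<le> (t * C + X / t)\<^sup>2" by (simp add: power2_eq_square)
  moreover have "0 \<le> t * C + X / t" using assms by simp
  ultimately show ?thesis by (rule power2_le_imp_le)
qed

context unital_f_algebra
begin

text \<open>Two applications of \<open>mult_isLub\<close> reduce to products x * x' from D, and
  directedness bounds these by a single square w * w.\<close>

lemma square_isLub:
  fixes z :: 'u
  assumes dir: "up_directed D" and pos: "\<And>d. d \<in> D \<Longrightarrow> 0 \<le> d" and lub: "isLub UNIV D z"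
  shows "isLub UNIV ((\<lambda>d. d * d) ` D) (z * z)"
proof (rule isLub_UNIV_I)
  fix u assume "u \<in> (\<lambda>d. d * d) ` D"
  then obtain d where "u = d * d" "d \<in> D" by blast
  then show "u \<le> z * z" using square_mono[OF pos isLub_upper[OF lub]] by simp
next
  fix y assume y: "\<And>u. u \<in> (\<lambda>d. d * d) ` D \<Longrightarrow> u \<le> y"
  obtain d0 where "d0 \<in> D" using dir by (auto simp: up_directed_def)
  then have z0: "0 \<le> z" using order_trans[OF pos isLub_upper[OF lub]] by simp
  have 1: "z * x \<le> y" if x: "x \<in> D" for x
  proof -
    have "x * z \<le> y"
    proof (rule isLub_least[OF mult_isLub[OF pos[OF x] lub]])
      fix u assume "u \<in> (\<lambda>d. x * d) ` D"
      then obtain x' where x': "u = x * x'" "x' \<in> D" by blast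
      obtain w where w: "w \<in> D" "x \<le> w" "x' \<le> w" using dir x x' unfolding up_directed_def by meson
      have "u \<le> w * w" unfolding x' using w pos x x' by (intro mult_mono) auto
      also have "\<dots> \<le> y" using y w by blast
      finally show "u \<le> y" .
    qed
    then show ?thesis by (simp add: mult_commute)
  qed
  show "z * z \<le> y"
    by (rule isLub_least[OF mult_isLub[OF z0 lub]]) (use 1 in auto)
qed

text \<open>Lets bounds and integrability pass from squares to the elements themselves.\<close>

lemma le_one_add_square: "x \<le> one + x * x" for x :: 'u
proof (rule le_by_points[of "{x}"])
  fix V \<omega> assume p: "real_point one V \<omega>" and Z: "{x} \<subseteq> V"
  interpret real_point one V \<omega> by fact
  have "0 \<le> (\<omega> x - 1 / 2)\<^sup>2" by simp
  then have "\<omega> x \<le> 1 + \<omega> x * \<omega> x" by (simp add: power2_eq_square algebra_simps)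
  then show "\<omega> x \<le> \<omega> (one + x * x)" using Z by simp
qed simp

end

section \<open>Order boundedness and representation of functionals\<close>

context cond_exp_L2
begin

text \<open>Where the truncated suprema \<open>v k\<close> stay bounded in \<open>k\<close>, the tents with peak at \<open>v = k\<close>
  provide disjoint pieces to which lateral completeness applies; where \<open>v k = k\<close> for all \<open>k\<close>,
  boundedness of \<open>T\<close> on the net leaves no room.\<close>

lemma bdd_above_if_T_bounded:
  assumes D: "up_directed D" "\<And>d. d \<in> D \<Longrightarrow> d \<in> \<L>" "\<And>d. d \<in> D \<Longrightarrow> 0 \<le> d"
    and g: "\<And>d. d \<in> D \<Longrightarrow> \<T> d \<le> g"
  shows "bdd_above D"
proof -
  note add_2_eq_Suc [simp del] add_2_eq_Suc' [simp del]
  obtain d0 where d0: "d0 \<in> D" using D(1) by (auto simp: up_directed_def)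
  define W where "W = (\<lambda>k. (\<lambda>d. trunc d k) ` D)"
  define v where "v = (\<lambda>k. Sup (W k))"
  have Wne: "W k \<noteq> {}" for k using d0 by (auto simp: W_def)
  have Wle: "x \<le> real k *\<^sub>R one" if "x \<in> W k" for x k
    using that trunc_le_n by (auto simp: W_def)
  have Wbdd: "bdd_above (W k)" for k using Wle by (rule bdd_aboveI)
  have v: "isLub UNIV (W k) (v k)" for k
    unfolding v_def using Wne Wbdd by (rule isLub_cSup)
  have v_le: "v k \<le> real k *\<^sub>R one" for k using Wle by (rule isLub_least[OF v])
  have v_ge: "trunc d k \<le> v k" if "d \<in> D" for d k
    by (rule isLub_upper[OF v]) (use that in \<open>auto simp: W_def\<close>)
  have v0: "0 \<le> v k" for k using v_ge[OF d0] trunc_nonneg[OF D(3)[OF d0]] order_trans by blast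
  have v_mono: "v j \<le> v k" if "j \<le> k" for j k
  proof (rule isLub_least[OF v])
    fix x assume "x \<in> W j"
    then obtain d where "x = trunc d j" "d \<in> D" by (auto simp: W_def)
    then show "x \<le> v k" using v_ge[of d k] trunc_mono[OF order_refl that, of d] order_trans by blast
  qed
  \<comment> \<open>With \<open>v_mono\<close> and \<open>v_le\<close> this yields v j = inf (v k) j
    at points (\<open>point_v\<close>), although evaluation need not commute with the suprema
    defining v.\<close>
  have v_split: "v k \<le> v j + pprt (v k - real j *\<^sub>R one)" if "j \<le> k" for j k
  proof (rule isLub_least[OF v])
    fix x assume "x \<in> W k"
    then obtain d where d: "x = trunc d k" "d \<in> D" by (auto simp: W_def)
    have "trunc d k \<le> trunc d j + pprt (trunc d k - real j *\<^sub>R one)"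
    proof (rule le_by_points[of "{d}"])
      fix V \<omega> assume p: "real_point one V \<omega>" and Z: "{d} \<subseteq> V"
      interpret real_point one V \<omega> by fact
      show "\<omega> (trunc d k) \<le> \<omega> (trunc d j + pprt (trunc d k - real j *\<^sub>R one))"
        using Z that by (simp add: trunc_def min_def max_def)
    qed simp
    also have "\<dots> \<le> v j + pprt (v k - real j *\<^sub>R one)"
      using v_ge[OF d(2)] by (intro add_mono pprt_mono diff_right_mono) auto
    finally show "x \<le> v j + pprt (v k - real j *\<^sub>R one)" using d by simp
  qed
  \<comment> \<open>The cut-off k + 2 exceeds the support (k - 1, k + 1), so the tent vanishes
    wherever the cut-off is reached. The factor in h gives h k \<ge> k + 1 wherever the tent is at
    least 1/2.\<close>
  define tent where "tent = (\<lambda>k. pprt (one - \<bar>v (k + 2) - real k *\<^sub>R one\<bar>))"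
  define h where "h = (\<lambda>k. (2 * (real k + 1)) *\<^sub>R tent k)"
  have point_v: "\<omega> (v j) = min (\<omega> (v k)) (real j)"
    if p: "real_point one V \<omega>" and jk: "v j \<in> V" "v k \<in> V" "j \<le> k" for V \<omega> j k
  proof -
    interpret real_point one V \<omega> by fact
    have "\<omega> (v j) \<le> \<omega> (v k)" using pt_mono[OF _ _ v_mono[OF jk(3)]] jk by simp
    moreover have "\<omega> (v j) \<le> real j" using pt_mono[OF _ _ v_le[of j]] jk by simp
    moreover have "\<omega> (v k) \<le> \<omega> (v j) + max (\<omega> (v k) - real j) 0"
      using pt_mono[OF _ _ v_split[OF jk(3)]] jk by simp
    ultimately show ?thesis by (simp add: min_def max_def split: if_splits)
  qed
  have h0: "0 \<le> h k" for k by (simp add: h_def tent_def scaleR_nonneg_nonneg)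
  \<comment> \<open>Tents whose peaks are at least 2 apart do not meet, whereas neighbours overlap;
    hence the split into even and odd k below.\<close>
  have disj: "inf (h j) (h k) = 0" if jk: "j + 2 \<le> k" for j k
  proof (rule antisym)
    show "inf (h j) (h k) \<le> 0"
    proof (rule le_by_points[of "{v (j + 2), v (k + 2)}"])
      fix V \<omega> assume p: "real_point one V \<omega>" and Z: "{v (j + 2), v (k + 2)} \<subseteq> V"
      interpret real_point one V \<omega> by fact
      have [simp]: "v (j + 2) \<in> V" "v (k + 2) \<in> V" using Z by auto
      have eq: "\<omega> (v (j + 2)) = min (\<omega> (v (k + 2))) (real (j + 2))"
        using point_v[OF p, of "j + 2" "k + 2"] jk by simp
      have "\<omega> (tent j) = 0 \<or> \<omega> (tent k) = 0"
        using eq jk by (auto simp: tent_def min_def max_def split: if_splits)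
      then show "\<omega> (inf (h j) (h k)) \<le> \<omega> 0"
        by (auto simp: h_def tent_def simp del: pt_pprt)
    qed simp
  qed (simp add: h0)
  have bdd: "bdd_above (h ` K)" if K: "\<And>j k. j \<in> K \<Longrightarrow> k \<in> K \<Longrightarrow> j < k \<Longrightarrow> j + 2 \<le> k" for K
  proof (rule disjoint_bdd_above)
    show "0 \<le> x" if "x \<in> h ` K" for x using that h0 by auto
    fix x y assume "x \<in> h ` K" "y \<in> h ` K" "x \<noteq> y"
    then obtain j k where jk: "x = h j" "y = h k" "j \<in> K" "k \<in> K" "j \<noteq> k" by blast
    then have "inf x y = 0"
      using disj[of j k] disj[of k j] K[of j k] K[of k j] by (auto simp: inf_commute neq_iff)
    then show "inf \<bar>x\<bar> \<bar>y\<bar> = 0" using jk h0 by simp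
  qed
  have "bdd_above (h ` {k. even k})" "bdd_above (h ` {k. odd k})"
    by (rule bdd; simp; presburger)+
  then obtain b0 b1 where b0: "\<And>k. even k \<Longrightarrow> h k \<le> b0" and b1: "\<And>k. odd k \<Longrightarrow> h k \<le> b1"
    unfolding bdd_above_def by auto
  define b where "b = sup b0 b1"
  have hb: "h k \<le> b" for k using b0[of k] b1[of k] by (cases "even k") (auto simp: b_def intro: le_supI1 le_supI2)
  have Tv: "v k \<in> \<L>" "\<T> (v k) \<le> g" for k
  proof -
    show "v k \<in> \<L>" by (rule bounded_in_L[of _ "real k"]) (simp add: v0 v_le)
    have dir: "up_directed (W k)"
      unfolding W_def by (rule up_directed_image[OF D(1)]) (simp add: trunc_mono)
    have T: "x \<in> \<L>" "0 \<le> x" "\<T> x \<le> g" if "x \<in> W k" for x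
    proof -
      obtain d where d: "x = trunc d k" "d \<in> D" using \<open>x \<in> W k\<close> by (auto simp: W_def)
      show "x \<in> \<L>" "0 \<le> x" using d D(3) by (auto simp: trunc_nonneg)
      then have "\<T> x \<le> \<T> d" using d D(2) trunc_le by (intro T_ext_mono) auto
      then show "\<T> x \<le> g" using g[OF d(2)] by simp
    qed
    show "\<T> (v k) \<le> g"
      by (rule isLub_least[OF T_isLub(2)[OF dir T(1,2) v T(3)]]) (use T in auto)
  qed
  have g0: "0 \<le> g" using T_nonneg[OF D(2,3)[OF d0]] g[OF d0] d0 by simp
  have vb: "v m \<le> b" for m
  proof -
    \<comment> \<open>Supported where v m exceeds b. There every v k has the value k, so k w \<le> v
      k and \<T> w \<le> g / k for all positive k.\<close>
    define w where "w = inf (pprt (v m - b)) one"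
    have w0: "0 \<le> w" by (simp add: w_def)
    have wL: "w \<in> \<L>" by (rule bounded_in_L[of _ 1]) (simp add: w_def)
    have wk: "real k *\<^sub>R w \<le> v k" for k
    proof (rule le_by_points[of "insert b (v ` {..m + k + 2})"])
      fix V \<omega> assume p: "real_point one V \<omega>" and Z: "insert b (v ` {..m + k + 2}) \<subseteq> V"
      interpret real_point one V \<omega> by fact
      have [simp]: "b \<in> V" using Z by simp
      have vV: "v i \<in> V" if "i \<le> m + k + 2" for i using Z that by auto
      have [simp]: "v m \<in> V" "v k \<in> V" by (simp_all add: vV)
      have nn: "0 \<le> \<omega> (v i)" if "i \<le> m + k + 2" for i using pt_mono[OF _ vV[OF that] v0] by simp
      show "\<omega> (real k *\<^sub>R w) \<le> \<omega> (v k)"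
      proof (cases "real k \<le> \<omega> (v k)")
        case True
        have "real k * min (max (\<omega> (v m) - \<omega> b) 0) 1 \<le> real k * 1" by (intro mult_left_mono) auto
        then show ?thesis using True by (simp add: w_def)
      next
        case False
        define s where "s = \<omega> (v k)"
        have s: "0 \<le> s" "s < real k" using False nn[of k] by (auto simp: s_def)
        have vs: "\<omega> (v i) = min s (real i)" if "i \<le> m + k + 2" for i
        proof (cases "i \<le> k")
          case True
          then show ?thesis using point_v[OF p vV[OF that] \<open>v k \<in> V\<close>] by (simp add: s_def)
        next
          case False
          then have ki: "k \<le> i" by simp
          have "s = min (\<omega> (v i)) (real k)"
            using point_v[OF p \<open>v k \<in> V\<close> vV[OF that] ki] by (simp add: s_def)
          moreover have "real k \<le> real i" using ki by simp
          ultimately show ?thesis using s(2) by linarith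
        qed
        \<comment> \<open>The integer nearest to the stable value s: the tent at i is at least 1/2
          there, so s < i + 1 \<le> h i \<le> b, and w vanishes at this point.\<close>
        define i where "i = nat \<lfloor>s + 1/2\<rfloor>"
        have i: "real i \<le> s + 1/2" "s + 1/2 < real i + 1" using s by (auto simp: i_def)
        then have ik: "i \<le> k" "i + 2 \<le> m + k + 2" using s by linarith+
        have vi: "\<omega> (v (i + 2)) = s" using vs[OF ik(2)] i by simp
        have "1/2 \<le> 1 - \<bar>s - real i\<bar>" using i by linarith
        then have "2 * (real i + 1) * (1/2) \<le> 2 * (real i + 1) * (1 - \<bar>s - real i\<bar>)"
          by (intro mult_left_mono) auto
        also have "\<dots> \<le> \<omega> (h i)"
          using vV[OF ik(2)] vi by (simp add: h_def tent_def mult_left_mono)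
        also have "\<dots> \<le> \<omega> b"
          using pt_mono[OF _ _ hb[of i]] vV[OF ik(2)] by (simp add: h_def tent_def)
        finally have "s \<le> \<omega> b" using i by simp
        moreover have "\<omega> (v m) \<le> s" using vs[of m] by simp
        ultimately have "\<omega> w = 0" by (simp add: w_def)
        then show ?thesis using nn[of k] by (simp add: w_def)
      qed
    qed simp
    have "\<T> w \<le> t *\<^sub>R g" if t: "0 < t" for t
    proof -
      obtain k :: nat where k: "1 / t < real k" using reals_Archimedean2 by blast
      then have k0: "0 < real k" using t by (meson less_trans zero_less_divide_1_iff)
      have "real k *\<^sub>R \<T> w \<le> g"
        using T_ext_mono[OF _ Tv(1) wk[of k]] wL Tv(2)[of k] by simp
      then have "\<T> w \<le> g /\<^sub>R real k" using k0 by (simp add: pos_le_divideR_eq)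
      also have "\<dots> \<le> t *\<^sub>R g"
        using k k0 t g0 by (intro scaleR_right_mono) (auto simp: field_simps)
      finally show ?thesis .
    qed
    then have "\<T> w \<le> 0" by (rule riesz_archimedean)
    then have "w = 0" using T_eq_0 wL w0 by blast
    then have "pprt (v m - b) = 0" unfolding w_def by (rule disjoint_one)
    then have "v m - b \<le> 0" by (metis pprt_def sup_ge1)
    then show ?thesis by simp
  qed
  show ?thesis
  proof (rule bdd_aboveI)
    fix d assume d: "d \<in> D"
    show "d \<le> b"
      by (rule isLub_least[OF isLub_trunc]) (use v_ge[OF d] vb order_trans in blast)
  qed
qed

text \<open>\<open>z\<close> is the largest element of \<open>H\<close> with \<open>T (z h) \<le> \<psi> h\<close> for all \<open>h \<ge> 0\<close>. If equality failed at
  \<open>h0\<close>, a Hahn type exhaustion (a maximal \<open>k \<le> h0\<close> with \<open>\<psi>' k \<le> \<epsilon> T k\<close>, \<open>\<psi>'\<close> being the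
  difference) would give \<open>w = h0 - k\<close> below which \<open>\<psi>' \<ge> \<epsilon> T\<close>, so that \<open>z\<close> could be enlarged.\<close>

lemma positive_functional_representation:
  assumes \<psi>_A: "\<And>x. x \<in> \<H> \<Longrightarrow> 0 \<le> x \<Longrightarrow> \<psi> x \<in> \<A>"
    and \<psi>_nonneg: "\<And>x. x \<in> \<H> \<Longrightarrow> 0 \<le> x \<Longrightarrow> 0 \<le> \<psi> x"
    and \<psi>_add: "\<And>x y. x \<in> \<H> \<Longrightarrow> 0 \<le> x \<Longrightarrow> y \<in> \<H> \<Longrightarrow> 0 \<le> y \<Longrightarrow> \<psi> (x + y) = \<psi> x + \<psi> y"
    and \<psi>_mult: "\<And>a x. a \<in> \<A> \<Longrightarrow> 0 \<le> a \<Longrightarrow> a \<le> one \<Longrightarrow> x \<in> \<H> \<Longrightarrow> 0 \<le> x \<Longrightarrow> \<psi> (a * x) = a * \<psi> x"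
    and \<psi>_bound: "\<And>t x. 0 < t \<Longrightarrow> x \<in> \<H> \<Longrightarrow> 0 \<le> x \<Longrightarrow> \<psi> x \<le> t *\<^sub>R c + (1 / t) *\<^sub>R \<T> (x * x)"
  obtains z where "z \<in> \<H>" "\<And>x. x \<in> \<H> \<Longrightarrow> 0 \<le> x \<Longrightarrow> \<T> (z * x) = \<psi> x"
proof -
  define S where "S = {x \<in> \<H>. 0 \<le> x \<and> (\<forall>h\<in>\<H>. 0 \<le> h \<longrightarrow> \<T> (x * h) \<le> \<psi> h)}"
  have S: "x \<in> \<H>" "0 \<le> x" "\<And>h. h \<in> \<H> \<Longrightarrow> 0 \<le> h \<Longrightarrow> \<T> (x * h) \<le> \<psi> h" if "x \<in> S" for x
    using that by (auto simp: S_def)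
  have SI: "x \<in> S" if "x \<in> \<H>" "0 \<le> x" "\<And>h. h \<in> \<H> \<Longrightarrow> 0 \<le> h \<Longrightarrow> \<T> (x * h) \<le> \<psi> h" for x
    using that by (simp add: S_def)
  have "0 \<in> S" using \<psi>_nonneg by (intro SI) auto
  have S_sup: "sup x y \<in> S" if x: "x \<in> S" and y: "y \<in> S" for x y
  proof (rule SI)
    show "sup x y \<in> \<H>" "0 \<le> sup x y" using S[OF x] S[OF y] by (auto intro: le_supI1)
    fix h assume h: "h \<in> \<H>" "0 \<le> h"
    have "\<T> (sup x y * h) - \<psi> h \<le> t *\<^sub>R \<T> h" if t: "0 < t" for t
    proof -
      \<comment> \<open>A continuous substitute for the indicator of x > y. Splitting h into u h and
        (one - u) h tests x on the first piece and y on the second, with error at most t h.\<close>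
      define u where "u = inf ((1 / t) *\<^sub>R pprt (x - y)) one"
      have u: "0 \<le> u" "u \<le> one" using t by (auto simp: u_def scaleR_nonneg_nonneg)
      define h1 where "h1 = u * h"
      have "h1 \<le> h" unfolding h1_def using mult_right_mono[OF u(2) h(2)] by simp
      moreover have h1: "0 \<le> h1" unfolding h1_def using u h by simp
      ultimately have H1: "h1 \<in> \<H>" "0 \<le> h1" "h - h1 \<in> \<H>" "0 \<le> h - h1"
        using H_mono[OF h(1), of h1] h by auto
      have "sup x y * h \<le> x * h1 + y * (h - h1) + t *\<^sub>R h"
      proof (rule le_by_points[of "{x, y, h}"])
        fix V \<omega> assume p: "real_point one V \<omega>" and Z: "{x, y, h} \<subseteq> V"
        interpret real_point one V \<omega> by fact
        have [simp]: "x \<in> V" "y \<in> V" "h \<in> V" using Z by auto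
        define X Y K where "X = \<omega> x" "Y = \<omega> y" "K = \<omega> h"
        define U where "U = min (max (X - Y) 0 / t) 1"
        have K: "0 \<le> K" using pt_mono[OF _ _ h(2)] by (simp add: X_Y_K_def)
        have "max X Y \<le> X * U + Y * (1 - U) + t"
        proof (cases "X \<le> Y")
          case True
          then show ?thesis using t by (simp add: U_def)
        next
          case False
          show ?thesis
          proof (cases "X - Y \<le> t")
            case True
            have "0 \<le> (X - Y) * U" using False t by (simp add: U_def)
            then show ?thesis using True False by (simp add: algebra_simps)
          next
            case f: False
            then have "U = 1" using t by (simp add: U_def)
            then show ?thesis using False t by simp
          qed
        qed
        from mult_right_mono[OF this K]
        show "\<omega> (sup x y * h) \<le> \<omega> (x * h1 + y * (h - h1) + t *\<^sub>R h)"
          by (simp add: h1_def u_def U_def X_Y_K_def algebra_simps)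
      qed simp
      then have "\<T> (sup x y * h) \<le> \<T> (x * h1 + y * (h - h1) + t *\<^sub>R h)"
        using H1 h S[OF x] S[OF y] by (intro T_ext_mono) simp_all
      also have "\<dots> = \<T> (x * h1) + \<T> (y * (h - h1)) + t *\<^sub>R \<T> h"
        using H1 h S(1)[OF x] S(1)[OF y] T_add[of "x * h1 + y * (h - h1)" "t *\<^sub>R h"]
          T_add[of "x * h1" "y * (h - h1)"] L_add[of "x * h1" "y * (h - h1)"] T_scaleR[of h t] L_scaleR[of h t]
        by (simp only: H_mult H_L)
      also have "\<dots> \<le> \<psi> h1 + \<psi> (h - h1) + t *\<^sub>R \<T> h"
        using H1 S(3)[OF x] S(3)[OF y] by (intro add_mono) auto
      also have "\<psi> h1 + \<psi> (h - h1) = \<psi> h" using \<psi>_add[OF H1] by simp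
      finally show ?thesis by (simp add: diff_le_eq add.commute)
    qed
    then have "\<T> (sup x y * h) - \<psi> h \<le> 0" by (rule riesz_archimedean)
    then show "\<T> (sup x y * h) \<le> \<psi> h" by simp
  qed
  have S_dir: "up_directed S" using \<open>0 \<in> S\<close> S_sup by (intro up_directed_sup) auto
  define Q where "Q = (\<lambda>x. x * x) ` S"
  have Q_dir: "up_directed Q"
    unfolding Q_def using S(2) by (intro up_directed_image[OF S_dir] square_mono) auto
  have Q: "q \<in> \<L>" "0 \<le> q" "\<T> q \<le> 4 *\<^sub>R c" if "q \<in> Q" for q
  proof -
    obtain x where x: "q = x * x" "x \<in> S" using \<open>q \<in> Q\<close> Q_def by blast
    show "q \<in> \<L>" "0 \<le> q" unfolding x using S[OF x(2)] by simp_all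
    \<comment> \<open>Testing x on itself. With t = 2 in \<open>\<psi>_bound\<close>, half of \<T> q
      can be absorbed on the left.\<close>
    have "\<T> q \<le> \<psi> x" unfolding x using S[OF x(2)] by blast
    also have "\<dots> \<le> 2 *\<^sub>R c + (1 / 2) *\<^sub>R \<T> q" unfolding x using \<psi>_bound[of 2 x] S[OF x(2)] by simp
    finally have "2 *\<^sub>R \<T> q \<le> 2 *\<^sub>R (2 *\<^sub>R c + (1 / 2) *\<^sub>R \<T> q)" by (intro scaleR_left_mono) auto
    then show "\<T> q \<le> 4 *\<^sub>R c" by (simp add: scaleR_right_distrib scaleR_2[of "\<T> q"])
  qed
  obtain g where g: "\<And>q. q \<in> Q \<Longrightarrow> q \<le> g"
    using bdd_above_if_T_bounded[OF Q_dir Q] by (auto simp: bdd_above_def)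
  have "x \<le> one + g" if "x \<in> S" for x
    using le_one_add_square[of x] g[of "x * x"] that Q_def by (meson add_left_mono image_eqI order_trans)
  then have "bdd_above S" by (rule bdd_aboveI)
  define z where "z = Sup S"
  have z: "isLub UNIV S z" unfolding z_def using \<open>0 \<in> S\<close> \<open>bdd_above S\<close> by (intro isLub_cSup) auto
  have z0: "0 \<le> z" using isLub_upper[OF z \<open>0 \<in> S\<close>] .
  have Qz: "isLub UNIV Q (z * z)" unfolding Q_def by (rule square_isLub[OF S_dir S(2) z])
  have zzL: "z * z \<in> \<L>" by (rule T_isLub(1)[OF Q_dir Q(1,2) Qz Q(3)])
  have "z \<in> \<L>" by (rule L_mono[OF _ z0 le_one_add_square]) (simp add: zzL)
  then have zH: "z \<in> \<H>" using zzL by (simp only: H_iff)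
  have z_le: "\<T> (z * h) \<le> \<psi> h" if h: "h \<in> \<H>" "0 \<le> h" for h
  proof -
    let ?D = "(\<lambda>x. h * x) ` S"
    have dir: "up_directed ?D" using h by (intro up_directed_image[OF S_dir] mult_left_mono)
    have D: "d \<in> \<L>" "0 \<le> d" "\<T> d \<le> \<psi> h" if "d \<in> ?D" for d
    proof -
      obtain x where x: "d = x * h" "x \<in> S" using \<open>d \<in> ?D\<close> by (auto simp: mult_commute[of h])
      show "d \<in> \<L>" "0 \<le> d" "\<T> d \<le> \<psi> h" unfolding x using S[OF x(2)] h by simp_all
    qed
    have "isLub UNIV (\<T> ` ?D) (\<T> (h * z))"
      by (rule T_isLub(2)[OF dir D(1,2) mult_isLub[OF h(2) z] D(3)])
    then have "\<T> (h * z) \<le> \<psi> h" by (rule isLub_least) (use D in blast)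
    then show ?thesis by (simp add: mult_commute)
  qed
  define \<psi>' where "\<psi>' = (\<lambda>h. \<psi> h - \<T> (z * h))"
  have \<psi>'_nonneg: "0 \<le> \<psi>' h" if "h \<in> \<H>" "0 \<le> h" for h using z_le[OF that] by (simp add: \<psi>'_def)
  have \<psi>'_add: "\<psi>' (x + y) = \<psi>' x + \<psi>' y" if "x \<in> \<H>" "0 \<le> x" "y \<in> \<H>" "0 \<le> y" for x y
    using that zH by (simp add: \<psi>'_def \<psi>_add distrib_left)
  have \<psi>'_mono: "\<psi>' x \<le> \<psi>' y" if "x \<in> \<H>" "0 \<le> x" "y \<in> \<H>" "x \<le> y" for x y
    using \<psi>'_add[of x "y - x"] \<psi>'_nonneg[of "y - x"] that by simp
  have \<psi>'_mult: "\<psi>' (a * x) = a * \<psi>' x"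
    if "a \<in> \<A>" "0 \<le> a" "a \<le> one" "x \<in> \<H>" "0 \<le> x" for a x
  proof -
    have "z * (a * x) = a * (z * x)" by (metis mult.assoc mult_commute)
    then show ?thesis using that zH by (simp add: \<psi>'_def \<psi>_mult right_diff_distrib)
  qed
  have \<psi>'_A: "\<psi>' x \<in> \<A>" if "x \<in> \<H>" "0 \<le> x" for x
    using that zH \<psi>_A by (simp add: \<psi>'_def)
  have "\<psi>' h0 = 0" if h0: "h0 \<in> \<H>" "0 \<le> h0" for h0
  proof (rule ccontr)
    assume "\<psi>' h0 \<noteq> 0"
    then have "\<not> \<psi>' h0 \<le> 0" using \<psi>'_nonneg[OF h0] by simp
    then obtain \<epsilon> where \<epsilon>: "0 < \<epsilon>" "\<not> \<psi>' h0 \<le> \<epsilon> *\<^sub>R \<T> h0" using riesz_archimedean by blast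
    define N where "N = {k. 0 \<le> k \<and> k \<le> h0 \<and> \<psi>' k \<le> \<epsilon> *\<^sub>R \<T> k}"
    have N: "k \<in> \<H>" "0 \<le> k" "k \<le> h0" "\<psi>' k \<le> \<epsilon> *\<^sub>R \<T> k" if "k \<in> N" for k
      using that H_mono[OF h0(1), of k] by (auto simp: N_def)
    have "\<psi>' 0 = 0" using \<psi>'_add[of 0 0] by simp
    then have "0 \<in> N" using h0 by (simp add: N_def)
    \<comment> \<open>The supremum of a chain must stay in N although \<psi>' is not known to be
      order continuous; \<open>\<psi>_bound\<close> and monotone convergence for squares take the
      place of continuity.\<close>
    have chain: "\<exists>u\<in>N. \<forall>a\<in>C. a \<le> u"
      if C: "C \<subseteq> N" "C \<noteq> {}" "\<And>x y. x \<in> C \<Longrightarrow> y \<in> C \<Longrightarrow> x \<le> y \<or> y \<le> x" for C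
    proof -
      have CN: "k \<in> \<H>" "0 \<le> k" "k \<le> h0" "\<psi>' k \<le> \<epsilon> *\<^sub>R \<T> k" if "k \<in> C" for k
        using N C(1) that by blast+
      have dir: "up_directed C" unfolding up_directed_def using C(2,3) by (metis order_refl)
      define s where "s = Sup C"
      have s: "isLub UNIV C s"
        unfolding s_def by (rule isLub_cSup[OF C(2) bdd_aboveI[OF CN(3)]])
      have s_le: "k \<le> s" if "k \<in> C" for k using isLub_upper[OF s that] .
      obtain k0 where k0: "k0 \<in> C" using C(2) by blast
      have s0: "0 \<le> s" using CN(2)[OF k0] s_le[OF k0] by (rule order_trans)
      have sh: "s \<le> h0" using CN(3) by (rule isLub_least[OF s])
      have sH: "s \<in> \<H>" by (rule H_mono[OF h0(1) s0 sh])
      have "\<psi>' s - \<epsilon> *\<^sub>R \<T> s \<le> t *\<^sub>R c" if t: "0 < t" for t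
      proof -
        \<comment> \<open>The goal is ?r \<ge> 0. Applying the bound to s - k and using (s - k)^2
          \<le> s^2 - k^2 gives \<T> (k^2) \<le> t ?r + \<T> (s^2); in the supremum over k the two
          squares cancel.\<close>
        let ?r = "t *\<^sub>R c + \<epsilon> *\<^sub>R \<T> s - \<psi>' s"
        have kk: "\<T> (k * k) \<le> t *\<^sub>R ?r + \<T> (s * s)" if k: "k \<in> C" for k
        proof -
          let ?d = "s - k"
          have d: "?d \<in> \<H>" "0 \<le> ?d" using sH CN(1)[OF k] s_le[OF k] by simp_all
          have "?d * ?d \<le> s * s - k * k"
          proof (rule le_by_points[of "{s, k}"])
            fix V \<omega> assume p: "real_point one V \<omega>" and Z: "{s, k} \<subseteq> V"
            interpret real_point one V \<omega> by fact
            have [simp]: "s \<in> V" "k \<in> V" using Z by auto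
            have "0 \<le> \<omega> k" "0 \<le> \<omega> s - \<omega> k" 
              using pt_mono[OF _ _ CN(2)[OF k]] pt_mono[OF _ _ s_le[OF k]] by simp_all
            then have "0 \<le> 2 * \<omega> k * (\<omega> s - \<omega> k)" by simp
            then show "\<omega> (?d * ?d) \<le> \<omega> (s * s - k * k)" by (simp add: algebra_simps)
          qed simp
          then have sq: "\<T> (?d * ?d) \<le> \<T> (s * s - k * k)"
            using d sH CN(1)[OF k] by (intro T_ext_mono) (simp_all only: H_mult L_diff)
          have "\<psi>' s = \<psi>' k + \<psi>' ?d" using \<psi>'_add[OF CN(1,2)[OF k] d] by simp
          also have "\<psi>' k \<le> \<epsilon> *\<^sub>R \<T> k" using CN(4)[OF k] .
          also have "\<epsilon> *\<^sub>R \<T> k \<le> \<epsilon> *\<^sub>R \<T> s"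
            using \<epsilon> sH CN(1)[OF k] s_le[OF k] by (intro scaleR_left_mono T_ext_mono) simp_all
          also have "\<psi>' ?d \<le> \<psi> ?d" using T_nonneg[of "z * ?d"] zH z0 d by (simp add: \<psi>'_def)
          also have "\<psi> ?d \<le> t *\<^sub>R c + (1 / t) *\<^sub>R \<T> (?d * ?d)" using \<psi>_bound[OF t d] .
          also have "\<T> (?d * ?d) \<le> \<T> (s * s) - \<T> (k * k)" using sq sH CN(1)[OF k] by simp
          finally have "\<psi>' s \<le> \<epsilon> *\<^sub>R \<T> s + (t *\<^sub>R c + (1 / t) *\<^sub>R (\<T> (s * s) - \<T> (k * k)))"
            using t by (simp add: scaleR_left_mono)
          then have "(1 / t) *\<^sub>R (\<T> (k * k) - \<T> (s * s)) \<le> ?r" by (simp add: algebra_simps)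
          then have "t *\<^sub>R (1 / t) *\<^sub>R (\<T> (k * k) - \<T> (s * s)) \<le> t *\<^sub>R ?r"
            using t by (intro scaleR_left_mono) auto
          then show ?thesis using t by (simp add: diff_le_eq)
        qed
        let ?Q = "(\<lambda>k. k * k) ` C"
        have Qdir: "up_directed ?Q" using CN(2) by (intro up_directed_image[OF dir] square_mono)
        have QC: "q \<in> \<L>" "0 \<le> q" "\<T> q \<le> t *\<^sub>R ?r + \<T> (s * s)" if "q \<in> ?Q" for q
          using that CN kk by auto
        have "\<T> (s * s) \<le> t *\<^sub>R ?r + \<T> (s * s)"
          by (rule isLub_least[OF T_isLub(2)[OF Qdir QC(1,2) square_isLub[OF dir CN(2) s] QC(3)]])
            (use kk in auto)
        then have "0 \<le> t *\<^sub>R ?r" by simp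
        then have "(1 / t) *\<^sub>R 0 \<le> (1 / t) *\<^sub>R t *\<^sub>R ?r" using t by (intro scaleR_left_mono) auto
        then show ?thesis using t by (simp add: algebra_simps)
      qed
      then have "\<psi>' s - \<epsilon> *\<^sub>R \<T> s \<le> 0" by (rule riesz_archimedean)
      then have "s \<in> N" using s0 sh by (simp add: N_def)
      then show ?thesis using s_le by blast
    qed
    obtain k where k: "k \<in> N" and max: "\<And>a. a \<in> N \<Longrightarrow> k \<le> a \<Longrightarrow> a = k"
      using chain_bounded_maximal[of N] \<open>0 \<in> N\<close> chain by blast
    define w where "w = h0 - k"
    have w: "w \<in> \<H>" "0 \<le> w" using h0 N[OF k] by (simp_all add: w_def)
    have "w \<noteq> 0" using N(4)[OF k] \<epsilon>(2) by (auto simp: w_def)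
    have lower: "\<epsilon> *\<^sub>R \<T> u \<le> \<psi>' u" if u: "0 \<le> u" "u \<le> w" for u
    proof -
      have uH: "u \<in> \<H>" by (rule H_mono[OF w(1) u])
      define \<theta> where "\<theta> = \<psi>' u - \<epsilon> *\<^sub>R \<T> u"
      \<comment> \<open>Localises in A to where \<theta> < 0; homogeneity over A carries a through
        \<psi>' and \<T>. Then k + a u stays in N, so maximality of k forces a u = 0, hence a
        \<theta> = 0 and \<theta> \<ge> 0.\<close>
      define a where "a = inf (pprt (- \<theta>)) one"
      have "\<theta> \<in> \<A>" using \<psi>'_A[OF uH u(1)] uH by (simp add: \<theta>_def)
      then have a: "a \<in> \<A>" "0 \<le> a" "a \<le> one" by (simp_all add: a_def)
      have au: "0 \<le> a * u" "a * u \<le> u" "a * u \<in> \<H>"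
        using mult_right_mono[OF a(3) u(1)] a u uH by simp_all
      have eq: "\<psi>' (a * u) - \<epsilon> *\<^sub>R \<T> (a * u) = a * \<theta>"
        using \<psi>'_mult[OF a uH u(1)] a uH by (simp add: \<theta>_def right_diff_distrib)
      have "a * \<theta> \<le> 0"
      proof (rule le_by_points[of "{\<theta>}"])
        fix V \<omega> assume p: "real_point one V \<omega>" and Z: "{\<theta>} \<subseteq> V"
        interpret real_point one V \<omega> by fact
        show "\<omega> (a * \<theta>) \<le> \<omega> 0" using Z by (simp add: a_def mult_le_0_iff min_def max_def)
      qed simp
      then have "\<psi>' (a * u) \<le> \<epsilon> *\<^sub>R \<T> (a * u)" unfolding eq[symmetric] by (simp only: diff_le_0_iff_le)
      then have "\<psi>' (k + a * u) \<le> \<epsilon> *\<^sub>R \<T> (k + a * u)"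
        using \<psi>'_add[OF N(1,2)[OF k] au(3,1)] N[OF k] au by (simp add: scaleR_right_distrib add_mono)
      moreover have "k + a * u \<le> h0"
        using add_left_mono[OF order_trans[OF au(2) u(2)], of k] by (simp add: w_def)
      ultimately have "k + a * u \<in> N" using N(2)[OF k] au by (simp add: N_def)
      from max[OF this] have "a * u = 0" using au by simp
      then have 0: "a * \<theta> = 0" using eq \<open>\<psi>' 0 = 0\<close> by simp
      have "0 \<le> \<theta>"
      proof (rule le_by_points[of "{\<theta>}"])
        fix V \<omega> assume p: "real_point one V \<omega>" and Z: "{\<theta>} \<subseteq> V"
        interpret real_point one V \<omega> by fact
        have [simp]: "\<theta> \<in> V" using Z by auto
        have "\<omega> (a * \<theta>) = 0" using 0 by simp
        then show "\<omega> 0 \<le> \<omega> \<theta>" by (auto simp: a_def min_def max_def split: if_splits)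
      qed simp
      then show ?thesis by (simp add: \<theta>_def)
    qed
    \<comment> \<open>Truncating at \<open>one\<close> gives w' h \<le> h, which is needed where h
      lies below w / r; where h exceeds w / r, the bound w' h \<le> r h^2 holds instead.\<close>
    define w' where "w' = inf w one"
    have w': "0 \<le> w'" "w' \<in> \<H>" using w by (simp_all add: w'_def)
    have "z + \<epsilon> *\<^sub>R w' \<in> S"
    proof (rule SI)
      show "z + \<epsilon> *\<^sub>R w' \<in> \<H>" "0 \<le> z + \<epsilon> *\<^sub>R w'" using zH z0 w' \<epsilon> by (simp_all add: scaleR_nonneg_nonneg)
      fix h assume h: "h \<in> \<H>" "0 \<le> h"
      have "\<epsilon> *\<^sub>R \<T> (w' * h) - \<psi>' h \<le> t *\<^sub>R (\<epsilon> *\<^sub>R \<T> (h * h))" if t: "0 < t" for t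
      proof -
        \<comment> \<open>r \<le> 1 makes \<open>\<psi>'_mult\<close> applicable to r one, and r
          \<le> t keeps the error term within t.\<close>
        define r where "r = min t 1"
        have r: "0 < r" "r \<le> 1" "r \<le> t" using t by (auto simp: r_def)
        let ?m = "inf h ((1 / r) *\<^sub>R w)"
        have m: "0 \<le> ?m" "?m \<in> \<H>" using h w r by (simp_all add: scaleR_nonneg_nonneg)
        have "r *\<^sub>R ?m \<le> r *\<^sub>R (1 / r) *\<^sub>R w" using r by (intro scaleR_left_mono) auto
        then have rm: "0 \<le> r *\<^sub>R ?m" "r *\<^sub>R ?m \<le> w" using r m by (simp_all add: scaleR_nonneg_nonneg)
        have "r *\<^sub>R one \<le> 1 *\<^sub>R one" using r by (intro scaleR_right_mono) auto
        then have "\<psi>' (r *\<^sub>R ?m) = r *\<^sub>R \<psi>' ?m"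
          using \<psi>'_mult[of "r *\<^sub>R one" ?m] m r by (simp add: scaleR_nonneg_nonneg)
        then have "r *\<^sub>R (\<epsilon> *\<^sub>R \<T> ?m) \<le> r *\<^sub>R \<psi>' ?m"
          using lower[OF rm] T_scaleR[OF H_L[OF m(2)], of r] by (simp add: mult.commute)
        then have "\<epsilon> *\<^sub>R \<T> ?m \<le> \<psi>' ?m" by (simp only: scaleR_le_cancel_left_pos[OF r(1)])
        also have "\<dots> \<le> \<psi>' h" using m h by (intro \<psi>'_mono) simp_all
        finally have 1: "\<epsilon> *\<^sub>R \<T> ?m \<le> \<psi>' h" .
        have "w' * h \<le> ?m + r *\<^sub>R (h * h)"
        proof (rule le_by_points[of "{w, h}"])
          fix V \<omega> assume p: "real_point one V \<omega>" and Z: "{w, h} \<subseteq> V"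
          interpret real_point one V \<omega> by fact
          have [simp]: "w \<in> V" "h \<in> V" using Z by auto
          define X K where "X = \<omega> w" "K = \<omega> h"
          have XK: "0 \<le> X" "0 \<le> K" using pt_mono[OF _ _ w(2)] pt_mono[OF _ _ h(2)] by (simp_all add: X_K_def)
          have "min X 1 * K \<le> min K (X / r) + r * (K * K)"
          proof (cases "K \<le> X / r")
            case True
            have "min X 1 * K \<le> 1 * K" using XK by (intro mult_right_mono) auto
            moreover have "0 \<le> r * (K * K)" using r by simp
            ultimately show ?thesis using True by simp
          next
            case False
            then have "X \<le> r * K" using r by (simp add: field_simps)
            then have "min X 1 * K \<le> (r * K) * K" using XK by (intro mult_right_mono) auto
            moreover have "0 \<le> min K (X / r)" using XK r by simp
            ultimately show ?thesis unfolding mult.assoc by (intro add_increasing)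
          qed
          then show "\<omega> (w' * h) \<le> \<omega> (?m + r *\<^sub>R (h * h))"
            by (simp add: w'_def X_K_def)
        qed simp
        then have "\<T> (w' * h) \<le> \<T> (?m + r *\<^sub>R (h * h))"
          using w' h m by (intro T_ext_mono) simp_all
        also have "\<dots> = \<T> ?m + r *\<^sub>R \<T> (h * h)" using m h by simp
        also have "\<dots> \<le> \<T> ?m + t *\<^sub>R \<T> (h * h)"
          using r T_square_nonneg[OF h(1)] by (intro add_left_mono scaleR_right_mono)
        finally have "\<epsilon> *\<^sub>R \<T> (w' * h) \<le> \<epsilon> *\<^sub>R (\<T> ?m + t *\<^sub>R \<T> (h * h))"
          using \<epsilon> by (intro scaleR_left_mono) auto
        also have "\<dots> \<le> \<psi>' h + t *\<^sub>R (\<epsilon> *\<^sub>R \<T> (h * h))"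
          using 1 by (simp add: scaleR_right_distrib mult.commute)
        finally show ?thesis by (simp add: diff_le_eq add.commute)
      qed
      then have "\<epsilon> *\<^sub>R \<T> (w' * h) - \<psi>' h \<le> 0" by (rule riesz_archimedean)
      then have "\<epsilon> *\<^sub>R \<T> (w' * h) \<le> \<psi>' h" by simp
      then show "\<T> ((z + \<epsilon> *\<^sub>R w') * h) \<le> \<psi> h"
        using zH w' h by (simp add: \<psi>'_def distrib_right le_diff_eq add.commute)
    qed
    then have "z + \<epsilon> *\<^sub>R w' \<le> z" by (rule isLub_upper[OF z])
    then have "(1 / \<epsilon>) *\<^sub>R \<epsilon> *\<^sub>R w' \<le> (1 / \<epsilon>) *\<^sub>R 0" using \<epsilon> by (intro scaleR_left_mono) auto
    then have "w' = 0" using \<epsilon> w' by simp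
    then have "w = 0" unfolding w'_def by (rule disjoint_one)
    with \<open>w \<noteq> 0\<close> show False by simp
  qed
  then have "\<T> (z * x) = \<psi> x" if "x \<in> \<H>" "0 \<le> x" for x using that by (simp add: \<psi>'_def)
  with zH show thesis using that by blast
qed

text \<open>The positive part of the functional is the Riesz-Kantorovich supremum.\<close>

lemma functional_representation:
  assumes \<phi>_A: "\<And>x. x \<in> \<H> \<Longrightarrow> \<phi> x \<in> \<A>"
    and \<phi>_add: "\<And>x y. x \<in> \<H> \<Longrightarrow> y \<in> \<H> \<Longrightarrow> \<phi> (x + y) = \<phi> x + \<phi> y"
    and \<phi>_mult: "\<And>a x. a \<in> \<A> \<Longrightarrow> x \<in> \<H> \<Longrightarrow> \<phi> (a * x) = a * \<phi> x"
    and c: "c \<in> \<A>"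
    and \<phi>_bound: "\<And>t x. 0 < t \<Longrightarrow> x \<in> \<H> \<Longrightarrow> \<phi> x \<le> t *\<^sub>R c + (1 / t) *\<^sub>R \<T> (x * x)"
  obtains z where "z \<in> \<H>" "\<And>x. x \<in> \<H> \<Longrightarrow> \<T> (z * x) = \<phi> x"
proof -
  have \<phi>_0: "\<phi> 0 = 0" using \<phi>_add[of 0 0] by simp
  have \<phi>_diff: "\<phi> (x - y) = \<phi> x - \<phi> y" if "x \<in> \<H>" "y \<in> \<H>" for x y
    using \<phi>_add[of "x - y" y] that by simp
  define P where "P = (\<lambda>x. Sup (\<phi> ` {0..x}))"
  have I: "g \<in> \<H>" "0 \<le> g" "g \<le> x" if "g \<in> {0..x}" "x \<in> \<H>" for g x
    using that H_mono[of x g] by auto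
  have bd: "u \<le> t *\<^sub>R c + (1 / t) *\<^sub>R \<T> (x * x)"
    if u: "u \<in> \<phi> ` {0..x}" and x: "x \<in> \<H>" and t: "0 < t" for u x t
  proof -
    obtain g where "u = \<phi> g" "g \<in> {0..x}" using u by blast
    note g = this(1) I[OF this(2) x]
    have "u \<le> t *\<^sub>R c + (1 / t) *\<^sub>R \<T> (g * g)" unfolding g(1) using \<phi>_bound[OF t g(2)] .
    also have "\<T> (g * g) \<le> \<T> (x * x)" using g x by (intro T_ext_mono square_mono) simp_all
    finally show ?thesis using t by (simp add: scaleR_left_mono)
  qed
  have lub: "isLub UNIV (\<phi> ` {0..x}) (P x)" if "x \<in> \<H>" "0 \<le> x" for x
    unfolding P_def using that bdd_aboveI[OF bd[OF _ that(1) zero_less_one]] by (intro isLub_cSup) auto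
  have upper: "\<phi> g \<le> P x" if "0 \<le> g" "g \<le> x" "x \<in> \<H>" for g x
    using isLub_upper[OF lub[of x], of "\<phi> g"] order_trans[OF that(1,2)] that by auto
  have least: "P x \<le> y" if x: "x \<in> \<H>" "0 \<le> x" and y: "\<And>g. g \<in> \<H> \<Longrightarrow> 0 \<le> g \<Longrightarrow> g \<le> x \<Longrightarrow> \<phi> g \<le> y" for x y
  proof (rule isLub_least[OF lub[OF x]])
    fix u assume "u \<in> \<phi> ` {0..x}"
    then obtain g where g: "u = \<phi> g" "g \<in> {0..x}" by blast
    show "u \<le> y" unfolding g(1) by (rule y[OF I[OF g(2) x(1)]])
  qed
  have P_nonneg: "0 \<le> P x" if "x \<in> \<H>" "0 \<le> x" for x using upper[of 0 x] that \<phi>_0 by simp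
  have P_bound: "P x \<le> t *\<^sub>R c + (1 / t) *\<^sub>R \<T> (x * x)" if "0 < t" "x \<in> \<H>" "0 \<le> x" for t x
    using bd[OF _ that(2,1)] by (rule isLub_least[OF lub[OF that(2,3)]])
  have P_A: "P x \<in> \<A>" if x: "x \<in> \<H>" "0 \<le> x" for x
  proof -
    have PL: "P x \<in> \<L>"
      by (rule L_mono[OF _ P_nonneg[OF x] P_bound[OF zero_less_one x]]) (use x c in simp)
    have "P x \<le> \<T> (P x)"
    proof (rule least[OF x])
      fix g assume g: "g \<in> \<H>" "0 \<le> g" "g \<le> x"
      have "\<T> (\<phi> g) \<le> \<T> (P x)" using upper[OF g(2,3) x(1)] \<phi>_A[OF g(1)] PL by (intro T_ext_mono) simp_all
      then show "\<phi> g \<le> \<T> (P x)" using \<phi>_A[OF g(1)] by simp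
    qed
    with PL show ?thesis by (rule A_if_le_T)
  qed
  have P_add: "P (x + y) = P x + P y" if x: "x \<in> \<H>" "0 \<le> x" and y: "y \<in> \<H>" "0 \<le> y" for x y
  proof (rule antisym)
    show "P (x + y) \<le> P x + P y"
    proof (rule least)
      fix g assume g: "g \<in> \<H>" "0 \<le> g" "g \<le> x + y"
      \<comment> \<open>Riesz decomposition of g into a part below x and a part below y.\<close>
      define m where "m = inf g x"
      have m: "m \<in> \<H>" "0 \<le> m" "m \<le> x" "m \<le> g" using g x by (simp_all add: m_def)
      have "g - m = pprt (g - x)" unfolding m_def inf_eq_pprt by simp
      moreover have "g - x \<le> y" using g(3) by (simp add: diff_le_eq add.commute)
      ultimately have 2: "g - m \<le> y" using y(2) by (simp add: pprt_def)
      have "\<phi> g = \<phi> m + \<phi> (g - m)" using \<phi>_diff[OF g(1) m(1)] by simp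
      also have "\<dots> \<le> P x + P y"
        using m x y 2 by (intro add_mono upper) auto
      finally show "\<phi> g \<le> P x + P y" .
    qed (use x y in simp_all)
    have "P x \<le> P (x + y) - P y"
    proof (rule least[OF x])
      fix g assume g: "g \<in> \<H>" "0 \<le> g" "g \<le> x"
      have "P y \<le> P (x + y) - \<phi> g"
      proof (rule least[OF y])
        fix g' assume g': "g' \<in> \<H>" "0 \<le> g'" "g' \<le> y"
        have "\<phi> (g + g') \<le> P (x + y)" using g g' x y by (intro upper add_mono) auto
        then show "\<phi> g' \<le> P (x + y) - \<phi> g" using \<phi>_add[OF g(1) g'(1)] by (simp add: le_diff_eq add.commute)
      qed
      then show "\<phi> g \<le> P (x + y) - P y" by (simp add: le_diff_eq add.commute)
    qed
    then show "P x + P y \<le> P (x + y)" by (simp add: le_diff_eq)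
  qed
  have P_mult_ge: "a * P x \<le> P (a * x)" if a: "a \<in> \<A>" "0 \<le> a" and x: "x \<in> \<H>" "0 \<le> x" for a x
  proof (rule isLub_least[OF mult_isLub[OF a(2) lub[OF x]]])
    fix u assume "u \<in> (\<lambda>d. a * d) ` \<phi> ` {0..x}"
    then obtain g where g: "u = a * \<phi> g" "g \<in> {0..x}" by blast
    have "\<phi> (a * g) \<le> P (a * x)"
      using g(2) a x by (intro upper mult_left_mono mult_nonneg_nonneg) simp_all
    then show "u \<le> P (a * x)" using g \<phi>_mult[OF a(1) I(1)[OF g(2) x(1)]] by simp
  qed
  have P_mult: "P (a * x) = a * P x"
    if a: "a \<in> \<A>" "0 \<le> a" "a \<le> one" and x: "x \<in> \<H>" "0 \<le> x" for a x
  proof (rule antisym)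
    \<comment> \<open>The missing inequality comes from applying \<open>P_mult_ge\<close> to the
      complement one - a, which is positive because a \<le> one; no division by a occurs.\<close>
    have "P x = P (a * x) + P ((one - a) * x)"
    proof -
      have "P (a * x + (one - a) * x) = P (a * x) + P ((one - a) * x)"
        by (rule P_add) (use a x in simp_all)
      then show ?thesis by (simp add: left_diff_distrib)
    qed
    moreover have "(one - a) * P x \<le> P ((one - a) * x)" using a x by (intro P_mult_ge) simp_all
    ultimately show "P (a * x) \<le> a * P x" by (simp add: left_diff_distrib)
  qed (use P_mult_ge a x in blast)
  obtain z1 where z1: "z1 \<in> \<H>" "\<And>x. x \<in> \<H> \<Longrightarrow> 0 \<le> x \<Longrightarrow> \<T> (z1 * x) = P x"
    using positive_functional_representation[of P c, OF P_A P_nonneg P_add P_mult P_bound] by blast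
  define N where "N = (\<lambda>x. P x - \<phi> x)"
  have N_bound: "N x \<le> t *\<^sub>R (4 *\<^sub>R c) + (1 / t) *\<^sub>R \<T> (x * x)" if t: "0 < t" and x: "x \<in> \<H>" "0 \<le> x" for t x
  proof -
    \<comment> \<open>The parameter 2 t in both bounds makes the two quadratic terms add up to \<T>
      (x^2) / t, at the price of the constant 4 c.\<close>
    have "- \<phi> x \<le> (2 * t) *\<^sub>R c + (1 / (2 * t)) *\<^sub>R \<T> (x * x)"
      using \<phi>_bound[of "2 * t" "- x"] \<phi>_diff[of 0 x] t x \<phi>_0 by simp
    then have "P x + - \<phi> x \<le> ((2 * t) *\<^sub>R c + (1 / (2 * t)) *\<^sub>R \<T> (x * x)) + ((2 * t) *\<^sub>R c + (1 / (2 * t)) *\<^sub>R \<T> (x * x))"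
      using t x by (intro add_mono P_bound) auto
    also have "\<dots> = 2 *\<^sub>R ((2 * t) *\<^sub>R c + (1 / (2 * t)) *\<^sub>R \<T> (x * x))"
      by (simp only: scaleR_2)
    also have "\<dots> = t *\<^sub>R (4 *\<^sub>R c) + (1 / t) *\<^sub>R \<T> (x * x)"
      using t by (simp add: scaleR_right_distrib mult.commute)
    finally show ?thesis by (simp add: N_def)
  qed
  have N_A: "N x \<in> \<A>" if "x \<in> \<H>" "0 \<le> x" for x using P_A \<phi>_A that by (simp add: N_def)
  have N_nonneg: "0 \<le> N x" if "x \<in> \<H>" "0 \<le> x" for x using upper[of x x] that by (simp add: N_def)
  have N_add: "N (x + y) = N x + N y" if "x \<in> \<H>" "0 \<le> x" "y \<in> \<H>" "0 \<le> y" for x y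
    using P_add \<phi>_add that by (simp add: N_def)
  have N_mult: "N (a * x) = a * N x" if "a \<in> \<A>" "0 \<le> a" "a \<le> one" "x \<in> \<H>" "0 \<le> x" for a x
    using P_mult \<phi>_mult that by (simp add: N_def right_diff_distrib)
  obtain z2 where z2: "z2 \<in> \<H>" "\<And>x. x \<in> \<H> \<Longrightarrow> 0 \<le> x \<Longrightarrow> \<T> (z2 * x) = N x"
    using positive_functional_representation[of N "4 *\<^sub>R c", OF N_A N_nonneg N_add N_mult N_bound] by blast
  have pos: "\<T> ((z1 - z2) * x) = \<phi> x" if "x \<in> \<H>" "0 \<le> x" for x
    using z1 z2 that by (simp add: left_diff_distrib N_def)
  have "\<T> ((z1 - z2) * x) = \<phi> x" if x: "x \<in> \<H>" for x
  proof -
    let ?p = "pprt x" and ?n = "pprt (- x)"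
    have pn: "?p \<in> \<H>" "?n \<in> \<H>" using x by simp_all
    have "\<T> ((z1 - z2) * (?p - ?n)) = \<T> ((z1 - z2) * ?p) - \<T> ((z1 - z2) * ?n)"
      unfolding right_diff_distrib[of "z1 - z2" ?p ?n] by (intro T_diff H_mult H_diff z1 z2 pn)
    also have "\<dots> = \<phi> ?p - \<phi> ?n" using pn by (simp only: pos zero_le_pprt)
    also have "\<dots> = \<phi> (?p - ?n)" by (rule \<phi>_diff[OF pn, symmetric])
    finally show ?thesis by (simp only: pprt_diff_pprt_uminus)
  qed
  with z1(1) z2(1) show thesis using that[of "z1 - z2"] by simp
qed

section \<open>Uniqueness and existence of adjoints\<close>

lemma T_bounded_ops_iff:
  "S \<in> T_bounded_ops \<iota> T \<longleftrightarrow> S \<in> \<H> \<rightarrow>\<^sub>E \<H> \<and>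
     (\<forall>x\<in>\<H>. \<forall>y\<in>\<H>. S (x + y) = S x + S y) \<and> (\<forall>a\<in>\<A>. \<forall>x\<in>\<H>. S (a * x) = a * S x) \<and>
     (\<exists>k\<in>\<A>. 0 \<le> k \<and> (\<forall>x\<in>\<H>. \<T> (S x * S x) \<le> k * k * \<T> (x * x)))"
proof -
  have "T_norm \<iota> T (S x) \<le> k * T_norm \<iota> T x \<longleftrightarrow> \<T> (S x * S x) \<le> k * k * \<T> (x * x)"
    if "S \<in> \<H> \<rightarrow>\<^sub>E \<H>" "0 \<le> k" "x \<in> \<H>" for k x
    using that by (intro T_norm_le_iff) auto
  then show ?thesis unfolding T_bounded_ops_def by auto
qed

lemma T_bounded_opsI:
  assumes "\<And>x. x \<in> \<H> \<Longrightarrow> S x \<in> \<H>" "\<And>x. x \<notin> \<H> \<Longrightarrow> S x = undefined"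
    and "\<And>x y. x \<in> \<H> \<Longrightarrow> y \<in> \<H> \<Longrightarrow> S (x + y) = S x + S y"
    and "\<And>a x. a \<in> \<A> \<Longrightarrow> x \<in> \<H> \<Longrightarrow> S (a * x) = a * S x"
    and "k \<in> \<A>" "0 \<le> k" "\<And>x. x \<in> \<H> \<Longrightarrow> \<T> (S x * S x) \<le> k * k * \<T> (x * x)"
  shows "S \<in> T_bounded_ops \<iota> T"
  unfolding T_bounded_ops_iff using assms by (auto simp: PiE_iff extensional_def)

lemma op_mem: "S \<in> T_bounded_ops \<iota> T \<Longrightarrow> x \<in> \<H> \<Longrightarrow> S x \<in> \<H>"
  and op_undefined: "S \<in> T_bounded_ops \<iota> T \<Longrightarrow> x \<notin> \<H> \<Longrightarrow> S x = undefined"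
  and op_plus: "S \<in> T_bounded_ops \<iota> T \<Longrightarrow> x \<in> \<H> \<Longrightarrow> y \<in> \<H> \<Longrightarrow> S (x + y) = S x + S y"
  and op_mult: "S \<in> T_bounded_ops \<iota> T \<Longrightarrow> a \<in> \<A> \<Longrightarrow> x \<in> \<H> \<Longrightarrow> S (a * x) = a * S x"
  unfolding T_bounded_ops_iff by (auto simp: PiE_iff extensional_def)

lemma op_bound:
  assumes "S \<in> T_bounded_ops \<iota> T"
  obtains k where "k \<in> \<A>" "0 \<le> k" "\<And>x. x \<in> \<H> \<Longrightarrow> \<T> (S x * S x) \<le> k * k * \<T> (x * x)"
  using assms unfolding T_bounded_ops_iff by blast

text \<open>Nondegeneracy of the form: test on x = u - v.\<close>

lemma H_eqI:
  assumes u: "u \<in> \<H>" and v: "v \<in> \<H>" and eq: "\<And>x. x \<in> \<H> \<Longrightarrow> \<T> (x * u) = \<T> (x * v)"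
  shows "u = v"
proof -
  have "\<T> ((u - v) * (u - v)) = \<T> ((u - v) * u) - \<T> ((u - v) * v)"
    unfolding right_diff_distrib[of "u - v" u v] by (intro T_diff H_mult H_diff u v)
  also have "\<dots> = 0" using eq[of "u - v"] u v by simp
  finally have "u - v = 0" by (intro H_definite) (use u v in simp_all)
  then show ?thesis by simp
qed

text \<open>The relation behind the \<open>THE\<close> of \<open>op_adjoint\<close>. Identities can
  be proved for it without first evaluating that description.\<close>

definition is_adjoint :: "('u \<Rightarrow> 'u) \<Rightarrow> ('u \<Rightarrow> 'u) \<Rightarrow> bool" where
  "is_adjoint S S' \<longleftrightarrow> S' \<in> T_bounded_ops \<iota> T \<and> (\<forall>x\<in>\<H>. \<forall>y\<in>\<H>. \<T> (S x * y) = \<T> (x * S' y))"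

lemma is_adjointD:
  assumes "is_adjoint S S'"
  shows "S' \<in> T_bounded_ops \<iota> T" "\<And>x y. x \<in> \<H> \<Longrightarrow> y \<in> \<H> \<Longrightarrow> \<T> (S x * y) = \<T> (x * S' y)"
  using assms by (auto simp: is_adjoint_def)

lemma is_adjoint_unique:
  assumes S': "is_adjoint S S'" and S'': "is_adjoint S S''"
  shows "S' = S''"
proof
  fix y
  show "S' y = S'' y"
  proof (cases "y \<in> \<H>")
    case True
    show ?thesis
    proof (rule H_eqI)
      show "S' y \<in> \<H>" "S'' y \<in> \<H>"
        using op_mem is_adjointD(1)[OF S'] is_adjointD(1)[OF S''] True by blast+
      fix x assume "x \<in> \<H>"
      then show "\<T> (x * S' y) = \<T> (x * S'' y)"
        using is_adjointD(2)[OF S'] is_adjointD(2)[OF S''] True by metis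
    qed
  next
    \<comment> \<open>Off H both operators are \<open>undefined\<close>, so equality holds as
      functions and not merely on H.\<close>
    case False
    then show ?thesis
      using op_undefined is_adjointD(1)[OF S'] is_adjointD(1)[OF S''] by metis
  qed
qed

text \<open>The functional x \<mapsto> \<T> (S x * y) is A-linear, and Cauchy-Schwarz bounds its
  square by k^2 \<T> (y^2) times \<T> (x^2); this supplies the constant c of the representation
  theorem.\<close>

lemma riesz_adjoint_value:
  assumes S: "S \<in> T_bounded_ops \<iota> T" and y: "y \<in> \<H>"
  obtains z where "z \<in> \<H>" "\<And>x. x \<in> \<H> \<Longrightarrow> \<T> (S x * y) = \<T> (x * z)"
proof -
  obtain k where k: "k \<in> \<A>" "0 \<le> k" "\<And>x. x \<in> \<H> \<Longrightarrow> \<T> (S x * S x) \<le> k * k * \<T> (x * x)"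
    using op_bound[OF S] by blast
  define Y where "Y = \<T> (y * y)"
  have Y: "Y \<in> \<A>" "0 \<le> Y" using y T_square_nonneg[OF y] by (simp_all add: Y_def)
  have bound: "\<T> (S x * y) \<le> t *\<^sub>R (k * k * Y) + (1 / t) *\<^sub>R \<T> (x * x)" if t: "0 < t" and x: "x \<in> \<H>" for t x
  proof -
    have "\<T> (S x * y) * \<T> (S x * y) \<le> \<T> (S x * S x) * Y"
      unfolding Y_def by (rule cauchy_schwarz[OF op_mem[OF S x] y])
    also have "\<dots> \<le> (k * k * \<T> (x * x)) * Y" using k(3)[OF x] Y by (intro mult_right_mono)
    finally have le: "\<T> (S x * y) * \<T> (S x * y) \<le> (k * k * \<T> (x * x)) * Y" .
    show ?thesis
    proof (rule le_by_points[of "{\<T> (S x * y), k, Y, \<T> (x * x)}"])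
      fix V \<omega> assume p: "real_point one V \<omega>" and Z: "{\<T> (S x * y), k, Y, \<T> (x * x)} \<subseteq> V"
      interpret real_point one V \<omega> by fact
      have [simp]: "\<T> (S x * y) \<in> V" "k \<in> V" "Y \<in> V" "\<T> (x * x) \<in> V" using Z by auto
      have "\<omega> (\<T> (S x * y)) * \<omega> (\<T> (S x * y)) \<le> (\<omega> k * \<omega> k * \<omega> Y) * \<omega> (\<T> (x * x))"
        using pt_mono[OF _ _ le] by (simp add: ac_simps)
      moreover have "0 \<le> \<omega> Y" "0 \<le> \<omega> (\<T> (x * x))"
        using pt_mono[OF _ _ Y(2)] pt_mono[OF _ _ T_square_nonneg[OF x]] by simp_all
      ultimately have "\<omega> (\<T> (S x * y)) \<le> t * (\<omega> k * \<omega> k * \<omega> Y) + \<omega> (\<T> (x * x)) / t"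
        using t by (intro le_of_square_le) simp_all
      then show "\<omega> (\<T> (S x * y)) \<le> \<omega> (t *\<^sub>R (k * k * Y) + (1 / t) *\<^sub>R \<T> (x * x))" by simp
    qed simp
  qed
  have 1: "\<T> (S x * y) \<in> \<A>" if "x \<in> \<H>" for x using op_mem[OF S that] y by simp
  have 2: "\<T> (S (x + x') * y) = \<T> (S x * y) + \<T> (S x' * y)" if "x \<in> \<H>" "x' \<in> \<H>" for x x'
    using op_plus[OF S that] op_mem[OF S] that y by (simp add: distrib_right)
  have 3: "\<T> (S (a * x) * y) = a * \<T> (S x * y)" if "a \<in> \<A>" "x \<in> \<H>" for a x
    using op_mult[OF S that] op_mem[OF S] that y by (simp add: mult.assoc)
  have "k * k * Y \<in> \<A>" using k Y by simp
  then obtain z where z: "z \<in> \<H>" "\<And>x. x \<in> \<H> \<Longrightarrow> \<T> (z * x) = \<T> (S x * y)"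
    using functional_representation[of "\<lambda>x. \<T> (S x * y)" "k * k * Y", OF 1 2 3 _ bound] by blast
  show thesis by (rule that[OF z(1)]) (use z(2) in \<open>simp add: mult_commute\<close>)
qed

text \<open>The values are chosen one y at a time; additivity and A-homogeneity then follow from
  nondegeneracy, and the bound k of S serves for the adjoint as well.\<close>

lemma is_adjoint_exists:
  assumes S: "S \<in> T_bounded_ops \<iota> T"
  obtains S' where "is_adjoint S S'"
proof -
  have "\<exists>S'. \<forall>y\<in>\<H>. S' y \<in> \<H> \<and> (\<forall>x\<in>\<H>. \<T> (S x * y) = \<T> (x * S' y))"
    using riesz_adjoint_value[OF S] by (intro bchoice) metis
  then obtain S0 where S0: "\<And>y. y \<in> \<H> \<Longrightarrow> S0 y \<in> \<H>"
    "\<And>x y. x \<in> \<H> \<Longrightarrow> y \<in> \<H> \<Longrightarrow> \<T> (S x * y) = \<T> (x * S0 y)" by blast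
  obtain k where k: "k \<in> \<A>" "0 \<le> k" "\<And>x. x \<in> \<H> \<Longrightarrow> \<T> (S x * S x) \<le> k * k * \<T> (x * x)"
    using op_bound[OF S] by blast
  define S' where "S' = restrict S0 \<H>"
  have S': "S' y = S0 y" if "y \<in> \<H>" for y using that by (simp add: S'_def)
  have "S' \<in> T_bounded_ops \<iota> T"
  proof (rule T_bounded_opsI[OF _ _ _ _ k(1,2)])
    fix y assume y: "y \<in> \<H>"
    show "S' y \<in> \<H>" using S0(1) S' y by simp
    fix y' assume y': "y' \<in> \<H>"
    show "S' (y + y') = S' y + S' y'"
    proof (rule H_eqI)
      fix x assume x: "x \<in> \<H>"
      have "\<T> (x * S' (y + y')) = \<T> (S x * y + S x * y')"
        using S0(2)[of x "y + y'"] S'[of "y + y'"] x y y' by (simp add: distrib_left)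
      also have "\<dots> = \<T> (S x * y) + \<T> (S x * y')" using op_mem[OF S x] y y' by (intro T_add H_mult)
      also have "\<dots> = \<T> (x * S' y) + \<T> (x * S' y')" using S0(2) S' x y y' by simp
      also have "\<dots> = \<T> (x * (S' y + S' y'))" using S0(1) S' x y y' by (simp add: distrib_left)
      finally show "\<T> (x * S' (y + y')) = \<T> (x * (S' y + S' y'))" .
    qed (use S0(1) S' y y' in simp_all)
  next
    fix a y assume a: "a \<in> \<A>" and y: "y \<in> \<H>"
    show "S' (a * y) = a * S' y"
    proof (rule H_eqI)
      fix x assume x: "x \<in> \<H>"
      note c = mult_left_commute[of _ a]
      have "\<T> (x * S' (a * y)) = \<T> (a * (S x * y))"
        using S0(2)[of x "a * y"] S'[of "a * y"] x y a by (simp only: A_mult_H c)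
      also have "\<dots> = a * \<T> (S x * y)" using op_mem[OF S x] a y by simp
      also have "\<dots> = a * \<T> (x * S' y)" using S0(2) S' x y by simp
      also have "\<dots> = \<T> (x * (a * S' y))" unfolding c using S0(1) S' x y a by simp
      finally show "\<T> (x * S' (a * y)) = \<T> (x * (a * S' y))" .
    qed (use S0(1) S' a y in simp_all)
  next
    fix y assume y: "y \<in> \<H>"
    let ?w = "S' y"
    have w: "?w \<in> \<H>" using S0(1) S' y by simp
    have eq: "\<T> (?w * ?w) = \<T> (S ?w * y)" using S0(2)[OF w y] S'[OF y] by simp
    \<comment> \<open>With w = S' y, Cauchy-Schwarz gives \<T> (w^2)^2 \<le> k^2 \<T> (w^2) \<T>
      (y^2). One factor \<T> (w^2) is cancelled at each point, where it is a real number.\<close>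
    have "\<T> (?w * ?w) * \<T> (?w * ?w) \<le> \<T> (S ?w * S ?w) * \<T> (y * y)"
      unfolding eq by (rule cauchy_schwarz[OF op_mem[OF S w] y])
    also have "\<dots> \<le> (k * k * \<T> (?w * ?w)) * \<T> (y * y)"
      using k(3)[OF w] T_square_nonneg[OF y] by (intro mult_right_mono)
    finally have le: "\<T> (?w * ?w) * \<T> (?w * ?w) \<le> (k * k * \<T> (?w * ?w)) * \<T> (y * y)" .
    show "\<T> (?w * ?w) \<le> k * k * \<T> (y * y)"
    proof (rule le_by_points[of "{\<T> (?w * ?w), k, \<T> (y * y)}"])
      fix V \<omega> assume p: "real_point one V \<omega>" and Z: "{\<T> (?w * ?w), k, \<T> (y * y)} \<subseteq> V"
      interpret real_point one V \<omega> by fact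
      have [simp]: "\<T> (?w * ?w) \<in> V" "k \<in> V" "\<T> (y * y) \<in> V" using Z by auto
      define W K Y where "W = \<omega> (\<T> (?w * ?w))" "K = \<omega> k" "Y = \<omega> (\<T> (y * y))"
      have pos: "0 \<le> W" "0 \<le> Y"
        using pt_mono[OF _ _ T_square_nonneg[OF w]] pt_mono[OF _ _ T_square_nonneg[OF y]]
        by (simp_all add: W_K_Y_def)
      have "W * W \<le> W * (K * K * Y)" using pt_mono[OF _ _ le] by (simp add: W_K_Y_def ac_simps)
      then have "W \<le> K * K * Y" using pos by (cases "W = 0") simp_all
      then show "\<omega> (\<T> (?w * ?w)) \<le> \<omega> (k * k * \<T> (y * y))" by (simp add: W_K_Y_def)
    qed simp
  qed (simp add: S'_def)
  then have "is_adjoint S S'" using S0(2) S' by (simp add: is_adjoint_def)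
  then show thesis by (rule that)
qed

lemma op_adjoint_eqI: "is_adjoint S S' \<Longrightarrow> op_adjoint \<iota> T S = S'"
  unfolding op_adjoint_def T_inner_def
  by (rule the_equality) (auto simp: is_adjoint_def intro: is_adjoint_unique[of S, unfolded is_adjoint_def])

lemma is_adjoint_op_adjoint: "S \<in> T_bounded_ops \<iota> T \<Longrightarrow> is_adjoint S (op_adjoint \<iota> T S)"
  using is_adjoint_exists op_adjoint_eqI by metis

section \<open>Sums, multiples and composites with their adjoints\<close>

lemma op_add_bounded:
  assumes S: "S \<in> T_bounded_ops \<iota> T" and R: "R \<in> T_bounded_ops \<iota> T"
  shows "op_add \<iota> T S R \<in> T_bounded_ops \<iota> T"
proof -
  obtain k where k: "k \<in> \<A>" "0 \<le> k" "\<And>x. x \<in> \<H> \<Longrightarrow> \<T> (S x * S x) \<le> k * k * \<T> (x * x)"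
    using op_bound[OF S] by blast
  obtain l where l: "l \<in> \<A>" "0 \<le> l" "\<And>x. x \<in> \<H> \<Longrightarrow> \<T> (R x * R x) \<le> l * l * \<T> (x * x)"
    using op_bound[OF R] by blast
  \<comment> \<open>From (s + r)^2 \<le> 2 s^2 + 2 r^2 and 2 k^2 + 2 l^2 \<le> 4 (k + l)^2.\<close>
  define m where "m = 2 *\<^sub>R (k + l)"
  have m: "m \<in> \<A>" "0 \<le> m" using k l by (simp_all add: m_def scaleR_nonneg_nonneg)
  show ?thesis
  proof (rule T_bounded_opsI[OF _ _ _ _ m])
    fix x assume x: "x \<in> \<H>"
    let ?s = "S x" and ?r = "R x" and ?X = "\<T> (x * x)"
    have sr: "?s \<in> \<H>" "?r \<in> \<H>" using op_mem[OF S x] op_mem[OF R x] by simp_all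
    have "(?s + ?r) * (?s + ?r) \<le> 2 *\<^sub>R (?s * ?s) + 2 *\<^sub>R (?r * ?r)"
    proof (rule le_by_points[of "{?s, ?r}"])
      fix V \<omega> assume p: "real_point one V \<omega>" and Z: "{?s, ?r} \<subseteq> V"
      interpret real_point one V \<omega> by fact
      have "0 \<le> (\<omega> ?s - \<omega> ?r) * (\<omega> ?s - \<omega> ?r)" by simp
      then show "\<omega> ((?s + ?r) * (?s + ?r)) \<le> \<omega> (2 *\<^sub>R (?s * ?s) + 2 *\<^sub>R (?r * ?r))"
        using Z by (simp add: algebra_simps)
    qed simp
    then have "\<T> ((?s + ?r) * (?s + ?r)) \<le> \<T> (2 *\<^sub>R (?s * ?s) + 2 *\<^sub>R (?r * ?r))"
      using sr by (intro T_ext_mono) simp_all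
    also have "\<dots> = 2 *\<^sub>R \<T> (?s * ?s) + 2 *\<^sub>R \<T> (?r * ?r)" using sr by simp
    also have "\<dots> \<le> 2 *\<^sub>R (k * k * ?X) + 2 *\<^sub>R (l * l * ?X)"
      using k(3)[OF x] l(3)[OF x] by (intro add_mono scaleR_left_mono) auto
    also have "\<dots> \<le> m * m * ?X"
    proof (rule le_by_points[of "{k, l, ?X}"])
      fix V \<omega> assume p: "real_point one V \<omega>" and Z: "{k, l, ?X} \<subseteq> V"
      interpret real_point one V \<omega> by fact
      have [simp]: "k \<in> V" "l \<in> V" "?X \<in> V" using Z by auto
      define K L X where "K = \<omega> k" "L = \<omega> l" "X = \<omega> ?X"
      have pos: "0 \<le> K" "0 \<le> L" "0 \<le> X"
        using pt_mono[OF _ _ k(2)] pt_mono[OF _ _ l(2)] pt_mono[OF _ _ T_square_nonneg[OF x]]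
        by (simp_all add: K_L_X_def)
      then have "0 \<le> (2 * (K * K) + 2 * (L * L) + 8 * (K * L)) * X" by simp
      then have "2 * (K * K * X) + 2 * (L * L * X) \<le> 4 * ((K + L) * (K + L) * X)"
        by (simp add: algebra_simps)
      then show "\<omega> (2 *\<^sub>R (k * k * ?X) + 2 *\<^sub>R (l * l * ?X)) \<le> \<omega> (m * m * ?X)"
        by (simp add: m_def K_L_X_def)
    qed simp
    finally show "\<T> (op_add \<iota> T S R x * op_add \<iota> T S R x) \<le> m * m * ?X"
      using x by (simp add: op_add_def)
  qed (use op_mem[OF S] op_mem[OF R] op_plus[OF S] op_plus[OF R] op_mult[OF S] op_mult[OF R]
      in \<open>simp_all add: op_add_def distrib_left\<close>)
qed

lemma op_scale_bounded:
  assumes S: "S \<in> T_bounded_ops \<iota> T" and a: "a \<in> \<A>"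
  shows "op_scale \<iota> T a S \<in> T_bounded_ops \<iota> T"
proof -
  obtain k where k: "k \<in> \<A>" "0 \<le> k" "\<And>x. x \<in> \<H> \<Longrightarrow> \<T> (S x * S x) \<le> k * k * \<T> (x * x)"
    using op_bound[OF S] by blast
  \<comment> \<open>The bound must be positive although a need not be; squaring removes the absolute
    value again.\<close>
  have m: "\<bar>a\<bar> * k \<in> \<A>" "0 \<le> \<bar>a\<bar> * k" using a k by simp_all
  show ?thesis
  proof (rule T_bounded_opsI[OF _ _ _ _ m])
    fix x assume x: "x \<in> \<H>"
    let ?X = "\<T> (x * x)"
    have "(a * S x) * (a * S x) = (a * a) * (S x * S x)" by (simp add: mult_ac_simps)
    then have "\<T> ((a * S x) * (a * S x)) = (a * a) * \<T> (S x * S x)"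
      using a op_mem[OF S x] by simp
    also have "\<dots> \<le> (a * a) * (k * k * ?X)"
      using k(3)[OF x] by (intro mult_left_mono f_algebra_square_nonneg)
    also have "\<dots> = (\<bar>a\<bar> * k) * (\<bar>a\<bar> * k) * ?X"
      unfolding square_of_abs[of a, symmetric] by (simp add: mult_ac_simps)
    finally show "\<T> (op_scale \<iota> T a S x * op_scale \<iota> T a S x) \<le> (\<bar>a\<bar> * k) * (\<bar>a\<bar> * k) * ?X"
      using x by (simp add: op_scale_def)
  qed (use a op_mem[OF S] op_plus[OF S] op_mult[OF S] mult_left_commute[of _ a] in \<open>simp_all add: op_scale_def distrib_left\<close>)
qed

lemma op_comp_bounded:
  assumes S: "S \<in> T_bounded_ops \<iota> T" and R: "R \<in> T_bounded_ops \<iota> T"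
  shows "op_comp \<iota> T S R \<in> T_bounded_ops \<iota> T"
proof -
  obtain k where k: "k \<in> \<A>" "0 \<le> k" "\<And>x. x \<in> \<H> \<Longrightarrow> \<T> (S x * S x) \<le> k * k * \<T> (x * x)"
    using op_bound[OF S] by blast
  obtain l where l: "l \<in> \<A>" "0 \<le> l" "\<And>x. x \<in> \<H> \<Longrightarrow> \<T> (R x * R x) \<le> l * l * \<T> (x * x)"
    using op_bound[OF R] by blast
  have m: "k * l \<in> \<A>" "0 \<le> k * l" using k l by simp_all
  show ?thesis
  proof (rule T_bounded_opsI[OF _ _ _ _ m])
    fix x assume x: "x \<in> \<H>"
    have "\<T> (S (R x) * S (R x)) \<le> (k * k) * \<T> (R x * R x)" using k(3)[OF op_mem[OF R x]] .
    also have "\<dots> \<le> (k * k) * (l * l * \<T> (x * x))"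
      using l(3)[OF x] by (intro mult_left_mono f_algebra_square_nonneg)
    also have "\<dots> = (k * l) * (k * l) * \<T> (x * x)" by (simp add: mult_ac_simps)
    finally show "\<T> (op_comp \<iota> T S R x * op_comp \<iota> T S R x) \<le> (k * l) * (k * l) * \<T> (x * x)"
      using x by (simp add: op_comp_def compose_def)
  qed (use op_mem[OF S] op_mem[OF R] op_plus[OF S] op_plus[OF R] op_mult[OF S] op_mult[OF R]
      in \<open>simp_all add: op_comp_def compose_def\<close>)
qed

lemma op_id_bounded: "op_id \<iota> T \<in> T_bounded_ops \<iota> T"
  by (rule T_bounded_opsI[of _ one]) (simp_all add: op_id_def)

lemma is_adjoint_add:
  assumes S: "S \<in> T_bounded_ops \<iota> T" "is_adjoint S S'" and R: "R \<in> T_bounded_ops \<iota> T" "is_adjoint R R'"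
  shows "is_adjoint (op_add \<iota> T S R) (op_add \<iota> T S' R')"
  unfolding is_adjoint_def
proof (intro conjI ballI)
  note S' = is_adjointD[OF S(2)] and R' = is_adjointD[OF R(2)]
  show "op_add \<iota> T S' R' \<in> T_bounded_ops \<iota> T" using S' R' by (intro op_add_bounded)
  fix x y assume "x \<in> \<H>" "y \<in> \<H>"
  then show "\<T> (op_add \<iota> T S R x * y) = \<T> (x * op_add \<iota> T S' R' y)"
    using op_mem[OF S(1)] op_mem[OF R(1)] op_mem[OF S'(1)] op_mem[OF R'(1)] S'(2) R'(2)
    by (simp add: op_add_def distrib_left distrib_right)
qed

lemma is_adjoint_scale:
  assumes S: "S \<in> T_bounded_ops \<iota> T" "is_adjoint S S'" and a: "a \<in> \<A>"
  shows "is_adjoint (op_scale \<iota> T a S) (op_scale \<iota> T a S')"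
  unfolding is_adjoint_def
proof (intro conjI ballI)
  note S' = is_adjointD[OF S(2)]
  show "op_scale \<iota> T a S' \<in> T_bounded_ops \<iota> T" using S' a by (intro op_scale_bounded)
  fix x y assume xy: "x \<in> \<H>" "y \<in> \<H>"
  have "\<T> (a * S x * y) = a * \<T> (S x * y)" using op_mem[OF S(1)] xy a by (simp add: mult.assoc)
  also have "\<dots> = a * \<T> (x * S' y)" using S'(2) xy by simp
  also have "\<dots> = \<T> (a * (x * S' y))" using op_mem[OF S'(1)] xy a by simp
  also have "a * (x * S' y) = x * (a * S' y)" by (rule mult_left_commute)
  finally show "\<T> (op_scale \<iota> T a S x * y) = \<T> (x * op_scale \<iota> T a S' y)"
    using xy by (simp add: op_scale_def)
qed

lemma is_adjoint_comp:
  assumes S: "is_adjoint S S'" and R: "R \<in> T_bounded_ops \<iota> T" "is_adjoint R R'"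
  shows "is_adjoint (op_comp \<iota> T S R) (op_comp \<iota> T R' S')"
  unfolding is_adjoint_def
proof (intro conjI ballI)
  note S' = is_adjointD[OF S] and R' = is_adjointD[OF R(2)]
  show "op_comp \<iota> T R' S' \<in> T_bounded_ops \<iota> T" using S' R' by (intro op_comp_bounded)
  fix x y assume "x \<in> \<H>" "y \<in> \<H>"
  then show "\<T> (op_comp \<iota> T S R x * y) = \<T> (x * op_comp \<iota> T R' S' y)"
    using op_mem[OF R(1)] op_mem[OF S'(1)] S'(2) R'(2) by (simp add: op_comp_def compose_def)
qed

text \<open>The form is symmetric because multiplication is commutative; membership of S is required
  since S now plays the role of the adjoint.\<close>

lemma is_adjoint_sym:
  assumes "S \<in> T_bounded_ops \<iota> T" "is_adjoint S S'"
  shows "is_adjoint S' S"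
  using assms is_adjointD(2)[OF assms(2)] mult_commute unfolding is_adjoint_def by metis

lemma is_adjoint_id: "is_adjoint (op_id \<iota> T) (op_id \<iota> T)"
  by (simp add: is_adjoint_def op_id_bounded) (simp add: op_id_def)

end

theorem proposition7p1:
  fixes e :: "'e::dedekind_complete_riesz_space"
    and T :: "'e \<Rightarrow> 'e"
    and \<iota> :: "'e \<Rightarrow> 'u::{universally_complete_riesz_space,f_algebra}"
    and S R :: "'u \<Rightarrow> 'u"
    and a :: 'u
  assumes "weak_order_unit e"
    and "conditional_expectation T"
    and "T e = e"
    and "strictly_positive T"
    and "universal_completion \<iota>"
    and "mult_unit (\<iota> e)"
    and "S \<in> T_bounded_ops \<iota> T"
    and "R \<in> T_bounded_ops \<iota> T"
    and "a \<in> range_T \<iota> T"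
  shows "op_adjoint \<iota> T (op_add \<iota> T S R) = op_add \<iota> T (op_adjoint \<iota> T S) (op_adjoint \<iota> T R)
    \<and> op_adjoint \<iota> T (op_scale \<iota> T a S) = op_scale \<iota> T a (op_adjoint \<iota> T S)
    \<and> op_adjoint \<iota> T (op_comp \<iota> T S R) = op_comp \<iota> T (op_adjoint \<iota> T R) (op_adjoint \<iota> T S)
    \<and> op_adjoint \<iota> T (op_adjoint \<iota> T S) = S
    \<and> op_adjoint \<iota> T (op_id \<iota> T) = op_id \<iota> T"
proof -
  interpret cond_exp T \<iota> by unfold_locales fact+
  \<comment> \<open>On \<iota> of positive elements the extension acts as T, so T e = e makes
    \<iota> e a fixed point.\<close>
  have one: "\<iota> e \<in> range_T \<iota> T"
    using i_L_pos[of e] assms(1,3) by (simp add: A_iff weak_order_unit_def)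
  interpret cond_exp_L2 T \<iota> "\<iota> e" by unfold_locales (fact assms one)+
  note S = assms(7) is_adjoint_op_adjoint[OF assms(7)]
    and R = assms(8) is_adjoint_op_adjoint[OF assms(8)]
  show ?thesis
    using is_adjoint_add[OF S R] is_adjoint_scale[OF S assms(9)] is_adjoint_comp[OF S(2) R]
      is_adjoint_sym[OF S] is_adjoint_id
    by (intro conjI op_adjoint_eqI)
qed

end
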